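(* Let $\Lambda$ be a finite $k$-graph with no sources. If $\{t_\lambda\}_{\lambda\in\Lambda}$ is a monic representation of $C^*(\Lambda)$ on a Hilbert space $\mathcal H$ with cyclic vector $\xi$, then it is unitarily equivalent to the representation $\{S_\lambda\}$ of $C^*(\Lambda)$ on $L^2(\Lambda^\infty,\mu_\pi)$ associated (via $S_\lambda f=f_\lambda\cdot(f\circ\sigma^{d(\lambda)})$) to a $\Lambda$-projective system on $(\Lambda^\infty,\mu_\pi)$ with the standard prefixing and coding maps. Conversely, any representation of $C^*(\Lambda)$ on $L^2(\Lambda^\infty,\mu)$ (for a Borel measure $\mu$) arising in this way from a $\Lambda$-projective system on $(\Lambda^\infty,\mu)$ with the standard prefixing and coding maps is monic.
   Context: $k$-graph: countable small category with degree functor $d:\Lambda\to\mathbb N^k$ with unique factorization; finite, no sources. $\Lambda^\infty$: infinite paths, cylinder sets $Z(\lambda)$, Borel $\sigma$-algebra; $C(\Lambda^\infty)$ embeds in $C^*(\Lambda)$ via $\chi_{Z(\lambda)}\mapsto t_\lambda t_\lambda^*$. Standard coding maps $\sigma^m(x)(p,q)=x(p+m,q+m)$, standard prefixing maps $\sigma_\lambda:Z(s(\lambda))\to Z(\lambda)$, $x\mapsto\lambda x$. A representation $\{t_\lambda\}$ of $C^*(\Lambda)$ on $\mathcal H$ is monic if $t_\lambda\ne0$ for all $\lambda$ and there is $\xi\in\mathcal H$ with $\overline{\operatorname{span}}\{t_\lambda t_\lambda^*\xi:\lambda\in\Lambda\}=\mathcal H$. For such $\xi$, $\mu_\pi$ is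 the Borel measure on $\Lambda^\infty$ with $\mu_\pi(Z(\lambda))=\langle\xi,t_\lambda t_\lambda^*\xi\rangle$. A $\Lambda$-projective system on $(\Lambda^\infty,\mu)$ with the standard maps: the maps form a $\Lambda$-semibranching function system (for each $m$, $\{Z(\lambda)\}_{\lambda\in\Lambda^m}$ partitions $\Lambda^\infty$; $\mu(Z(v))>0$; $\mu\circ\sigma_\lambda\ll\mu$ with positive derivative a.e. on $Z(s(\lambda))$), together with $f_\lambda\in L^2(\Lambda^\infty,\mu)$ with $|f_\lambda|^2=d(\mu\circ\sigma_\lambda^{-1})/d\mu$ (push-forward; nonzero a.e. on $Z(\lambda)$) and $f_\lambda\cdot(f_\nu\circ\sigma^{d(\lambda)})=f_{\lambda\nu}$ whenever $s(\lambda)=r(\nu)$. *)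

theory Defs
  imports "HOL-Analysis.Analysis" "HOL-Probability.Probability" "HOL-Library.Function_Algebras"
begin

text \<open>A k-graph is given by its set of morphisms, range and source maps (objects are identified
with identity morphisms, i.e. vertices), composition and degree functor into N^k, where N^k is
represented by functions nat => nat vanishing from index k on.\<close>

record 'a kgraph =
  mor :: "'a set"
  rng :: "'a \<Rightarrow> 'a"
  src :: "'a \<Rightarrow> 'a"
  cmp :: "'a \<Rightarrow> 'a \<Rightarrow> 'a"
  deg :: "'a \<Rightarrow> nat \<Rightarrow> nat"

definition Nk :: "nat \<Rightarrow> (nat \<Rightarrow> nat) set" where
  "Nk k = {n. \<forall>i\<ge>k. n i = 0}"

definition is_kgraph :: "nat \<Rightarrow> 'a kgraph \<Rightarrow> bool" where
  "is_kgraph k G \<longleftrightarrow>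
     (\<forall>l\<in>mor G. deg G l \<in> Nk k \<and> rng G l \<in> mor G \<and> src G l \<in> mor G) \<and>
     (\<forall>l\<in>mor G. rng G (rng G l) = rng G l \<and> src G (rng G l) = rng G l \<and>
                 rng G (src G l) = src G l \<and> src G (src G l) = src G l) \<and>
     (\<forall>l\<in>mor G. \<forall>m\<in>mor G. src G l = rng G m \<longrightarrow>
         cmp G l m \<in> mor G \<and> rng G (cmp G l m) = rng G l \<and> src G (cmp G l m) = src G m \<and>
         deg G (cmp G l m) = deg G l + deg G m) \<and>
     (\<forall>l\<in>mor G. \<forall>m\<in>mor G. \<forall>n\<in>mor G. src G l = rng G m \<longrightarrow> src G m = rng G n \<longrightarrow>
         cmp G (cmp G l m) n = cmp G l (cmp G m n)) \<and>
     (\<forall>l\<in>mor G. cmp G (rng G l) l = l \<and> cmp G l (src G l) = l) \<and>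
     (\<forall>l\<in>mor G. \<forall>m n. deg G l = m + n \<longrightarrow>
         (\<exists>!p. fst p \<in> mor G \<and> snd p \<in> mor G \<and> src G (fst p) = rng G (snd p) \<and>
               cmp G (fst p) (snd p) = l \<and> deg G (fst p) = m \<and> deg G (snd p) = n))"

definition vertices :: "'a kgraph \<Rightarrow> 'a set" where
  "vertices G = {v\<in>mor G. deg G v = 0}"

definition finite_kgraph :: "'a kgraph \<Rightarrow> bool" where
  "finite_kgraph G \<longleftrightarrow> (\<forall>n. finite {l\<in>mor G. deg G l = n})"

definition no_sources :: "nat \<Rightarrow> 'a kgraph \<Rightarrow> bool" where
  "no_sources k G \<longleftrightarrow> (\<forall>v\<in>vertices G. \<forall>n\<in>Nk k. \<exists>l\<in>mor G. rng G l = v \<and> deg G l = n)"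

type_synonym 'a ipath = "(nat \<Rightarrow> nat) \<times> (nat \<Rightarrow> nat) \<Rightarrow> 'a"

text \<open>Degree-preserving functors from Omega_k (morphisms (p,q) with p <= q in N^k) into Lambda,
made extensional (value undefined off the morphisms of Omega_k).\<close>
definition inf_paths :: "nat \<Rightarrow> 'a kgraph \<Rightarrow> 'a ipath set" where
  "inf_paths k G = {x.
     (\<forall>p\<in>Nk k. \<forall>q\<in>Nk k. p \<le> q \<longrightarrow>
        x (p, q) \<in> mor G \<and> deg G (x (p, q)) = q - p \<and>
        rng G (x (p, q)) = x (p, p) \<and> src G (x (p, q)) = x (q, q)) \<and>
     (\<forall>p\<in>Nk k. \<forall>q\<in>Nk k. \<forall>r\<in>Nk k. p \<le> q \<longrightarrow> q \<le> r \<longrightarrow>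
        cmp G (x (p, q)) (x (q, r)) = x (p, r)) \<and>
     (\<forall>p q. \<not> (p \<in> Nk k \<and> q \<in> Nk k \<and> p \<le> q) \<longrightarrow> x (p, q) = undefined)}"

definition cyl :: "nat \<Rightarrow> 'a kgraph \<Rightarrow> 'a \<Rightarrow> 'a ipath set" where
  "cyl k G l = {x\<in>inf_paths k G. x (0, deg G l) = l}"

definition path_borel :: "nat \<Rightarrow> 'a kgraph \<Rightarrow> 'a ipath set set" where
  "path_borel k G = sigma_sets (inf_paths k G)
     {U. U \<subseteq> inf_paths k G \<and> openin (topology_generated_by (cyl k G ` mor G)) U}"

definition shift :: "nat \<Rightarrow> (nat \<Rightarrow> nat) \<Rightarrow> 'a ipath \<Rightarrow> 'a ipath" where
  "shift k m x = (\<lambda>(p, q). if p \<in> Nk k \<and> q \<in> Nk k \<and> p \<le> q then x (p + m, q + m) else undefined)"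

definition prefix :: "nat \<Rightarrow> 'a kgraph \<Rightarrow> 'a \<Rightarrow> 'a ipath \<Rightarrow> 'a ipath" where
  "prefix k G l x = (THE y. y \<in> inf_paths k G \<and> y (0, deg G l) = l \<and> shift k (deg G l) y = x)"

definition borel_on_paths :: "nat \<Rightarrow> 'a kgraph \<Rightarrow> 'a ipath measure \<Rightarrow> bool" where
  "borel_on_paths k G \<mu> \<longleftrightarrow> space \<mu> = inf_paths k G \<and> sets \<mu> = path_borel k G"

definition std_sbfs :: "nat \<Rightarrow> 'a kgraph \<Rightarrow> 'a ipath measure \<Rightarrow> bool" where
  "std_sbfs k G \<mu> \<longleftrightarrow>
     (\<forall>l\<in>mor G. cyl k G l \<in> sets \<mu>) \<and>
     (\<forall>n\<in>Nk k. (\<Union>l\<in>{l\<in>mor G. deg G l = n}. cyl k G l) = inf_paths k G \<and>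
                disjoint_family_on (cyl k G) {l\<in>mor G. deg G l = n}) \<and>
     (\<forall>n\<in>Nk k. shift k n \<in> measurable \<mu> \<mu>) \<and>
     (\<forall>v\<in>vertices G. emeasure \<mu> (cyl k G v) > 0) \<and>
     (\<forall>l\<in>mor G.
        prefix k G l \<in> measurable (restrict_space \<mu> (cyl k G (src G l))) \<mu> \<and>
        (\<forall>A\<in>sets \<mu>. A \<subseteq> cyl k G (src G l) \<longrightarrow> prefix k G l ` A \<in> sets \<mu>) \<and>
        (\<exists>\<Phi>\<in>borel_measurable \<mu>.
            (AE x in \<mu>. x \<in> cyl k G (src G l) \<longrightarrow> \<Phi> x > 0) \<and>
            (\<forall>A\<in>sets \<mu>. A \<subseteq> cyl k G (src G l) \<longrightarrow>
                emeasure \<mu> (prefix k G l ` A) = (\<integral>\<^sup>+x\<in>A. \<Phi> x \<partial>\<mu>))))"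

definition proj_system :: "nat \<Rightarrow> 'a kgraph \<Rightarrow> 'a ipath measure \<Rightarrow> ('a \<Rightarrow> 'a ipath \<Rightarrow> complex) \<Rightarrow> bool" where
  "proj_system k G \<mu> f \<longleftrightarrow>
     std_sbfs k G \<mu> \<and>
     (\<forall>l\<in>mor G.
        f l \<in> borel_measurable \<mu> \<and> integrable \<mu> (\<lambda>x. (cmod (f l x))\<^sup>2) \<and>
        (\<forall>A\<in>sets \<mu>. emeasure \<mu> {x\<in>cyl k G (src G l). prefix k G l x \<in> A}
                        = (\<integral>\<^sup>+x\<in>A. ennreal ((cmod (f l x))\<^sup>2) \<partial>\<mu>)) \<and>
        (AE x in \<mu>. x \<in> cyl k G l \<longrightarrow> f l x \<noteq> 0)) \<and>
     (\<forall>l\<in>mor G. \<forall>m\<in>mor G. src G l = rng G m \<longrightarrow>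
        (AE x in \<mu>. f l x * f m (shift k (deg G l) x) = f (cmp G l m) x))"

definition proj_rep :: "nat \<Rightarrow> 'a kgraph \<Rightarrow> ('a \<Rightarrow> 'a ipath \<Rightarrow> complex) \<Rightarrow> 'a \<Rightarrow> ('a ipath \<Rightarrow> complex) \<Rightarrow> ('a ipath \<Rightarrow> complex)" where
  "proj_rep k G f l g = (\<lambda>x. f l x * g (shift k (deg G l) x))"

text \<open>A complex Hilbert space presented as a carrier with scalar multiplication and a
(semi-)inner product, linear in the second argument; vectors are identified modulo null vectors.\<close>
record 'h hspace =
  hcar :: "'h set"
  hsc :: "complex \<Rightarrow> 'h \<Rightarrow> 'h"
  hip :: "'h \<Rightarrow> 'h \<Rightarrow> complex"

definition hnorm :: "('h::ab_group_add) hspace \<Rightarrow> 'h \<Rightarrow> real" where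
  "hnorm H x = sqrt (Re (hip H x x))"

definition hnull :: "('h::ab_group_add) hspace \<Rightarrow> 'h \<Rightarrow> bool" where
  "hnull H x \<longleftrightarrow> hip H x x = 0"

definition is_hilbert_sp :: "('h::ab_group_add) hspace \<Rightarrow> bool" where
  "is_hilbert_sp H \<longleftrightarrow>
     0 \<in> hcar H \<and> (\<forall>x\<in>hcar H. \<forall>y\<in>hcar H. x + y \<in> hcar H) \<and> (\<forall>x\<in>hcar H. - x \<in> hcar H) \<and>
     (\<forall>c. \<forall>x\<in>hcar H. hsc H c x \<in> hcar H) \<and>
     (\<forall>x\<in>hcar H. hsc H 1 x = x) \<and>
     (\<forall>a b. \<forall>x\<in>hcar H. hsc H a (hsc H b x) = hsc H (a * b) x) \<and>
     (\<forall>a b. \<forall>x\<in>hcar H. hsc H (a + b) x = hsc H a x + hsc H b x) \<and>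
     (\<forall>a. \<forall>x\<in>hcar H. \<forall>y\<in>hcar H. hsc H a (x + y) = hsc H a x + hsc H a y) \<and>
     (\<forall>x\<in>hcar H. \<forall>y\<in>hcar H. \<forall>z\<in>hcar H. hip H x (y + z) = hip H x y + hip H x z) \<and>
     (\<forall>a. \<forall>x\<in>hcar H. \<forall>y\<in>hcar H. hip H x (hsc H a y) = a * hip H x y) \<and>
     (\<forall>x\<in>hcar H. \<forall>y\<in>hcar H. hip H y x = cnj (hip H x y)) \<and>
     (\<forall>x\<in>hcar H. Im (hip H x x) = 0 \<and> Re (hip H x x) \<ge> 0) \<and>
     (\<forall>X :: nat \<Rightarrow> 'h. (\<forall>n. X n \<in> hcar H) \<and> (\<forall>e>0. \<exists>N. \<forall>m\<ge>N. \<forall>n\<ge>N. hnorm H (X m - X n) < e) \<longrightarrow>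
          (\<exists>x\<in>hcar H. \<forall>e>0. \<exists>N. \<forall>n\<ge>N. hnorm H (X n - x) < e))"

definition hdefinite :: "('h::ab_group_add) hspace \<Rightarrow> bool" where
  "hdefinite H \<longleftrightarrow> (\<forall>x\<in>hcar H. hip H x x = 0 \<longrightarrow> x = 0)"

definition L2 :: "'x measure \<Rightarrow> ('x \<Rightarrow> complex) hspace" where
  "L2 \<mu> = \<lparr> hcar = {g. g \<in> borel_measurable \<mu> \<and> integrable \<mu> (\<lambda>x. (cmod (g x))\<^sup>2)},
            hsc = (\<lambda>c g x. c * g x),
            hip = (\<lambda>g h. \<integral>x. cnj (g x) * h x \<partial>\<mu>) \<rparr>"

definition is_op :: "('h::ab_group_add) hspace \<Rightarrow> ('h \<Rightarrow> 'h) \<Rightarrow> bool" where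
  "is_op H T \<longleftrightarrow> (\<forall>x\<in>hcar H. T x \<in> hcar H) \<and>
     (\<forall>x\<in>hcar H. \<forall>y\<in>hcar H. hnull H (T (x + y) - (T x + T y))) \<and>
     (\<forall>c. \<forall>x\<in>hcar H. hnull H (T (hsc H c x) - hsc H c (T x))) \<and>
     (\<exists>C. \<forall>x\<in>hcar H. hnorm H (T x) \<le> C * hnorm H x)"

definition is_adjoint :: "('h::ab_group_add) hspace \<Rightarrow> ('h \<Rightarrow> 'h) \<Rightarrow> ('h \<Rightarrow> 'h) \<Rightarrow> bool" where
  "is_adjoint H T T' \<longleftrightarrow> is_op H T \<and> is_op H T' \<and>
     (\<forall>x\<in>hcar H. \<forall>y\<in>hcar H. hip H (T x) y = hip H x (T' y))"

definition op_eq :: "('h::ab_group_add) hspace \<Rightarrow> ('h \<Rightarrow> 'h) \<Rightarrow> ('h \<Rightarrow> 'h) \<Rightarrow> bool" where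
  "op_eq H A B \<longleftrightarrow> (\<forall>x\<in>hcar H. hnull H (A x - B x))"

text \<open>Representation of C*(Lambda) = Cuntz-Krieger Lambda-family {t_lambda} (with adjoints ts_lambda)\<close>
definition CK_rep :: "nat \<Rightarrow> 'a kgraph \<Rightarrow> ('h::ab_group_add) hspace \<Rightarrow> ('a \<Rightarrow> 'h \<Rightarrow> 'h) \<Rightarrow> ('a \<Rightarrow> 'h \<Rightarrow> 'h) \<Rightarrow> bool" where
  "CK_rep k G H t ts \<longleftrightarrow>
     (\<forall>l\<in>mor G. is_adjoint H (t l) (ts l)) \<and>
     (\<forall>v\<in>vertices G. op_eq H (ts v) (t v)) \<and>
     (\<forall>v\<in>vertices G. \<forall>w\<in>vertices G. op_eq H (t v \<circ> t w) (if v = w then t v else (\<lambda>_. 0))) \<and>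
     (\<forall>l\<in>mor G. \<forall>m\<in>mor G. src G l = rng G m \<longrightarrow> op_eq H (t l \<circ> t m) (t (cmp G l m))) \<and>
     (\<forall>l\<in>mor G. op_eq H (ts l \<circ> t l) (t (src G l))) \<and>
     (\<forall>v\<in>vertices G. \<forall>n\<in>Nk k. op_eq H (t v)
        (\<lambda>x. \<Sum>l\<in>{l\<in>mor G. rng G l = v \<and> deg G l = n}. t l (ts l x)))"

definition dense_span :: "('h::ab_group_add) hspace \<Rightarrow> 'h set \<Rightarrow> bool" where
  "dense_span H S \<longleftrightarrow> (\<forall>x\<in>hcar H. \<forall>e>0. \<exists>F c. finite F \<and> F \<subseteq> S \<and>
        hnorm H (x - (\<Sum>y\<in>F. hsc H (c y) y)) < e)"

definition monic_with :: "'a kgraph \<Rightarrow> ('h::ab_group_add) hspace \<Rightarrow> ('a \<Rightarrow> 'h \<Rightarrow> 'h) \<Rightarrow> ('a \<Rightarrow> 'h \<Rightarrow> 'h) \<Rightarrow> 'h \<Rightarrow> bool" where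
  "monic_with G H t ts \<xi> \<longleftrightarrow>
     (\<forall>l\<in>mor G. \<exists>x\<in>hcar H. \<not> hnull H (t l x)) \<and> \<xi> \<in> hcar H \<and>
     dense_span H {t l (ts l \<xi>) | l. l \<in> mor G}"

definition unit_equiv :: "'a kgraph \<Rightarrow> ('h::ab_group_add) hspace \<Rightarrow> ('a \<Rightarrow> 'h \<Rightarrow> 'h)
     \<Rightarrow> ('g::ab_group_add) hspace \<Rightarrow> ('a \<Rightarrow> 'g \<Rightarrow> 'g) \<Rightarrow> bool" where
  "unit_equiv G H1 t1 H2 t2 \<longleftrightarrow> (\<exists>U.
     (\<forall>x\<in>hcar H1. U x \<in> hcar H2) \<and>
     (\<forall>x\<in>hcar H1. \<forall>y\<in>hcar H1. hnull H2 (U (x + y) - (U x + U y))) \<and>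
     (\<forall>c. \<forall>x\<in>hcar H1. hnull H2 (U (hsc H1 c x) - hsc H2 c (U x))) \<and>
     (\<forall>x\<in>hcar H1. \<forall>y\<in>hcar H1. hip H2 (U x) (U y) = hip H1 x y) \<and>
     (\<forall>y\<in>hcar H2. \<exists>x\<in>hcar H1. hnull H2 (y - U x)) \<and>
     (\<forall>l\<in>mor G. \<forall>x\<in>hcar H1. hnull H2 (U (t1 l x) - t2 l (U x))))"

end

theory Submission
  imports Defs
begin

text \<open>
The projections \<open>P l = t l (ts l)\<close> multiply like indicators of cylinders, so the vectors
\<open>P l \<xi>\<close> have the same Gram matrix as the functions \<open>indicator (Z l)\<close> in \<open>L2 \<mu>\<close>. Both families have
dense span, which yields a unitary \<open>U\<close> matching them; it turns \<open>P l\<close> into multiplication by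
\<open>indicator (Z l)\<close>. Put \<open>f l = U (t l \<xi>)\<close>. On the dense span, \<open>U (t l x)\<close> equals
\<open>f l\<close> times \<open>U x\<close> composed with the shift; comparing norms on cylinders shows that the shift pushes
\<open>|f l|^2 \<mu>\<close> forward to the restriction of \<open>\<mu>\<close> to \<open>Z (src l)\<close>, so the weighted shift is bounded and
the formula extends to all \<open>x\<close>. Everything required of a projective system follows from this
formula; in particular \<open>x = ts l \<xi>\<close> gives the Radon-Nikodym derivative of the prefixing map as \<open>|U (ts l \<xi>)|^2\<close>.

Conversely, for a projective system take \<open>\<xi> = 1\<close>: the functions \<open>S l (S l)* 1\<close>, for \<open>l\<close> of fixed range
\<open>v\<close> and degree, are supported on disjoint cylinders and add up to the indicator of \<open>Z v\<close>, so each
is the indicator of its cylinder, and these span a dense subspace.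
\<close>

section \<open>Semi-inner product spaces\<close>

text \<open>Elements of \<open>L2 \<mu>\<close> are functions, not classes, so on that side maps are
  linear and equalities hold only up to null vectors, that is, almost everywhere. On the side of
  \<open>H\<close>, definiteness turns the Cuntz-Krieger relations into equations. The weighted
  shift is the delicate point. Nothing says beforehand that the shift pulls null sets back to null
  sets, so multiplying \<open>f l\<close> with a shifted function need not respect almost-everywhere
  equality. The weight repairs this: weighting \<open>\<mu>\<close> by its squared modulus makes the
  shift measure preserving onto the cylinder of \<open>src G l\<close>. The norm bound therefore has
  to come before any density argument. Projections and cylinders multiply alike because both split
  over all extensions of any larger degree; at a common degree the projections are orthogonal and
  the cylinders disjoint, and both products run over the same index set. Positivity of vertex
  cylinders combines cyclicity of \<open>\<xi>\<close> with the requirement that \<open>t v\<close>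
  is nonzero.\<close>

locale hilb =
  fixes H :: "('h::ab_group_add) hspace"
  assumes hilbert: "is_hilbert_sp H"
begin

lemma
  shows zero_closed [simp]: "0 \<in> hcar H"
    and add_closed [simp]: "\<And>x y. x \<in> hcar H \<Longrightarrow> y \<in> hcar H \<Longrightarrow> x + y \<in> hcar H"
    and neg_closed [simp]: "\<And>x. x \<in> hcar H \<Longrightarrow> - x \<in> hcar H"
    and sc_closed [simp]: "\<And>c x. x \<in> hcar H \<Longrightarrow> hsc H c x \<in> hcar H"
    and sc_one [simp]: "\<And>x. x \<in> hcar H \<Longrightarrow> hsc H 1 x = x"
    and sc_sc: "\<And>a b x. x \<in> hcar H \<Longrightarrow> hsc H a (hsc H b x) = hsc H (a * b) x"
    and sc_add: "\<And>a b x. x \<in> hcar H \<Longrightarrow> hsc H (a + b) x = hsc H a x + hsc H b x"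
    and sc_add_right: "\<And>a x y. x \<in> hcar H \<Longrightarrow> y \<in> hcar H \<Longrightarrow> hsc H a (x + y) = hsc H a x + hsc H a y"
    and hip_add_right: "\<And>x y z. x \<in> hcar H \<Longrightarrow> y \<in> hcar H \<Longrightarrow> z \<in> hcar H \<Longrightarrow> hip H x (y + z) = hip H x y + hip H x z"
    and hip_sc_right: "\<And>a x y. x \<in> hcar H \<Longrightarrow> y \<in> hcar H \<Longrightarrow> hip H x (hsc H a y) = a * hip H x y"
    and hip_cnj: "\<And>x y. x \<in> hcar H \<Longrightarrow> y \<in> hcar H \<Longrightarrow> hip H y x = cnj (hip H x y)"
    and hip_self_Im: "\<And>x. x \<in> hcar H \<Longrightarrow> Im (hip H x x) = 0"
    and hip_self_Re: "\<And>x. x \<in> hcar H \<Longrightarrow> Re (hip H x x) \<ge> 0"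
  using hilbert unfolding is_hilbert_sp_def by meson+

lemma complete:
  fixes X :: "nat \<Rightarrow> 'h"
  assumes "\<And>n. X n \<in> hcar H" "\<And>e. e > 0 \<Longrightarrow> \<exists>N. \<forall>m\<ge>N. \<forall>n\<ge>N. hnorm H (X m - X n) < e"
  obtains x where "x \<in> hcar H" "\<And>e. e > 0 \<Longrightarrow> \<exists>N. \<forall>n\<ge>N. hnorm H (X n - x) < e"
proof -
  have "\<forall>X :: nat \<Rightarrow> 'h. (\<forall>n. X n \<in> hcar H) \<and> (\<forall>e>0. \<exists>N. \<forall>m\<ge>N. \<forall>n\<ge>N. hnorm H (X m - X n) < e) \<longrightarrow>
          (\<exists>x\<in>hcar H. \<forall>e>0. \<exists>N. \<forall>n\<ge>N. hnorm H (X n - x) < e)"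
    using hilbert unfolding is_hilbert_sp_def by (elim conjE)
  from mp[OF spec[OF this, of X]] assms that show ?thesis by blast
qed

lemma diff_closed [simp]: "x \<in> hcar H \<Longrightarrow> y \<in> hcar H \<Longrightarrow> x - y \<in> hcar H"
  by (metis add_closed neg_closed add_uminus_conv_diff)

lemma sum_closed [simp]: "(\<And>i. i \<in> F \<Longrightarrow> g i \<in> hcar H) \<Longrightarrow> sum g F \<in> hcar H"
  by (induction F rule: infinite_finite_induct) auto

lemma sc_zero [simp]: "x \<in> hcar H \<Longrightarrow> hsc H 0 x = 0"
  using sc_add[of x 0 0] by simp

lemma sc_minus_one: "x \<in> hcar H \<Longrightarrow> hsc H (-1) x = - x"
  using sc_add[of x 1 "-1"] by (simp add: eq_neg_iff_add_eq_0 add.commute)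

lemma hip_zero_right [simp]: "x \<in> hcar H \<Longrightarrow> hip H x 0 = 0"
  using hip_add_right[of x 0 0] by simp

lemma hip_minus_right: "x \<in> hcar H \<Longrightarrow> y \<in> hcar H \<Longrightarrow> hip H x (- y) = - hip H x y"
  using hip_sc_right[of x y "-1"] by (simp add: sc_minus_one)

lemma hip_diff_right:
  "x \<in> hcar H \<Longrightarrow> y \<in> hcar H \<Longrightarrow> z \<in> hcar H \<Longrightarrow> hip H x (y - z) = hip H x y - hip H x z"
  using hip_add_right[of x y "- z"] by (simp add: hip_minus_right)

lemma hip_sum_right:
  "x \<in> hcar H \<Longrightarrow> (\<And>i. i \<in> F \<Longrightarrow> g i \<in> hcar H) \<Longrightarrow> hip H x (sum g F) = (\<Sum>i\<in>F. hip H x (g i))"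
  by (induction F rule: infinite_finite_induct) (auto simp: hip_add_right)

lemma hip_zero_left [simp]: "x \<in> hcar H \<Longrightarrow> hip H 0 x = 0"
  using hip_cnj[of x 0] by simp

lemma hip_add_left:
  "x \<in> hcar H \<Longrightarrow> y \<in> hcar H \<Longrightarrow> z \<in> hcar H \<Longrightarrow> hip H (x + y) z = hip H x z + hip H y z"
  using hip_cnj[of z "x + y"] hip_cnj[of z x] hip_cnj[of z y] by (simp add: hip_add_right)

lemma hip_diff_left:
  "x \<in> hcar H \<Longrightarrow> y \<in> hcar H \<Longrightarrow> z \<in> hcar H \<Longrightarrow> hip H (x - y) z = hip H x z - hip H y z"
  using hip_cnj[of z "x - y"] hip_cnj[of z x] hip_cnj[of z y] by (simp add: hip_diff_right)

lemma hip_sc_left: "x \<in> hcar H \<Longrightarrow> y \<in> hcar H \<Longrightarrow> hip H (hsc H a x) y = cnj a * hip H x y"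
  using hip_cnj[of y "hsc H a x"] hip_cnj[of y x] by (simp add: hip_sc_right)

lemmas hip_linear = hip_add_left hip_add_right hip_diff_left hip_diff_right hip_sc_left hip_sc_right

lemma hnorm_nonneg [simp]: "x \<in> hcar H \<Longrightarrow> hnorm H x \<ge> 0"
  by (simp add: hnorm_def hip_self_Re)

lemma hnorm_sq: "x \<in> hcar H \<Longrightarrow> (hnorm H x)\<^sup>2 = Re (hip H x x)"
  by (simp add: hnorm_def hip_self_Re)

lemma hip_self: "x \<in> hcar H \<Longrightarrow> hip H x x = of_real ((hnorm H x)\<^sup>2)"
  by (simp add: complex_eq_iff hnorm_sq hip_self_Im)

lemma hnull_iff: "x \<in> hcar H \<Longrightarrow> hnull H x \<longleftrightarrow> hnorm H x = 0"
  by (simp add: hnull_def hip_self)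

lemma hnorm_zero [simp]: "hnorm H 0 = 0"
  by (simp add: hnorm_def)

lemma hnull_zero [simp]: "hnull H 0"
  by (simp add: hnull_def)

lemma hnorm_sc: "x \<in> hcar H \<Longrightarrow> hnorm H (hsc H c x) = cmod c * hnorm H x"
proof -
  assume x: "x \<in> hcar H"
  have "hip H (hsc H c x) (hsc H c x) = of_real ((cmod c * hnorm H x)\<^sup>2)"
    using x complex_norm_square[of c] hip_linear(5,6) hip_self[OF x]
    by (simp add: power_mult_distrib del: of_real_power)
  then have "Re (hip H (hsc H c x) (hsc H c x)) = (cmod c * hnorm H x)\<^sup>2"
    by (metis Re_complex_of_real)
  then show ?thesis using x unfolding hnorm_def[of H "hsc H c x"] by simp
qed

lemma hnorm_minus: "x \<in> hcar H \<Longrightarrow> hnorm H (- x) = hnorm H x"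
  using hnorm_sc[of x "-1"] by (simp add: sc_minus_one)

lemma hnorm_minus_commute: "x \<in> hcar H \<Longrightarrow> y \<in> hcar H \<Longrightarrow> hnorm H (x - y) = hnorm H (y - x)"
  using hnorm_minus[of "x - y"] by simp

text \<open>Subtracting \<open>hsc H c y\<close> from \<open>x\<close>, with \<open>c\<close> a real
  multiple \<open>s\<close> of the conjugate of \<open>hip H x y\<close>, gives a real quadratic in
  \<open>s\<close> that is never negative. The form is only semidefinite, so a null
  \<open>y\<close>, where the optimal \<open>s\<close> does not exist, is a separate case.\<close>

lemma Cauchy_Schwarz:
  assumes x: "x \<in> hcar H" and y: "y \<in> hcar H"
  shows "cmod (hip H x y) \<le> hnorm H x * hnorm H y"
proof -
  define b where "b = (cmod (hip H x y))\<^sup>2"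
  have b: "hip H x y * cnj (hip H x y) = of_real b"
    unfolding b_def by (rule complex_norm_square[symmetric])
  have ineq: "0 \<le> (hnorm H x)\<^sup>2 - 2 * s * b + s\<^sup>2 * b * (hnorm H y)\<^sup>2" for s :: real
  proof -
    define c where "c = of_real s * cnj (hip H x y)"
    have "hip H (x - hsc H c y) (x - hsc H c y)
        = hip H x x - c * hip H x y - cnj c * cnj (hip H x y) + cnj c * (c * hip H y y)"
      using x y hip_cnj[of x y] by (simp add: hip_linear algebra_simps)
    also have "\<dots> = of_real ((hnorm H x)\<^sup>2) - 2 * of_real s * (hip H x y * cnj (hip H x y))
        + (of_real s)\<^sup>2 * (hip H x y * cnj (hip H x y)) * of_real ((hnorm H y)\<^sup>2)"
      using x y by (simp add: c_def hip_self power2_eq_square algebra_simps)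
    also have "\<dots> = of_real ((hnorm H x)\<^sup>2 - 2 * s * b + s\<^sup>2 * b * (hnorm H y)\<^sup>2)"
      by (simp add: b)
    finally have "Re (hip H (x - hsc H c y) (x - hsc H c y))
        = (hnorm H x)\<^sup>2 - 2 * s * b + s\<^sup>2 * b * (hnorm H y)\<^sup>2" by (metis Re_complex_of_real)
    then show ?thesis using hip_self_Re[of "x - hsc H c y"] x y by simp
  qed
  have "b \<le> (hnorm H x)\<^sup>2 * (hnorm H y)\<^sup>2"
  proof (cases "hnorm H y = 0")
    case True
    have "b = 0"
    proof (rule ccontr)
      assume "b \<noteq> 0"
      \<comment> \<open>With \<open>hnorm H y = 0\<close> this value of \<open>s\<close> makes the
        right side of \<open>ineq\<close> equal to -1.\<close>
      then show False using ineq[of "((hnorm H x)\<^sup>2 + 1) / (2 * b)"] True by (simp add: field_simps)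
    qed
    then show ?thesis by simp
  next
    case False
    then have d: "(hnorm H y)\<^sup>2 > 0" by simp
    have "0 \<le> (hnorm H x)\<^sup>2 - b / (hnorm H y)\<^sup>2"
      using ineq[of "1 / (hnorm H y)\<^sup>2"] d False by (simp add: field_simps power2_eq_square)
    then show ?thesis using d by (simp add: field_simps)
  qed
  then show ?thesis
    unfolding b_def power_mult_distrib[symmetric] using x y
    by (auto intro: power2_le_imp_le)
qed

lemma hnorm_triangle:
  assumes x: "x \<in> hcar H" and y: "y \<in> hcar H"
  shows "hnorm H (x + y) \<le> hnorm H x + hnorm H y"
proof (rule power2_le_imp_le)
  have "(hnorm H (x + y))\<^sup>2 = (hnorm H x)\<^sup>2 + 2 * Re (hip H x y) + (hnorm H y)\<^sup>2"
    using x y hip_cnj[of x y] by (simp add: hnorm_sq hip_linear)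
  also have "Re (hip H x y) \<le> hnorm H x * hnorm H y"
    using Cauchy_Schwarz[OF x y] complex_Re_le_cmod[of "hip H x y"] by linarith
  finally show "(hnorm H (x + y))\<^sup>2 \<le> (hnorm H x + hnorm H y)\<^sup>2"
    by (simp add: power2_sum)
qed (use x y in simp)

lemma hnorm_triangle_diff:
  assumes "x \<in> hcar H" "y \<in> hcar H" "z \<in> hcar H"
  shows "hnorm H (x - z) \<le> hnorm H (x - y) + hnorm H (y - z)"
  using hnorm_triangle[of "x - y" "y - z"] assms by simp

lemma hnorm_triangle_minus:
  "x \<in> hcar H \<Longrightarrow> y \<in> hcar H \<Longrightarrow> hnorm H (x - y) \<le> hnorm H x + hnorm H y"
  using hnorm_triangle[of x "- y"] by (simp add: hnorm_minus)

lemma hnorm_cong: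
  assumes "x \<in> hcar H" "y \<in> hcar H" "hnull H (x - y)"
  shows "hnorm H x = hnorm H y"
  using hnorm_triangle[of "x - y" y] hnorm_triangle[of "y - x" x] assms
    hnorm_minus_commute[of x y] by (simp add: hnull_iff)

lemma hnull_add: "x \<in> hcar H \<Longrightarrow> y \<in> hcar H \<Longrightarrow> hnull H x \<Longrightarrow> hnull H y \<Longrightarrow> hnull H (x + y)"
  using hnorm_triangle[of x y] by (simp add: hnull_iff order.antisym)

lemma hnull_diff: "x \<in> hcar H \<Longrightarrow> y \<in> hcar H \<Longrightarrow> hnull H x \<Longrightarrow> hnull H y \<Longrightarrow> hnull H (x - y)"
  using hnorm_triangle_minus[of x y] by (simp add: hnull_iff order.antisym)

lemma hnull_sc: "x \<in> hcar H \<Longrightarrow> hnull H x \<Longrightarrow> hnull H (hsc H c x)"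
  by (simp add: hnull_iff hnorm_sc)

lemma hnull_sub_trans:
  assumes "x \<in> hcar H" "y \<in> hcar H" "z \<in> hcar H" "hnull H (x - y)" "hnull H (y - z)"
  shows "hnull H (x - z)"
  using hnull_add[of "x - y" "y - z"] assms by simp

lemma hnull_of_null_diff: "x \<in> hcar H \<Longrightarrow> y \<in> hcar H \<Longrightarrow> hnull H (x - y) \<Longrightarrow> hnull H y \<Longrightarrow> hnull H x"
  using hnorm_cong[of x y] by (simp add: hnull_iff)

text \<open>The error is expanded around the limits, so that the bound contains only the fixed norms
  of \<open>x\<close> and \<open>y\<close> and the norms of the differences.\<close>

lemma hip_tendsto:
  fixes X Y :: "nat \<Rightarrow> 'h"
  assumes x: "x \<in> hcar H" and y: "y \<in> hcar H"
    and X: "\<And>n. X n \<in> hcar H" and Y: "\<And>n. Y n \<in> hcar H"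
    and limX: "(\<lambda>n. hnorm H (x - X n)) \<longlonglongrightarrow> 0" and limY: "(\<lambda>n. hnorm H (y - Y n)) \<longlonglongrightarrow> 0"
  shows "(\<lambda>n. hip H (X n) (Y n)) \<longlonglongrightarrow> hip H x y"
proof -
  have "(\<lambda>n. hip H x y - hip H (X n) (Y n)) \<longlonglongrightarrow> 0"
  proof (rule Lim_null_comparison)
    let ?g = "\<lambda>n. hnorm H (x - X n) * hnorm H y + hnorm H x * hnorm H (y - Y n)
        + hnorm H (x - X n) * hnorm H (y - Y n)"
    show "?g \<longlonglongrightarrow> 0"
      using limX limY by (auto intro!: tendsto_eq_intros)
    have "cmod (hip H x y - hip H (X n) (Y n)) \<le> ?g n" for n
    proof -
      have "hip H x y - hip H (X n) (Y n)
          = hip H (x - X n) y + hip H x (y - Y n) - hip H (x - X n) (y - Y n)"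
        using x y X Y by (simp add: hip_linear)
      also have "cmod \<dots> \<le> cmod (hip H (x - X n) y) + cmod (hip H x (y - Y n))
          + cmod (hip H (x - X n) (y - Y n))"
        by (meson norm_triangle_ineq norm_triangle_ineq4 add_right_mono order_trans)
      also have "\<dots> \<le> ?g n"
        using x y X Y by (intro add_mono Cauchy_Schwarz) auto
      finally show ?thesis .
    qed
    then show "\<forall>\<^sub>F n in sequentially. norm (hip H x y - hip H (X n) (Y n)) \<le> ?g n" by simp
  qed
  from tendsto_diff[OF tendsto_const[of "hip H x y"] this] show ?thesis by simp
qed

end

section \<open>Linear spans and their closures\<close>

text \<open>Generators are added one at a time and may repeat, which makes closure properties short
  inductions; \<open>dense_span\<close> instead asks for one coefficient per vector of a finite
  set.\<close>

inductive_set hspan :: "('h::ab_group_add) hspace \<Rightarrow> 'h set \<Rightarrow> 'h set" for H S where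
  zero: "0 \<in> hspan H S"
| step: "x \<in> hspan H S \<Longrightarrow> y \<in> S \<Longrightarrow> x + hsc H c y \<in> hspan H S"

context hilb
begin

lemma hspan_closed:
  assumes "S \<subseteq> hcar H" "x \<in> hspan H S" shows "x \<in> hcar H"
  using assms(2) by (induction rule: hspan.induct) (use assms(1) in auto)

lemma hspan_add: "x \<in> hspan H S \<Longrightarrow> y \<in> hspan H S \<Longrightarrow> x + y \<in> hspan H S"
proof (induction rule: hspan.induct)
  case (step x z c)
  then show ?case using hspan.step[of "x + y" H S z c] by (simp add: ac_simps)
qed simp

lemma hspan_sc:
  assumes S: "S \<subseteq> hcar H" and "x \<in> hspan H S" shows "hsc H c x \<in> hspan H S"
  using assms(2)
proof (induction rule: hspan.induct)
  case zero
  have "hsc H c 0 = 0" using sc_add_right[of 0 0 c] by simp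
  then show ?case by (simp add: hspan.zero)
next
  case (step x y d)
  then have "y \<in> hcar H" "x \<in> hcar H" using S hspan_closed by auto
  then show ?case using step hspan.step[of "hsc H c x" H S y "c * d"] by (simp add: sc_add_right sc_sc)
qed

lemma hspan_sum: "finite F \<Longrightarrow> F \<subseteq> S \<Longrightarrow> (\<Sum>y\<in>F. hsc H (c y) y) \<in> hspan H S"
proof (induction F rule: finite_induct)
  case (insert x F)
  then show ?case using hspan.step[of "\<Sum>y\<in>F. hsc H (c y) y" H S x "c x"] by (simp add: add.commute)
qed (simp add: hspan.zero)

lemma hspan_imp_sum:
  assumes "S \<subseteq> hcar H" "x \<in> hspan H S"
  shows "\<exists>F c. finite F \<and> F \<subseteq> S \<and> x = (\<Sum>y\<in>F. hsc H (c y) y)"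
  using assms(2)
proof (induction rule: hspan.induct)
  case zero
  show ?case by (intro exI[of _ "{}"]) auto
next
  case (step x y d)
  then obtain F c where F: "finite F" "F \<subseteq> S" "x = (\<Sum>y\<in>F. hsc H (c y) y)" by auto
  \<comment> \<open>A generator that occurs again gets its coefficients merged; outside
    \<open>F\<close> the old value \<open>c y\<close> is arbitrary and has to count as 0.\<close>
  define c' where "c' = (\<lambda>z. if z = y then (if y \<in> F then c y else 0) + d else c z)"
  have y: "y \<in> hcar H" using step assms by auto
  have eq: "(\<Sum>z\<in>F - {y}. hsc H (c' z) z) = (\<Sum>z\<in>F - {y}. hsc H (c z) z)"
    by (intro sum.cong) (auto simp: c'_def)
  have "(\<Sum>z\<in>insert y F. hsc H (c' z) z) = hsc H (c' y) y + (\<Sum>z\<in>F - {y}. hsc H (c z) z)"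
    using F(1) by (simp add: sum.insert_remove eq)
  also have "\<dots> = x + hsc H d y"
  proof (cases "y \<in> F")
    case True
    have "x = hsc H (c y) y + (\<Sum>z\<in>F - {y}. hsc H (c z) z)"
      using F True by (simp add: sum.remove)
    then show ?thesis using True y by (simp add: c'_def sc_add add_ac)
  next
    case False
    then show ?thesis using F by (simp add: c'_def add.commute)
  qed
  finally show ?case using F step by (intro exI[of _ "insert y F"] exI[of _ c']) auto
qed

lemma dense_span_iff:
  assumes "S \<subseteq> hcar H"
  shows "dense_span H S \<longleftrightarrow> (\<forall>x\<in>hcar H. \<forall>e>0. \<exists>y\<in>hspan H S. hnorm H (x - y) < e)"
proof
  assume "dense_span H S"
  then show "\<forall>x\<in>hcar H. \<forall>e>0. \<exists>y\<in>hspan H S. hnorm H (x - y) < e"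
    unfolding dense_span_def using hspan_sum by meson
next
  assume "\<forall>x\<in>hcar H. \<forall>e>0. \<exists>y\<in>hspan H S. hnorm H (x - y) < e"
  then show "dense_span H S"
    unfolding dense_span_def using hspan_imp_sum[OF assms] by metis
qed

text \<open>The closed span as a set. Density becomes an inclusion, which can be proved by
  exhibiting more and more members.\<close>

definition hclos :: "'h set \<Rightarrow> 'h set" where
  "hclos S = {x\<in>hcar H. \<forall>e>0. \<exists>y\<in>hspan H S. hnorm H (x - y) < e}"

lemma hclos_closed: "x \<in> hclos S \<Longrightarrow> x \<in> hcar H"
  by (simp add: hclos_def)

lemma hclos_limit:
  assumes S: "S \<subseteq> hcar H" and x: "x \<in> hcar H"
    and appr: "\<And>e. e > 0 \<Longrightarrow> \<exists>z\<in>hclos S. hnorm H (x - z) < e"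
  shows "x \<in> hclos S"
  unfolding hclos_def
proof (intro CollectI conjI x allI impI)
  fix e :: real assume "e > 0"
  then obtain z where z: "z \<in> hclos S" "hnorm H (x - z) < e / 2" using appr[of "e/2"] by auto
  obtain y where y: "y \<in> hspan H S" "hnorm H (z - y) < e / 2"
    using z \<open>e > 0\<close> unfolding hclos_def by (auto dest!: spec[of _ "e/2"])
  have "hnorm H (x - y) < e"
    using hnorm_triangle_diff[of x z y] x z y hclos_closed[OF z(1)] hspan_closed[OF S y(1)] by auto
  then show "\<exists>y\<in>hspan H S. hnorm H (x - y) < e" using y by auto
qed

lemma hclos_null:
  assumes "S \<subseteq> hcar H" "x \<in> hcar H" "z \<in> hclos S" "hnull H (x - z)"
  shows "x \<in> hclos S"
  using assms hclos_closed by (intro hclos_limit[of S x]) (auto simp: hnull_iff intro!: bexI[of _ z])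

lemma hclos_superset:
  assumes "S \<subseteq> hcar H" "x \<in> S"
  shows "x \<in> hclos S"
proof -
  have "x \<in> hspan H S" using hspan.step[OF hspan.zero, of x S H 1] assms by auto
  then show ?thesis using assms unfolding hclos_def by (auto intro!: bexI[of _ x])
qed

lemma hclos_zero: "0 \<in> hclos S"
  unfolding hclos_def by (auto intro!: bexI[of _ 0] hspan.zero)

lemma hclos_add:
  assumes S: "S \<subseteq> hcar H" and x: "x \<in> hclos S" and y: "y \<in> hclos S"
  shows "x + y \<in> hclos S"
  unfolding hclos_def
proof (intro CollectI conjI allI impI)
  show "x + y \<in> hcar H" using x y by (simp add: hclos_closed)
  fix e :: real assume "e > 0"
  obtain u where u: "u \<in> hspan H S" "hnorm H (x - u) < e / 2"
    using x \<open>e > 0\<close> unfolding hclos_def by (auto dest!: spec[of _ "e/2"])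
  obtain w where w: "w \<in> hspan H S" "hnorm H (y - w) < e / 2"
    using y \<open>e > 0\<close> unfolding hclos_def by (auto dest!: spec[of _ "e/2"])
  have "hnorm H ((x + y) - (u + w)) < e"
    using hnorm_triangle[of "x - u" "y - w"] x y u w hclos_closed hspan_closed[OF S]
    by (simp add: algebra_simps)
  then show "\<exists>z\<in>hspan H S. hnorm H (x + y - z) < e" using hspan_add[OF u(1) w(1)] by auto
qed

lemma hclos_sc:
  assumes S: "S \<subseteq> hcar H" and x: "x \<in> hclos S"
  shows "hsc H c x \<in> hclos S"
  unfolding hclos_def
proof (intro CollectI conjI allI impI)
  show "hsc H c x \<in> hcar H" using x by (simp add: hclos_closed)
  fix e :: real assume "e > 0"
  \<comment> \<open>The summand 1 covers \<open>c = 0\<close>.\<close>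
  then have "e / (cmod c + 1) > 0" by (simp add: add_nonneg_pos)
  then obtain u where u: "u \<in> hspan H S" "hnorm H (x - u) < e / (cmod c + 1)"
    using x unfolding hclos_def by blast
  have uc: "u \<in> hcar H" "x \<in> hcar H" using u x hspan_closed[OF S] hclos_closed by auto
  have "hsc H c x - hsc H c u = hsc H c (x - u)"
    using sc_add_right[of "x - u" u c] uc by simp
  then have "hnorm H (hsc H c x - hsc H c u) = cmod c * hnorm H (x - u)"
    using uc by (simp add: hnorm_sc)
  also have "\<dots> \<le> (cmod c + 1) * hnorm H (x - u)" using uc by (intro mult_right_mono) auto
  also have "\<dots> < e"
    using u(2) by (simp add: pos_less_divide_eq add_nonneg_pos mult.commute)
  finally show "\<exists>z\<in>hspan H S. hnorm H (hsc H c x - z) < e" using hspan_sc[OF S u(1)] by auto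
qed

lemma hclos_sum:
  "S \<subseteq> hcar H \<Longrightarrow> (\<And>i. i \<in> F \<Longrightarrow> g i \<in> hclos S) \<Longrightarrow> sum g F \<in> hclos S"
  by (induction F rule: infinite_finite_induct) (auto intro: hclos_zero hclos_add)

lemma dense_span_iff_hclos: "S \<subseteq> hcar H \<Longrightarrow> dense_span H S \<longleftrightarrow> hcar H \<subseteq> hclos S"
  by (auto simp: dense_span_iff hclos_def)

end

section \<open>Bounded maps that are linear modulo null vectors\<close>

text \<open>The two-space version of \<open>is_op\<close>, needed for maps from \<open>H\<close>
  into \<open>L2\<close>. Linearity is asked only modulo null vectors because such a map picks
  representatives.\<close>

definition blin :: "('h::ab_group_add) hspace \<Rightarrow> ('g::ab_group_add) hspace \<Rightarrow> ('h \<Rightarrow> 'g) \<Rightarrow> bool" where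
  "blin H1 H2 A \<longleftrightarrow> (\<forall>x\<in>hcar H1. A x \<in> hcar H2) \<and>
     (\<forall>x\<in>hcar H1. \<forall>y\<in>hcar H1. hnull H2 (A (x + y) - (A x + A y))) \<and>
     (\<forall>c. \<forall>x\<in>hcar H1. hnull H2 (A (hsc H1 c x) - hsc H2 c (A x))) \<and>
     (\<exists>C. \<forall>x\<in>hcar H1. hnorm H2 (A x) \<le> C * hnorm H1 x)"

lemma
  assumes "blin H1 H2 A"
  shows blin_closed: "\<And>x. x \<in> hcar H1 \<Longrightarrow> A x \<in> hcar H2"
    and blin_add: "\<And>x y. x \<in> hcar H1 \<Longrightarrow> y \<in> hcar H1 \<Longrightarrow> hnull H2 (A (x + y) - (A x + A y))"
    and blin_sc: "\<And>c x. x \<in> hcar H1 \<Longrightarrow> hnull H2 (A (hsc H1 c x) - hsc H2 c (A x))"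
    and blin_bounded: "\<exists>C. \<forall>x\<in>hcar H1. hnorm H2 (A x) \<le> C * hnorm H1 x"
  using assms by (simp_all add: blin_def)

lemma is_op_iff_blin: "is_op H T \<longleftrightarrow> blin H H T"
  by (simp add: is_op_def blin_def)

text \<open>Applied to the difference of two maps, this is uniqueness of the bounded extension from
  a generating set. Every use of linearity costs a null vector, which the norm does not see.\<close>

lemma blin_null_on_dense:
  assumes H1: "hilb H1" and H2: "hilb H2" and A: "blin H1 H2 A"
    and S: "S \<subseteq> hcar H1" "dense_span H1 S" and null: "\<And>y. y \<in> S \<Longrightarrow> hnull H2 (A y)"
    and x: "x \<in> hcar H1"
  shows "hnull H2 (A x)"
proof -
  interpret H1: hilb H1 by fact
  interpret H2: hilb H2 by fact
  note Ac = blin_closed[OF A] and Aadd = blin_add[OF A] and Asc = blin_sc[OF A]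
  obtain C where C: "\<And>z. z \<in> hcar H1 \<Longrightarrow> hnorm H2 (A z) \<le> C * hnorm H1 z"
    using blin_bounded[OF A] by metis
  have span: "hnull H2 (A y)" if "y \<in> hspan H1 S" for y
    using that
  proof (induction rule: hspan.induct)
    case zero
    have "hnorm H2 (A 0) \<le> 0" using C[of 0] by simp
    then show ?case using Ac[of 0] by (simp add: H2.hnull_iff order.antisym)
  next
    case (step x y c)
    have xc: "x \<in> hcar H1" "y \<in> hcar H1" using step S H1.hspan_closed by auto
    have "hnull H2 (A (hsc H1 c y))"
      using Asc[of y c] H2.hnull_sc[of "A y" c] null[of y] step xc Ac
        H2.hnull_of_null_diff[of "A (hsc H1 c y)" "hsc H2 c (A y)"] by auto
    then have "hnull H2 (A x + A (hsc H1 c y))" using step xc Ac by (intro H2.hnull_add) auto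
    then show ?case using Aadd[of x "hsc H1 c y"] xc Ac
      by (intro H2.hnull_of_null_diff[of "A (x + hsc H1 c y)" "A x + A (hsc H1 c y)"]) auto
  qed
  have "hnorm H2 (A x) \<le> 0 + e" if "e > 0" for e
  proof -
    \<comment> \<open>The constant \<open>C\<close> is any real number, possibly zero or negative,
      so \<open>\<bar>C\<bar> + 1\<close> takes its place.\<close>
    have "e / (\<bar>C\<bar> + 1) > 0" using that by simp
    then obtain y where y: "y \<in> hspan H1 S" "hnorm H1 (x - y) < e / (\<bar>C\<bar> + 1)"
      using S x H1.dense_span_iff by blast
    have yc: "y \<in> hcar H1" using y S H1.hspan_closed by auto
    have "hnorm H2 (A x) = hnorm H2 (A (x - y) + A y)"
      using Aadd[of "x - y" y] x yc Ac by (intro H2.hnorm_cong) auto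
    also have "\<dots> \<le> hnorm H2 (A (x - y)) + hnorm H2 (A y)"
      using x yc Ac by (intro H2.hnorm_triangle) auto
    also have "\<dots> = hnorm H2 (A (x - y))" using span[OF y(1)] yc Ac by (simp add: H2.hnull_iff)
    also have "\<dots> \<le> C * hnorm H1 (x - y)" using C x yc by simp
    also have "\<dots> \<le> (\<bar>C\<bar> + 1) * hnorm H1 (x - y)" using x yc by (intro mult_right_mono) auto
    also have "\<dots> \<le> e" using y(2) by (simp add: field_simps)
    finally show ?thesis by simp
  qed
  then have "hnorm H2 (A x) \<le> 0" by (rule field_le_epsilon)
  then show ?thesis using Ac[OF x] by (simp add: H2.hnull_iff order.antisym)
qed

lemma blin_diff:
  assumes H2: "hilb H2" and A: "blin H1 H2 A" and B: "blin H1 H2 B"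
    and H1: "hilb H1"
  shows "blin H1 H2 (\<lambda>x. A x - B x)"
proof -
  interpret H1: hilb H1 by fact
  interpret H2: hilb H2 by fact
  note c = blin_closed[OF A] blin_closed[OF B]
  show ?thesis unfolding blin_def
  proof (intro conjI ballI allI)
    fix x assume x: "x \<in> hcar H1"
    show "A x - B x \<in> hcar H2" using c x by simp
    fix y assume y: "y \<in> hcar H1"
    have "hnull H2 ((A (x + y) - (A x + A y)) - (B (x + y) - (B x + B y)))"
      using x y c by (intro H2.hnull_diff blin_add[OF A] blin_add[OF B]) auto
    then show "hnull H2 (A (x + y) - B (x + y) - (A x - B x + (A y - B y)))"
      by (simp add: algebra_simps)
  next
    fix a x assume x: "x \<in> hcar H1"
    have "hnull H2 ((A (hsc H1 a x) - hsc H2 a (A x)) - (B (hsc H1 a x) - hsc H2 a (B x)))"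
      using x c by (intro H2.hnull_diff blin_sc[OF A] blin_sc[OF B]) auto
    moreover have "hsc H2 a (A x) - hsc H2 a (B x) = hsc H2 a (A x - B x)"
      using H2.sc_add_right[of "A x - B x" "B x" a] c[OF x] by simp
    ultimately show "hnull H2 (A (hsc H1 a x) - B (hsc H1 a x) - hsc H2 a (A x - B x))"
      by (simp add: algebra_simps)
  next
    obtain C D where C: "\<And>x. x \<in> hcar H1 \<Longrightarrow> hnorm H2 (A x) \<le> C * hnorm H1 x"
      and D: "\<And>x. x \<in> hcar H1 \<Longrightarrow> hnorm H2 (B x) \<le> D * hnorm H1 x"
      using blin_bounded[OF A] blin_bounded[OF B] by metis
    have "hnorm H2 (A x - B x) \<le> (C + D) * hnorm H1 x" if "x \<in> hcar H1" for x
      using H2.hnorm_triangle_minus[of "A x" "B x"] c[OF that] C[OF that] D[OF that]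
      by (simp add: algebra_simps)
    then show "\<exists>C. \<forall>x\<in>hcar H1. hnorm H2 (A x - B x) \<le> C * hnorm H1 x" by blast
  qed
qed

lemma blin_comp:
  assumes H1: "hilb H1" and H2: "hilb H2" and H3: "hilb H3"
    and A: "blin H1 H2 A" and B: "blin H2 H3 B"
  shows "blin H1 H3 (\<lambda>x. B (A x))"
proof -
  interpret H1: hilb H1 by fact
  interpret H2: hilb H2 by fact
  interpret H3: hilb H3 by fact
  note Ac = blin_closed[OF A] and Bc = blin_closed[OF B]
  obtain C D where C: "\<And>x. x \<in> hcar H1 \<Longrightarrow> hnorm H2 (A x) \<le> C * hnorm H1 x"
    and D: "\<And>x. x \<in> hcar H2 \<Longrightarrow> hnorm H3 (B x) \<le> D * hnorm H2 x"
    using blin_bounded[OF A] blin_bounded[OF B] by metis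
  \<comment> \<open>The inner map obeys its laws only modulo null vectors, so \<open>B\<close> must
    send congruent arguments to congruent values; boundedness gives this.\<close>
  have cong: "hnull H3 (B u - B w)" if u: "u \<in> hcar H2" and w: "w \<in> hcar H2" and null: "hnull H2 (u - w)" for u w
  proof -
    have "hnull H3 (B (u - w + w) - (B (u - w) + B w))" using u w by (intro blin_add[OF B]) auto
    moreover have "hnull H3 (B (u - w))"
      using D[of "u - w"] null u w Bc[of "u - w"]
      by (simp add: H2.hnull_iff H3.hnull_iff order.antisym)
    ultimately have "hnull H3 (B (u - w + w) - (B (u - w) + B w) + B (u - w))"
      using u w Bc by (intro H3.hnull_add) auto
    then show ?thesis by (simp add: algebra_simps)
  qed
  show ?thesis unfolding blin_def
  proof (intro conjI ballI allI)
    fix x assume x: "x \<in> hcar H1"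
    show "B (A x) \<in> hcar H3" using Ac Bc x by simp
    fix y assume y: "y \<in> hcar H1"
    have "hnull H3 (B (A (x + y)) - B (A x + A y))"
      using x y Ac by (intro cong blin_add[OF A]) auto
    moreover have "hnull H3 (B (A x + A y) - (B (A x) + B (A y)))"
      using x y Ac by (intro blin_add[OF B]) auto
    ultimately show "hnull H3 (B (A (x + y)) - (B (A x) + B (A y)))"
      using x y Ac Bc H3.hnull_sub_trans[of "B (A (x + y))" "B (A x + A y)" "B (A x) + B (A y)"] by auto
  next
    fix a x assume x: "x \<in> hcar H1"
    have "hnull H3 (B (A (hsc H1 a x)) - B (hsc H2 a (A x)))"
      using x Ac by (intro cong blin_sc[OF A]) auto
    moreover have "hnull H3 (B (hsc H2 a (A x)) - hsc H3 a (B (A x)))"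
      using x Ac by (intro blin_sc[OF B]) auto
    ultimately show "hnull H3 (B (A (hsc H1 a x)) - hsc H3 a (B (A x)))"
      using x Ac Bc
        H3.hnull_sub_trans[of "B (A (hsc H1 a x))" "B (hsc H2 a (A x))" "hsc H3 a (B (A x))"] by auto
  next
    have "hnorm H3 (B (A x)) \<le> (\<bar>D\<bar> * \<bar>C\<bar>) * hnorm H1 x" if x: "x \<in> hcar H1" for x
    proof -
      have "hnorm H3 (B (A x)) \<le> D * hnorm H2 (A x)" using D Ac x by simp
      also have "\<dots> \<le> \<bar>D\<bar> * hnorm H2 (A x)" using Ac x by (intro mult_right_mono) auto
      also have "\<dots> \<le> \<bar>D\<bar> * (\<bar>C\<bar> * hnorm H1 x)"
      proof (rule mult_left_mono)
        have "hnorm H2 (A x) \<le> C * hnorm H1 x" using C x by simp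
        also have "\<dots> \<le> \<bar>C\<bar> * hnorm H1 x" using x by (intro mult_right_mono) auto
        finally show "hnorm H2 (A x) \<le> \<bar>C\<bar> * hnorm H1 x" .
      qed simp
      finally show ?thesis by (simp add: mult.assoc)
    qed
    then show "\<exists>C. \<forall>x\<in>hcar H1. hnorm H3 (B (A x)) \<le> C * hnorm H1 x" by blast
  qed
qed

text \<open>Preserving inner products already forces linearity: the squared norm of
  \<open>U (x + y) - (U x + U y)\<close> expands into inner products computed in \<open>H1\<close>,
  where they cancel.\<close>

lemma isometry_blin:
  assumes H1: "hilb H1" and H2: "hilb H2" and c: "\<And>x. x \<in> hcar H1 \<Longrightarrow> U x \<in> hcar H2"
    and iso: "\<And>x y. x \<in> hcar H1 \<Longrightarrow> y \<in> hcar H1 \<Longrightarrow> hip H2 (U x) (U y) = hip H1 x y"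
  shows "blin H1 H2 U"
proof -
  interpret H1: hilb H1 by fact
  interpret H2: hilb H2 by fact
  show ?thesis unfolding blin_def
  proof (intro conjI ballI allI)
    fix x y assume xy: "x \<in> hcar H1" "y \<in> hcar H1"
    show "hnull H2 (U (x + y) - (U x + U y))"
      using xy c unfolding hnull_def by (simp add: H2.hip_linear iso) (simp add: H1.hip_linear)
  next
    fix a x assume x: "x \<in> hcar H1"
    show "hnull H2 (U (hsc H1 a x) - hsc H2 a (U x))"
      using x c unfolding hnull_def by (simp add: H2.hip_linear iso) (simp add: H1.hip_linear)
  next
    show "\<exists>C. \<forall>x\<in>hcar H1. hnorm H2 (U x) \<le> C * hnorm H1 x"
      using c iso by (intro exI[of _ 1]) (auto simp: hnorm_def)
  qed (use c in auto)
qed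

section \<open>A unitary from two families with the same Gram matrix\<close>

text \<open>The graph of the map sending each combination of the \<open>a i\<close> to the same
  combination of the \<open>b i\<close>. It stays a relation because the families may be dependent,
  so that single-valuedness, modulo null vectors, depends on the Gram matrices. It also serves the
  inverse map.\<close>

inductive pspan :: "('h::ab_group_add) hspace \<Rightarrow> ('g::ab_group_add) hspace \<Rightarrow> ('i \<Rightarrow> 'h) \<Rightarrow> ('i \<Rightarrow> 'g)
    \<Rightarrow> 'i set \<Rightarrow> 'h \<Rightarrow> 'g \<Rightarrow> bool" for H1 H2 a b I where
  zero: "pspan H1 H2 a b I 0 0"
| step: "pspan H1 H2 a b I x y \<Longrightarrow> i \<in> I \<Longrightarrow> pspan H1 H2 a b I (x + hsc H1 c (a i)) (y + hsc H2 c (b i))"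

lemma pspan_swap: "pspan H1 H2 a b I x y \<Longrightarrow> pspan H2 H1 b a I y x"
  by (induction rule: pspan.induct) (auto intro: pspan.intros)

lemma hspan_imp_pspan: "x \<in> hspan H1 (a ` I) \<Longrightarrow> \<exists>y. pspan H1 H2 a b I x y"
  by (induction rule: hspan.induct) (auto intro: pspan.intros)

locale gram_pair = H1: hilb H1 + H2: hilb H2
  for H1 :: "('h::ab_group_add) hspace" and H2 :: "('g::ab_group_add) hspace" +
  fixes a :: "'i \<Rightarrow> 'h" and b :: "'i \<Rightarrow> 'g" and I :: "'i set"
  assumes a_closed: "\<And>i. i \<in> I \<Longrightarrow> a i \<in> hcar H1" and b_closed: "\<And>i. i \<in> I \<Longrightarrow> b i \<in> hcar H2"
    and gram: "\<And>i j. i \<in> I \<Longrightarrow> j \<in> I \<Longrightarrow> hip H1 (a i) (a j) = hip H2 (b i) (b j)"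
    and dense1: "dense_span H1 (a ` I)"
begin

abbreviation "ps \<equiv> pspan H1 H2 a b I"

lemma ps_closed: "ps x y \<Longrightarrow> x \<in> hcar H1 \<and> y \<in> hcar H2"
  by (induction rule: pspan.induct) (auto simp: a_closed b_closed)

lemma ps_gram: 
  assumes "ps x y" "ps x' y'" shows "hip H1 x x' = hip H2 y y'"
proof -
  have 1: "hip H1 x (a i) = hip H2 y (b i)" if "ps x y" "i \<in> I" for x y i
    using that
  proof (induction rule: pspan.induct)
    case (step x y j c)
    then show ?case using ps_closed[of x y] by (simp add: H1.hip_linear H2.hip_linear a_closed b_closed gram)
  qed (simp add: a_closed b_closed)
  show ?thesis using assms(2)
  proof (induction rule: pspan.induct)
    case (step x' y' j c)
    then show ?case using ps_closed[of x' y'] ps_closed[OF assms(1)] 1[OF assms(1)]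
      by (simp add: H1.hip_linear H2.hip_linear a_closed b_closed)
  qed (use ps_closed[OF assms(1)] in simp)
qed

text \<open>The closure of the graph \<open>pspan\<close>, with both coordinates approximated by the
  same sequence of pairs. This keeps it symmetric in the two spaces.\<close>

definition corr :: "'h \<Rightarrow> 'g \<Rightarrow> bool" where
  "corr x y \<longleftrightarrow> y \<in> hcar H2 \<and> (\<exists>u w. (\<forall>n::nat. ps (u n) (w n)) \<and> (\<lambda>n. hnorm H1 (x - u n)) \<longlonglongrightarrow> 0
      \<and> (\<lambda>n. hnorm H2 (y - w n)) \<longlonglongrightarrow> 0)"

text \<open>Approximants of \<open>x\<close> are Cauchy, their partners are at the same mutual
  distances by \<open>ps_gram\<close>, and completeness of \<open>H2\<close> supplies the
  limit.\<close>

lemma corr_exists: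
  assumes x: "x \<in> hcar H1"
  shows "\<exists>y. corr x y"
proof -
  have "\<exists>u w. ps u w \<and> hnorm H1 (x - u) < 1 / real (Suc n)" for n
  proof -
    have "a ` I \<subseteq> hcar H1" using a_closed by auto
    then obtain u where "u \<in> hspan H1 (a ` I)" "hnorm H1 (x - u) < 1 / real (Suc n)"
      using dense1 x unfolding H1.dense_span_iff[OF \<open>a ` I \<subseteq> hcar H1\<close>]
      by (metis divide_pos_pos of_nat_0_less_iff zero_less_Suc zero_less_one)
    then show ?thesis using hspan_imp_pspan by blast
  qed
  then obtain u w where uw: "\<And>n. ps (u n) (w n)" "\<And>n. hnorm H1 (x - u n) < 1 / real (Suc n)"
    by metis
  have lim1: "(\<lambda>n. hnorm H1 (x - u n)) \<longlonglongrightarrow> 0"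
    by (rule LIMSEQ_norm_0) (use uw(2) x ps_closed[OF uw(1)] in simp)
  have iso: "hnorm H2 (w m - w n) = hnorm H1 (u m - u n)" for m n
    using ps_closed[OF uw(1)] ps_gram[OF uw(1) uw(1)]
    by (simp add: hnorm_def H1.hip_linear H2.hip_linear)
  have "\<exists>N. \<forall>m\<ge>N. \<forall>n\<ge>N. hnorm H2 (w m - w n) < e" if e: "e > 0" for e
  proof -
    have "\<forall>\<^sub>F n in sequentially. hnorm H1 (x - u n) < e / 2"
      using lim1 e by (intro order_tendstoD) auto
    then obtain N where N: "\<And>n. n \<ge> N \<Longrightarrow> hnorm H1 (x - u n) < e / 2"
      by (auto simp: eventually_sequentially)
    have "hnorm H2 (w m - w n) < e" if "m \<ge> N" "n \<ge> N" for m n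
      using H1.hnorm_triangle_diff[of "u m" x "u n"] N[OF that(1)] N[OF that(2)] x ps_closed[OF uw(1)]
        H1.hnorm_minus_commute[of "u m" x] by (simp add: iso)
    then show ?thesis by blast
  qed
  then obtain y where y: "y \<in> hcar H2" "\<And>e. e > 0 \<Longrightarrow> \<exists>N. \<forall>n\<ge>N. hnorm H2 (w n - y) < e"
    using H2.complete[of w] ps_closed[OF uw(1)] by metis
  have "(\<lambda>n. hnorm H2 (y - w n)) \<longlonglongrightarrow> 0"
    using y ps_closed[OF uw(1)] by (auto simp: LIMSEQ_def H2.hnorm_minus_commute[of y])
  then show ?thesis unfolding corr_def using y uw lim1 by blast
qed

lemma corr_hip:
  assumes "x \<in> hcar H1" "x' \<in> hcar H1" "corr x y" "corr x' y'"
  shows "hip H2 y y' = hip H1 x x'"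
proof -
  obtain u w u' w' where uw: "\<And>n. ps (u n) (w n)" "\<And>n. ps (u' n) (w' n)"
    and lim: "(\<lambda>n. hnorm H1 (x - u n)) \<longlonglongrightarrow> 0" "(\<lambda>n. hnorm H2 (y - w n)) \<longlonglongrightarrow> 0"
      "(\<lambda>n. hnorm H1 (x' - u' n)) \<longlonglongrightarrow> 0" "(\<lambda>n. hnorm H2 (y' - w' n)) \<longlonglongrightarrow> 0"
    using assms unfolding corr_def by metis
  have "(\<lambda>n. hip H1 (u n) (u' n)) \<longlonglongrightarrow> hip H1 x x'"
    using ps_closed[OF uw(1)] ps_closed[OF uw(2)] assms lim by (intro H1.hip_tendsto) auto
  moreover have "(\<lambda>n. hip H2 (w n) (w' n)) \<longlonglongrightarrow> hip H2 y y'"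
    using ps_closed[OF uw(1)] ps_closed[OF uw(2)] assms lim by (intro H2.hip_tendsto) (auto simp: corr_def)
  ultimately show ?thesis using ps_gram[OF uw] by (simp add: LIMSEQ_unique)
qed

lemma corr_basis: "i \<in> I \<Longrightarrow> corr (a i) (b i)"
  unfolding corr_def
  using pspan.step[OF pspan.zero, of i I H1 H2 a b 1]
  by (auto simp: a_closed b_closed intro!: exI[of _ "\<lambda>n. a i"] exI[of _ "\<lambda>n. b i"])

text \<open>The squared norm of \<open>y - y'\<close> expands into four inner products, each equal
  to \<open>hip H1 x x\<close> by \<open>corr_hip\<close>.\<close>

lemma corr_null:
  assumes "x \<in> hcar H1" "corr x y" "corr x y'"
  shows "hnull H2 (y - y')"
  using assms corr_hip[of x x] unfolding hnull_def by (simp add: H2.hip_linear corr_def)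

end

text \<open>Density of the \<open>a i\<close> defines \<open>U\<close> on all of \<open>H1\<close>.
  Density of the \<open>b i\<close> makes the swapped copy \<open>Q\<close> available, whose
  existence statement yields preimages.\<close>

lemma gram_unitary:
  assumes gp: "gram_pair H1 H2 a b I" and dense2: "dense_span H2 (b ` I)"
  obtains U where "\<And>x. x \<in> hcar H1 \<Longrightarrow> U x \<in> hcar H2"
    "\<And>x y. x \<in> hcar H1 \<Longrightarrow> y \<in> hcar H1 \<Longrightarrow> hip H2 (U x) (U y) = hip H1 x y"
    "\<And>y. y \<in> hcar H2 \<Longrightarrow> \<exists>x\<in>hcar H1. hnull H2 (y - U x)"
    "\<And>i. i \<in> I \<Longrightarrow> hnull H2 (U (a i) - b i)"
proof -
  interpret P: gram_pair H1 H2 a b I by fact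
  interpret Q: gram_pair H2 H1 b a I
    by unfold_locales (auto simp: P.a_closed P.b_closed P.gram dense2)
  define U where "U x = (SOME y. P.corr x y)" for x
  have U: "P.corr x (U x)" if "x \<in> hcar H1" for x
    unfolding U_def using P.corr_exists[OF that] by (rule someI_ex)
  show ?thesis
  proof (rule that[of U])
    show "U x \<in> hcar H2" if "x \<in> hcar H1" for x using U[OF that] by (simp add: P.corr_def)
    show "hip H2 (U x) (U y) = hip H1 x y" if "x \<in> hcar H1" "y \<in> hcar H1" for x y
      using P.corr_hip U that by simp
    show "hnull H2 (U (a i) - b i)" if "i \<in> I" for i
      using P.corr_null[of "a i"] P.corr_basis[OF that] U P.a_closed[OF that] by simp
    fix y assume y: "y \<in> hcar H2"
    obtain x where x: "Q.corr y x" using Q.corr_exists y by blast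
    then have "P.corr x y" using y pspan_swap unfolding P.corr_def Q.corr_def by blast
    moreover have "x \<in> hcar H1" using x by (simp add: Q.corr_def)
    ultimately show "\<exists>x\<in>hcar H1. hnull H2 (y - U x)" using P.corr_null U by blast
  qed
qed

section \<open>The space of square-integrable functions\<close>

lemma sum_fun_apply: "(\<Sum>i\<in>F. g i) x = (\<Sum>i\<in>F. g i x)"
  for g :: "'i \<Rightarrow> 'x \<Rightarrow> 'b::comm_monoid_add"
  by (induction F rule: infinite_finite_induct) auto

lemma L2_car: "g \<in> hcar (L2 M) \<longleftrightarrow> g \<in> borel_measurable M \<and> integrable M (\<lambda>x. (cmod (g x))\<^sup>2)"
  by (simp add: L2_def)

lemma L2_hsc: "hsc (L2 M) c g = (\<lambda>x. c * g x)"
  by (simp add: L2_def)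

lemma L2_hip: "hip (L2 M) g h = (\<integral>x. cnj (g x) * h x \<partial>M)"
  by (simp add: L2_def)

lemma L2_measurable: "g \<in> hcar (L2 M) \<Longrightarrow> g \<in> borel_measurable M"
  by (simp add: L2_car)

lemma L2_carI:
  assumes "g \<in> borel_measurable M" "(\<integral>\<^sup>+x. ennreal ((cmod (g x))\<^sup>2) \<partial>M) < \<infinity>"
  shows "g \<in> hcar (L2 M)"
  using assms by (auto simp: L2_car intro!: integrableI_nn_integral_finite[where x = "enn2real (\<integral>\<^sup>+x. ennreal ((cmod (g x))\<^sup>2) \<partial>M)"])

lemma L2_prod_integrable:
  assumes "g \<in> hcar (L2 M)" "h \<in> hcar (L2 M)"
  shows "integrable M (\<lambda>x. cnj (g x) * h x)"
proof (rule Bochner_Integration.integrable_bound)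
  note [measurable] = L2_measurable[OF assms(1)] L2_measurable[OF assms(2)]
  have [measurable]: "(\<lambda>x. cnj (g x)) \<in> borel_measurable M"
    by (rule borel_measurable_continuous_on[of cnj]) (auto intro: continuous_intros)
  show "integrable M (\<lambda>x. (cmod (g x))\<^sup>2 + (cmod (h x))\<^sup>2)" using assms by (simp add: L2_car)
  show "(\<lambda>x. cnj (g x) * h x) \<in> borel_measurable M" by measurable
  have "cmod (cnj (g x) * h x) \<le> (cmod (g x))\<^sup>2 + (cmod (h x))\<^sup>2" for x
  proof -
    have "0 \<le> (cmod (g x) - cmod (h x))\<^sup>2" "0 \<le> cmod (g x) * cmod (h x)" by auto
    then show ?thesis unfolding norm_mult power2_diff complex_mod_cnj by linarith
  qed
  then show "AE x in M. norm (cnj (g x) * h x) \<le> norm ((cmod (g x))\<^sup>2 + (cmod (h x))\<^sup>2)"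
    by simp
qed

lemma L2_add: 
  assumes g: "g \<in> hcar (L2 M)" and h: "h \<in> hcar (L2 M)"
  shows "(\<lambda>x. g x + h x) \<in> hcar (L2 M)"
  unfolding L2_car
proof
  note [measurable] = L2_measurable[OF g] L2_measurable[OF h]
  show "(\<lambda>x. g x + h x) \<in> borel_measurable M" by measurable
  have "integrable M (\<lambda>x. 2 * (cmod (g x))\<^sup>2 + 2 * (cmod (h x))\<^sup>2)" using assms by (simp add: L2_car)
  moreover have "(\<lambda>x. (cmod (g x + h x))\<^sup>2) \<in> borel_measurable M" by measurable
  moreover have "(cmod (g x + h x))\<^sup>2 \<le> 2 * (cmod (g x))\<^sup>2 + 2 * (cmod (h x))\<^sup>2" for x
  proof -
    have "(cmod (g x + h x))\<^sup>2 \<le> (cmod (g x) + cmod (h x))\<^sup>2"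
      by (intro power_mono norm_triangle_ineq) auto
    moreover have "0 \<le> (cmod (g x) - cmod (h x))\<^sup>2" by simp
    ultimately show ?thesis by (simp add: power2_diff power2_sum)
  qed
  ultimately show "integrable M (\<lambda>x. (cmod (g x + h x))\<^sup>2)"
    by (auto intro: Bochner_Integration.integrable_bound)
qed

lemma L2_scale: "g \<in> hcar (L2 M) \<Longrightarrow> (\<lambda>x. c * g x) \<in> hcar (L2 M)"
  by (auto simp: L2_car norm_mult power_mult_distrib)

lemma L2_diff:
  assumes g: "g \<in> hcar (L2 M)" and h: "h \<in> hcar (L2 M)"
  shows "(\<lambda>x. g x - h x) \<in> hcar (L2 M)"
  using L2_add[OF g L2_scale[OF h, of "-1"]] by simp

lemma L2_hip_self: "hip (L2 M) g g = of_real (\<integral>x. (cmod (g x))\<^sup>2 \<partial>M)"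
proof -
  have "cnj (g x) * g x = of_real ((cmod (g x))\<^sup>2)" for x
    using complex_norm_square[of "g x"] by (simp add: mult.commute)
  then show ?thesis by (simp add: L2_hip del: of_real_power)
qed

lemma L2_hnorm: "hnorm (L2 M) g = sqrt (\<integral>x. (cmod (g x))\<^sup>2 \<partial>M)"
  by (simp add: hnorm_def L2_hip_self)

lemma L2_hnorm_nn:
  assumes "g \<in> hcar (L2 M)"
  shows "(\<integral>\<^sup>+x. ennreal ((cmod (g x))\<^sup>2) \<partial>M) = ennreal ((hnorm (L2 M) g)\<^sup>2)"
  using assms by (simp add: L2_hnorm nn_integral_eq_integral L2_car)

lemma L2_hnull_iff:
  assumes "g \<in> hcar (L2 M)"
  shows "hnull (L2 M) g \<longleftrightarrow> (AE x in M. g x = 0)"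
  using assms integral_nonneg_eq_0_iff_AE[of M "\<lambda>x. (cmod (g x))\<^sup>2"]
  by (simp add: hnull_def L2_hip_self L2_car)

lemma L2_hnullI: "AE x in M. g x = 0 \<Longrightarrow> hnull (L2 M) g"
  by (simp add: hnull_def L2_hip_self integral_eq_zero_AE)

text \<open>The squared increments integrate to at most \<open>(1/16) ^ j\<close>. Weighted by
  \<open>4 ^ j\<close> they remain summable, so almost everywhere the weighted sum is some finite
  \<open>c\<close>; each increment is then at most \<open>sqrt c * (1/2) ^ j\<close>, a geometric
  bound.\<close>

lemma L2_Cauchy_AE_subseq:
  fixes X :: "nat \<Rightarrow> 'x \<Rightarrow> complex"
  assumes X: "\<And>n. X n \<in> hcar (L2 M)"
    and small: "\<And>j. hnorm (L2 M) (X (Suc j) - X j) \<le> (1/4) ^ j"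
  shows "AE x in M. convergent (\<lambda>j. X j x)"
proof -
  define d where "d j x = cmod (X (Suc j) x - X j x)" for j x
  have [measurable]: "X n \<in> borel_measurable M" for n using X by (simp add: L2_car)
  have [measurable]: "d j \<in> borel_measurable M" for j unfolding d_def by measurable
  have int: "(\<integral>\<^sup>+x. ennreal ((d j x)\<^sup>2) \<partial>M) \<le> ennreal ((1/16) ^ j)" for j
  proof -
    have diff: "X (Suc j) - X j \<in> hcar (L2 M)" using L2_diff[OF X[of "Suc j"] X[of j]] by (simp add: fun_diff_def)
    have "(\<integral>\<^sup>+x. ennreal ((d j x)\<^sup>2) \<partial>M) = ennreal ((hnorm (L2 M) (X (Suc j) - X j))\<^sup>2)"
      using L2_hnorm_nn[OF diff] by (simp add: d_def)
    also have "\<dots> \<le> ennreal (((1/4) ^ j)\<^sup>2)"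
      using small[of j] by (intro ennreal_leI power_mono) (auto simp: L2_hnorm)
    also have "((1/4::real) ^ j)\<^sup>2 = (1/16) ^ j"
      by (simp add: power_mult[symmetric] mult.commute[of j]) (simp add: power_mult power_divide)
    finally show ?thesis .
  qed
  have "(\<integral>\<^sup>+x. (\<Sum>j. ennreal (4 ^ j * (d j x)\<^sup>2)) \<partial>M) = (\<Sum>j. \<integral>\<^sup>+x. ennreal (4 ^ j * (d j x)\<^sup>2) \<partial>M)"
    by (intro nn_integral_suminf) measurable
  also have "\<dots> \<le> (\<Sum>j. ennreal ((1/4) ^ j))"
  proof (intro suminf_le)
    fix j
    have "(\<integral>\<^sup>+x. ennreal (4 ^ j * (d j x)\<^sup>2) \<partial>M) = ennreal (4 ^ j) * (\<integral>\<^sup>+x. ennreal ((d j x)\<^sup>2) \<partial>M)"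
      by (simp add: ennreal_mult' nn_integral_cmult)
    also have "\<dots> \<le> ennreal (4 ^ j) * ennreal ((1/16) ^ j)" by (intro mult_left_mono int) auto
    also have "\<dots> = ennreal (4 ^ j * (1/16) ^ j)" by (simp add: ennreal_mult')
    also have "(4 ^ j * (1/16) ^ j :: real) = (1/4) ^ j" by (simp add: power_mult_distrib[symmetric])
    finally show "(\<integral>\<^sup>+x. ennreal (4 ^ j * (d j x)\<^sup>2) \<partial>M) \<le> ennreal ((1/4) ^ j)" .
  qed auto
  also have "\<dots> = ennreal (\<Sum>j. (1/4) ^ j)"
    by (intro suminf_ennreal2) (auto intro: summable_geometric)
  also have "\<dots> < \<infinity>" by simp
  finally have "AE x in M. (\<Sum>j. ennreal (4 ^ j * (d j x)\<^sup>2)) \<noteq> \<infinity>"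
    by (intro nn_integral_noteq_infinite) auto
  then show ?thesis
  proof (rule AE_mp, intro AE_I2 impI)
    fix x assume fin: "(\<Sum>j. ennreal (4 ^ j * (d j x)\<^sup>2)) \<noteq> \<infinity>"
    define c where "c = enn2real (\<Sum>j. ennreal (4 ^ j * (d j x)\<^sup>2))"
    have c0: "c \<ge> 0" by (simp add: c_def)
    have le: "d j x \<le> sqrt c * (1/2) ^ j" for j
    proof -
      have "sum (\<lambda>j. ennreal (4 ^ j * (d j x)\<^sup>2)) {j} \<le> (\<Sum>j. ennreal (4 ^ j * (d j x)\<^sup>2))"
        by (intro sum_le_suminf) auto
      then have "ennreal (4 ^ j * (d j x)\<^sup>2) \<le> (\<Sum>j. ennreal (4 ^ j * (d j x)\<^sup>2))" by simp
      also have "\<dots> = ennreal c" using fin by (simp add: c_def top.not_eq_extremum)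
      finally have "4 ^ j * (d j x)\<^sup>2 \<le> c" using c0 by (simp only: ennreal_le_iff)
      moreover have "(4::real) ^ j = (2 ^ j)\<^sup>2"
        by (simp add: power_mult[symmetric] mult.commute[of j]) (simp add: power_mult)
      ultimately have "(2 ^ j * d j x)\<^sup>2 \<le> c" by (simp add: power_mult_distrib)
      then have "2 ^ j * d j x \<le> sqrt c" by (rule real_le_rsqrt)
      then show ?thesis by (simp add: power_one_over pos_le_divide_eq mult.commute)
    qed
    have "summable (\<lambda>j. sqrt c * (1/2) ^ j)" by (intro summable_mult summable_geometric) auto
    then have "summable (\<lambda>j. X (Suc j) x - X j x)"
      by (rule summable_comparison_test'[where N = 0]) (use le in \<open>simp add: d_def\<close>)
    then obtain L where "(\<lambda>n. \<Sum>j<n. X (Suc j) x - X j x) \<longlonglongrightarrow> L" using summable_LIMSEQ by blast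
    then have "(\<lambda>n. X n x - X 0 x) \<longlonglongrightarrow> L" using sum_lessThan_telescope[of "\<lambda>j. X j x"] by simp
    from tendsto_add[OF this tendsto_const[of "X 0 x"]] show "convergent (\<lambda>j. X j x)"
      by (auto simp: convergent_def)
  qed
qed

lemma L2_complete:
  fixes X :: "nat \<Rightarrow> 'x \<Rightarrow> complex"
  assumes X: "\<And>n. X n \<in> hcar (L2 M)"
    and Cauchy: "\<And>e. e > 0 \<Longrightarrow> \<exists>N. \<forall>m\<ge>N. \<forall>n\<ge>N. hnorm (L2 M) (X m - X n) < e"
  shows "\<exists>h\<in>hcar (L2 M). \<forall>e>0. \<exists>N. \<forall>n\<ge>N. hnorm (L2 M) (X n - h) < e"
proof -
  have [measurable]: "X n \<in> borel_measurable M" for n using X by (simp add: L2_car)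
  have Xdiff: "X m - X n \<in> hcar (L2 M)" for m n using L2_diff[OF X[of m] X[of n]] by (simp add: fun_diff_def)
  have "\<exists>N. \<forall>m\<ge>N. \<forall>n\<ge>N. hnorm (L2 M) (X m - X n) < (1/4) ^ j" for j
    by (intro Cauchy) simp
  then obtain N where N: "\<And>j m n. m \<ge> N j \<Longrightarrow> n \<ge> N j \<Longrightarrow> hnorm (L2 M) (X m - X n) < (1/4) ^ j"
    by metis
  \<comment> \<open>The sum dominates every \<open>N i\<close> with \<open>i \<le> j\<close>; the
    summand \<open>j\<close> makes the index tend to infinity.\<close>
  define r where "r j = (\<Sum>i\<le>j. N i) + j" for j :: nat
  have rN: "r j \<ge> N i" if "i \<le> j" for i j
    unfolding r_def using member_le_sum[of i "{..j}" N] that by simp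
  have "AE x in M. convergent (\<lambda>j. X (r j) x)"
    by (rule L2_Cauchy_AE_subseq) (auto intro!: less_imp_le N rN X)
  moreover define h where "h x = lim (\<lambda>j. X (r j) x)" for x
  ultimately have lim: "AE x in M. (\<lambda>j. X (r j) x) \<longlonglongrightarrow> h x"
    by (auto simp: convergent_LIMSEQ_iff)
  have [measurable]: "h \<in> borel_measurable M" unfolding h_def by measurable
  \<comment> \<open>Fatou's lemma along the subsequence turns distances to late members into the
    distance to the pointwise limit.\<close>
  have bound: "(\<integral>\<^sup>+x. ennreal ((cmod (X n x - h x))\<^sup>2) \<partial>M) \<le> ennreal (e\<^sup>2)"
    if K: "\<And>m. m \<ge> K \<Longrightarrow> hnorm (L2 M) (X n - X m) \<le> e" for n K e
  proof -
    have "(\<integral>\<^sup>+x. ennreal ((cmod (X n x - h x))\<^sup>2) \<partial>M)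
        = (\<integral>\<^sup>+x. liminf (\<lambda>j. ennreal ((cmod (X n x - X (r j) x))\<^sup>2)) \<partial>M)"
    proof (rule nn_integral_cong_AE, use lim in eventually_elim)
      case (elim x)
      then have "(\<lambda>j. ennreal ((cmod (X n x - X (r j) x))\<^sup>2)) \<longlonglongrightarrow> ennreal ((cmod (X n x - h x))\<^sup>2)"
        by (intro tendsto_intros)
      then show ?case by (intro lim_imp_Liminf[symmetric]) simp_all
    qed
    also have "\<dots> \<le> liminf (\<lambda>j. \<integral>\<^sup>+x. ennreal ((cmod (X n x - X (r j) x))\<^sup>2) \<partial>M)"
      by (intro nn_integral_liminf) measurable
    also have "\<dots> \<le> liminf (\<lambda>j. ennreal (e\<^sup>2))"
    proof (rule Liminf_mono)
      have "(\<integral>\<^sup>+x. ennreal ((cmod (X n x - X (r j) x))\<^sup>2) \<partial>M) \<le> ennreal (e\<^sup>2)" if "j \<ge> K" for j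
      proof -
        have "r j \<ge> K" using that by (simp add: r_def)
        then have "(hnorm (L2 M) (X n - X (r j)))\<^sup>2 \<le> e\<^sup>2"
          using K by (intro power_mono) (auto simp: L2_hnorm)
        then show ?thesis using L2_hnorm_nn[OF Xdiff[of n "r j"]] by (simp add: ennreal_leI)
      qed
      then show "\<forall>\<^sub>F j in sequentially. (\<integral>\<^sup>+x. ennreal ((cmod (X n x - X (r j) x))\<^sup>2) \<partial>M) \<le> ennreal (e\<^sup>2)"
        using eventually_sequentially by blast
    qed
    also have "\<dots> = ennreal (e\<^sup>2)" by (simp add: Liminf_const)
    finally show ?thesis .
  qed
  \<comment> \<open>The radius 1 is \<open>(1/4) ^ 0\<close>; a finite distance from one member is
    what puts \<open>h\<close> into the space.\<close>
  have diffc: "(\<lambda>x. X n x - h x) \<in> hcar (L2 M)" if "n \<ge> N 0" for n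
  proof (rule L2_carI)
    have "hnorm (L2 M) (X n - X m) \<le> 1" if "m \<ge> N 0" for m
      using N[of 0 n m] that \<open>n \<ge> N 0\<close> by simp
    then have "(\<integral>\<^sup>+x. ennreal ((cmod (X n x - h x))\<^sup>2) \<partial>M) \<le> ennreal (1\<^sup>2)" by (rule bound)
    also have "ennreal (1\<^sup>2) < \<infinity>" by (metis ennreal_less_top infinity_ennreal_def)
    finally show "(\<integral>\<^sup>+x. ennreal ((cmod (X n x - h x))\<^sup>2) \<partial>M) < \<infinity>" .
  qed measurable
  have hc: "h \<in> hcar (L2 M)"
    using L2_diff[OF X[of "N 0"] diffc[of "N 0"]] by simp
  moreover have "\<exists>K. \<forall>n\<ge>K. hnorm (L2 M) (X n - h) < e" if e: "e > 0" for e
  proof -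
    obtain K where K: "\<And>m n. m \<ge> K \<Longrightarrow> n \<ge> K \<Longrightarrow> hnorm (L2 M) (X m - X n) < e / 2"
      using Cauchy[of "e/2"] e by (metis half_gt_zero)
    have "hnorm (L2 M) (X n - h) < e" if "n \<ge> K" for n
    proof -
      have c: "X n - h \<in> hcar (L2 M)" using L2_diff[OF X[of n] hc] by (simp add: fun_diff_def)
      have "ennreal ((hnorm (L2 M) (X n - h))\<^sup>2) \<le> ennreal ((e/2)\<^sup>2)"
        using bound[of K n "e/2"] K[OF that] L2_hnorm_nn[OF c] by (simp add: less_imp_le)
      then have "(hnorm (L2 M) (X n - h))\<^sup>2 \<le> (e/2)\<^sup>2" by simp
      from power2_le_imp_le[OF this] have "hnorm (L2 M) (X n - h) \<le> e/2" using e by simp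
      then show ?thesis using e by simp
    qed
    then show ?thesis by blast
  qed
  ultimately show ?thesis by blast
qed

lemma hilb_L2: "hilb (L2 M)"
proof
  have cadd: "x + y \<in> hcar (L2 M)" if "x \<in> hcar (L2 M)" "y \<in> hcar (L2 M)" for x y
    using L2_add[OF that] by (simp add: plus_fun_def)
  have cneg: "- x \<in> hcar (L2 M)" if "x \<in> hcar (L2 M)" for x
    using L2_scale[OF that, of "-1"] by (simp add: fun_Compl_def)
  have hadd: "hip (L2 M) x (y + z) = hip (L2 M) x y + hip (L2 M) x z"
    if "x \<in> hcar (L2 M)" "y \<in> hcar (L2 M)" "z \<in> hcar (L2 M)" for x y z
    using that by (simp add: L2_hip distrib_left L2_prod_integrable)
  have hsc: "hip (L2 M) x (hsc (L2 M) a y) = a * hip (L2 M) x y" for a x y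
    by (simp add: L2_hip L2_hsc mult.left_commute)
  have hcnj: "hip (L2 M) y x = cnj (hip (L2 M) x y)" for x y
    using Bochner_Integration.integral_cnj[of M "\<lambda>z. cnj (x z) * y z"] by (simp add: L2_hip mult.commute)
  have L2_zero: "0 \<in> hcar (L2 M)" by (simp add: L2_car zero_fun_def)
  show "is_hilbert_sp (L2 M)"
    unfolding is_hilbert_sp_def
    using L2_complete[of _ M]
    by (intro conjI allI ballI impI cadd cneg hadd hsc hcnj L2_zero)
      (auto simp: L2_hsc L2_scale fun_eq_iff algebra_simps L2_hip_self)
qed

section \<open>Density of indicators over an intersection-stable generator\<close>

context finite_measure
begin

lemma L2_indicator: "A \<in> sets M \<Longrightarrow> (indicator A :: 'a \<Rightarrow> complex) \<in> hcar (L2 M)"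
proof -
  assume A: "A \<in> sets M"
  have "(cmod (indicator A x))\<^sup>2 = indicator A x" for x by (simp add: indicator_def)
  then show ?thesis using A by (simp add: L2_car emeasure_eq_measure)
qed

lemma L2_hip_indicator:
  assumes "A \<in> sets M" "B \<in> sets M"
  shows "hip (L2 M) (indicator A) (indicator B) = of_real (measure M (A \<inter> B))"
proof -
  have "cnj (indicator A x) * indicator B x = complex_of_real (indicator (A \<inter> B) x)" for x
    by (simp add: indicator_def)
  then have "hip (L2 M) (indicator A) (indicator B) = (\<integral>x. complex_of_real (indicator (A \<inter> B) x) \<partial>M)"
    by (simp add: L2_hip)
  also have "\<dots> = of_real (measure M (A \<inter> B))"
    using assms sets.sets_into_space[of "A \<inter> B" M] by (simp only: integral_complex_of_real) (simp add: Int_absorb1 Int_absorb2)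
  finally show ?thesis .
qed

lemma L2_hnorm_indicator:
  assumes "A \<in> sets M"
  shows "hnorm (L2 M) (indicator A) = sqrt (measure M A)"
  using L2_hip_indicator[OF assms assms] by (simp add: hnorm_def)

text \<open>The sets whose indicator lies in the closed span form a Dynkin system: complements use
  the indicator of the whole space, and disjoint unions converge in norm because the measure is
  finite. From indicators the claim passes to simple functions and then, by dominated convergence,
  to all of \<open>L2\<close>.\<close>

lemma L2_dense_indicators:
  assumes E: "Int_stable E" "E \<subseteq> Pow (space M)" "sets M = sigma_sets (space M) E" "space M \<in> E"
    and S: "S \<subseteq> hcar (L2 M)" and ES: "\<And>A. A \<in> E \<Longrightarrow> indicator A \<in> hilb.hclos (L2 M) S"
  shows "hcar (L2 M) \<subseteq> hilb.hclos (L2 M) S"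
proof -
  interpret L: hilb "L2 M" by (rule hilb_L2)
  have ind: "indicator A \<in> L.hclos S" if "A \<in> sets M" for A
    using E(1,2) that[unfolded E(3)]
  proof (induction rule: sigma_sets_induct_disjoint)
    case (basic A)
    then show ?case by (rule ES)
  next
    case empty
    have "(indicator {} :: 'a \<Rightarrow> complex) = 0" by (auto simp: fun_eq_iff)
    then show ?case using L.hclos_zero by (simp only:)
  next
    case (compl A)
    then have "A \<subseteq> space M" using sigma_sets_into_sp[OF E(2)] by auto
    then have "(indicator (space M - A) :: 'a \<Rightarrow> complex)
        = indicator (space M) + hsc (L2 M) (-1) (indicator A)"
      by (auto simp: fun_eq_iff L2_hsc indicator_def)
    then show ?case using L.hclos_add[OF S ES[OF E(4)] L.hclos_sc[OF S compl(2), of "-1"]] by (simp only:)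
  next
    case (union A)
    then have A: "A i \<in> sets M" for i by (auto simp: E(3))
    define B where "B n = (\<Union>i<n. A i)" for n
    have B: "B n \<in> sets M" for n using A by (auto simp: B_def)
    have indB: "(indicator (B n) :: 'a \<Rightarrow> complex) = (\<Sum>i<n. indicator (A i))" for n
    proof (rule ext)
      fix x
      have "disjoint_family_on A {..<n}" using union(1) by (auto simp: disjoint_family_on_def)
      then have "(indicator (B n) x :: complex) = (\<Sum>i<n. indicator (A i) x)"
        unfolding B_def by (intro indicator_UN_disjoint) auto
      then show "(indicator (B n) x :: complex) = (\<Sum>i<n. indicator (A i)) x"
        by (simp add: sum_fun_apply)
    qed
    have "(\<lambda>n. measure M (B n)) \<longlonglongrightarrow> measure M (\<Union>n. B n)"
      using B by (intro finite_Lim_measure_incseq) (auto simp: B_def incseq_def intro: less_le_trans)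
    moreover have UB: "(\<Union>n. B n) = (\<Union>i. A i)" by (auto simp: B_def)
    ultimately have "(\<lambda>n. measure M (\<Union>i. A i) - measure M (B n)) \<longlonglongrightarrow> measure M (\<Union>i. A i) - measure M (\<Union>i. A i)"
      by (intro tendsto_intros) simp
    then have lim: "(\<lambda>n. sqrt (measure M (\<Union>i. A i) - measure M (B n))) \<longlonglongrightarrow> 0"
      using tendsto_real_sqrt by fastforce
    show ?case
    proof (rule L.hclos_limit[OF S])
      show "indicator (\<Union>i. A i) \<in> hcar (L2 M)" using A by (intro L2_indicator) auto
      fix e :: real assume "e > 0"
      then obtain n where n: "sqrt (measure M (\<Union>i. A i) - measure M (B n)) < e"
        using order_tendstoD(2)[OF lim] by (auto simp: eventually_sequentially)
      have sub: "B n \<subseteq> (\<Union>i. A i)" by (auto simp: B_def)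
      have "(indicator (\<Union>i. A i) - indicator (B n) :: 'a \<Rightarrow> complex) = indicator ((\<Union>i. A i) - B n)"
        using sub by (auto simp: fun_eq_iff indicator_def)
      then have "hnorm (L2 M) (indicator (\<Union>i. A i) - indicator (B n)) < e"
        using n A B sub by (simp add: L2_hnorm_indicator finite_measure_Diff sets.countable_UN)
      moreover have "indicator (B n) \<in> L.hclos S"
        unfolding indB using union(3) by (intro L.hclos_sum[OF S]) auto
      ultimately show "\<exists>z\<in>L.hclos S. hnorm (L2 M) (indicator (\<Union>i. A i) - z) < e" by blast
    qed
  qed
  have simple: "s \<in> L.hclos S" if s: "simple_function M s" "s \<in> hcar (L2 M)" for s :: "'a \<Rightarrow> complex"
  proof (rule L.hclos_null[OF S s(2)])
    let ?z = "\<Sum>y\<in>s ` space M. hsc (L2 M) y (indicator (s -` {y} \<inter> space M))"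
    show z: "?z \<in> L.hclos S"
      using s by (intro L.hclos_sum L.hclos_sc S ind) (auto intro: simple_functionD)
    have "AE x in M. (s - ?z) x = 0"
    proof (rule AE_I2)
      fix x assume x: "x \<in> space M"
      have "?z x = (\<Sum>y\<in>s ` space M. y * indicator (s -` {y} \<inter> space M) x)"
        by (simp add: sum_fun_apply L2_hsc)
      also have "\<dots> = (\<Sum>y\<in>s ` space M. if y = s x then s x else 0)"
        using x by (intro sum.cong) (auto simp: indicator_def)
      also have "\<dots> = s x" using x simple_functionD(1)[OF s(1)] by (simp add: sum.delta)
      finally show "(s - ?z) x = 0" by simp
    qed
    then show "hnull (L2 M) (s - ?z)" by (rule L2_hnullI)
  qed
  show ?thesis
  proof
    fix g assume g: "g \<in> hcar (L2 M)"
    note [measurable] = L2_measurable[OF g]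
    obtain s where s': "\<forall>i. simple_function M (s i)" "\<forall>x\<in>space M. (\<lambda>i. s i x) \<longlonglongrightarrow> g x"
      "\<forall>i. \<forall>x\<in>space M. dist (s i x) 0 \<le> 2 * dist (g x) 0"
      using borel_measurable_implies_sequence_metric[OF L2_measurable[OF g], of 0] by blast
    then have s: "\<And>i. simple_function M (s i)" "\<And>x. x \<in> space M \<Longrightarrow> (\<lambda>i. s i x) \<longlonglongrightarrow> g x"
      "\<And>i x. x \<in> space M \<Longrightarrow> cmod (s i x) \<le> 2 * cmod (g x)" by simp_all
    note [measurable] = borel_measurable_simple_function[OF s(1)]
    have sc: "s i \<in> hcar (L2 M)" for i
      unfolding L2_car
    proof
      show "integrable M (\<lambda>x. (cmod (s i x))\<^sup>2)"
      proof (rule Bochner_Integration.integrable_bound)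
        show "integrable M (\<lambda>x. 4 * (cmod (g x))\<^sup>2)" using g by (simp add: L2_car)
        show "AE x in M. norm ((cmod (s i x))\<^sup>2) \<le> norm (4 * (cmod (g x))\<^sup>2)"
          using power_mono[OF s(3), of _ i 2] by (auto simp: power_mult_distrib)
      qed measurable
    qed measurable
    have "(\<lambda>i. \<integral>x. (cmod ((g - s i) x))\<^sup>2 \<partial>M) \<longlonglongrightarrow> (\<integral>x. 0 \<partial>M)"
    proof (rule integral_dominated_convergence)
      \<comment> \<open>The factor 9 is \<open>(1 + 2)\<close> squared, the simple functions being
        bounded by \<open>2 * cmod (g x)\<close>.\<close>
      show "integrable M (\<lambda>x. 9 * (cmod (g x))\<^sup>2)" using g by (simp add: L2_car)
      have "(cmod ((g - s i) x))\<^sup>2 \<le> 9 * (cmod (g x))\<^sup>2" if "x \<in> space M" for i x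
      proof -
        have "cmod ((g - s i) x) \<le> 3 * cmod (g x)"
          using norm_triangle_ineq4[of "g x" "s i x"] s(3)[OF that, of i] by simp
        then have "(cmod ((g - s i) x))\<^sup>2 \<le> (3 * cmod (g x))\<^sup>2" by (intro power_mono) auto
        then show ?thesis by (simp add: power_mult_distrib)
      qed
      then show "AE x in M. norm ((cmod ((g - s i) x))\<^sup>2) \<le> 9 * (cmod (g x))\<^sup>2" for i by simp
      show "AE x in M. (\<lambda>i. (cmod ((g - s i) x))\<^sup>2) \<longlonglongrightarrow> 0"
      proof (rule AE_I2)
        fix x assume "x \<in> space M"
        from tendsto_power[OF tendsto_norm[OF tendsto_diff[OF tendsto_const[of "g x"] s(2)[OF this]]], of 2]
        show "(\<lambda>i. (cmod ((g - s i) x))\<^sup>2) \<longlonglongrightarrow> 0" by simp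
      qed
    qed (simp_all add: fun_diff_def)
    then have lim: "(\<lambda>i. hnorm (L2 M) (g - s i)) \<longlonglongrightarrow> 0"
      unfolding L2_hnorm using tendsto_real_sqrt by fastforce
    show "g \<in> L.hclos S"
    proof (rule L.hclos_limit[OF S g])
      fix e :: real assume "e > 0"
      then obtain n where "hnorm (L2 M) (g - s n) < e"
        using order_tendstoD(2)[OF lim] by (auto simp: eventually_sequentially)
      then show "\<exists>z\<in>L.hclos S. hnorm (L2 M) (g - z) < e" using simple[OF s(1) sc] by blast
    qed
  qed
qed

end

section \<open>Paths in higher-rank graphs\<close>

lemma Nk_zero [simp]: "0 \<in> Nk k"
  and Nk_add [simp]: "m \<in> Nk k \<Longrightarrow> n \<in> Nk k \<Longrightarrow> m + n \<in> Nk k"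
  and Nk_diff [simp]: "m \<in> Nk k \<Longrightarrow> m - n \<in> Nk k"
  and Nk_sup [simp]: "m \<in> Nk k \<Longrightarrow> n \<in> Nk k \<Longrightarrow> sup m n \<in> Nk k"
  by (auto simp: Nk_def)

lemma zero_le_multidegree [simp]: "0 \<le> (m :: nat \<Rightarrow> nat)"
  by (simp add: le_fun_def)

lemma multidegree_diff_add: "m \<le> n \<Longrightarrow> m + (n - m) = (n :: nat \<Rightarrow> nat)"
  by (auto simp: le_fun_def fun_eq_iff)

lemma multidegree_add_diff [simp]: "m + n - m = (n :: nat \<Rightarrow> nat)" "n + m - m = (n :: nat \<Rightarrow> nat)"
  by (auto simp: fun_eq_iff)

lemma multidegree_le_add [simp]: "m \<le> m + (n :: nat \<Rightarrow> nat)" "m \<le> n + (m :: nat \<Rightarrow> nat)"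
  by (auto simp: le_fun_def)

lemma countable_Nk: "countable (Nk k)"
proof (rule countable_image_inj_on)
  show "countable ((\<lambda>n. map n [0..<k]) ` Nk k)" by (rule countableI_type)
  show "inj_on (\<lambda>n. map n [0..<k]) (Nk k)"
  proof (rule inj_onI, rule ext)
    fix m n :: "nat \<Rightarrow> nat" and i assume "m \<in> Nk k" "n \<in> Nk k" "map m [0..<k] = map n [0..<k]"
    then show "m i = n i" by (cases "i < k") (auto simp: Nk_def)
  qed
qed

locale kgr =
  fixes k :: nat and G :: "'a kgraph"
  assumes kg: "is_kgraph k G" and fin: "finite_kgraph G"
begin

lemma
  assumes "l \<in> mor G"
  shows deg_Nk [simp]: "deg G l \<in> Nk k" and rng_mor [simp]: "rng G l \<in> mor G"
    and src_mor [simp]: "src G l \<in> mor G"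
    and rng_rng [simp]: "rng G (rng G l) = rng G l" and src_rng [simp]: "src G (rng G l) = rng G l"
    and rng_src [simp]: "rng G (src G l) = src G l" and src_src [simp]: "src G (src G l) = src G l"
    and cmp_rng [simp]: "cmp G (rng G l) l = l" and cmp_src [simp]: "cmp G l (src G l) = l"
  using kg assms unfolding is_kgraph_def by auto

lemma
  assumes "l \<in> mor G" "m \<in> mor G" "src G l = rng G m"
  shows cmp_mor [simp]: "cmp G l m \<in> mor G" and rng_cmp [simp]: "rng G (cmp G l m) = rng G l"
    and src_cmp [simp]: "src G (cmp G l m) = src G m" and deg_cmp [simp]: "deg G (cmp G l m) = deg G l + deg G m"
  using kg assms unfolding is_kgraph_def by auto

lemma cmp_assoc:
  assumes "l \<in> mor G" "m \<in> mor G" "n \<in> mor G" "src G l = rng G m" "src G m = rng G n"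
  shows "cmp G (cmp G l m) n = cmp G l (cmp G m n)"
  using kg assms unfolding is_kgraph_def by auto

lemma factorisation:
  assumes "l \<in> mor G" "deg G l = m + n"
  shows "\<exists>!p. fst p \<in> mor G \<and> snd p \<in> mor G \<and> src G (fst p) = rng G (snd p) \<and>
               cmp G (fst p) (snd p) = l \<and> deg G (fst p) = m \<and> deg G (snd p) = n"
  using kg assms unfolding is_kgraph_def by (elim conjE) blast

text \<open>Equal composites and equal first degrees force equal second degrees, so both pairs are
  factorisations of one morphism of the same type, and uniqueness applies.\<close>

lemma cmp_cancel:
  assumes "a \<in> mor G" "b \<in> mor G" "src G a = rng G b" "a' \<in> mor G" "b' \<in> mor G" "src G a' = rng G b'"
    and eq: "cmp G a b = cmp G a' b'" and d: "deg G a = deg G a'"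
  shows "a = a'" "b = b'"
proof -
  have "deg G a + deg G b = deg G a + deg G b'"
    using deg_cmp[OF assms(1-3)] deg_cmp[OF assms(4-6)] eq d by metis
  then have db: "deg G b = deg G b'" by simp
  have "deg G (cmp G a b) = deg G a + deg G b" by (rule deg_cmp[OF assms(1-3)])
  from factorisation[OF cmp_mor[OF assms(1-3)] this] obtain p
    where p: "\<And>q. fst q \<in> mor G \<and> snd q \<in> mor G \<and> src G (fst q) = rng G (snd q) \<and>
      cmp G (fst q) (snd q) = cmp G a b \<and> deg G (fst q) = deg G a \<and> deg G (snd q) = deg G b \<Longrightarrow> q = p"
    by (elim ex1E) blast
  have "(a, b) = p" "(a', b') = p" by (rule p; use assms db in simp)+
  then show "a = a'" "b = b'" by auto
qed

lemma deg_rng [simp]: "l \<in> mor G \<Longrightarrow> deg G (rng G l) = 0"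
  using deg_cmp[of "rng G l" l] by simp

lemma deg_src [simp]: "l \<in> mor G \<Longrightarrow> deg G (src G l) = 0"
  using deg_cmp[of l "src G l"] by simp

text \<open>Both \<open>rng G v\<close> followed by \<open>v\<close> and \<open>v\<close> followed
  by \<open>src G v\<close> factor \<open>v\<close> into two pieces of degree 0, hence
  agree.\<close>

lemma vertex_rng: "v \<in> mor G \<Longrightarrow> deg G v = 0 \<Longrightarrow> rng G v = v"
  using cmp_cancel[of "rng G v" v v "src G v"] by simp

lemma vertex_src: "v \<in> mor G \<Longrightarrow> deg G v = 0 \<Longrightarrow> src G v = v"
  by (rule cmp_cancel(2)[of "rng G v" v v, symmetric]) auto

lemma rng_vertex [simp]: "l \<in> mor G \<Longrightarrow> rng G l \<in> vertices G"
  and src_vertex [simp]: "l \<in> mor G \<Longrightarrow> src G l \<in> vertices G"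
  by (auto simp: vertices_def)

lemma vertexD:
  assumes "v \<in> vertices G" shows "v \<in> mor G" "deg G v = 0" "rng G v = v" "src G v = v"
  using assms vertex_rng vertex_src by (auto simp: vertices_def)

section \<open>Initial segments and infinite paths\<close>

text \<open>The prefix order on morphisms. Prefixes of one morphism are determined by their degrees,
  so most arguments about paths become comparisons of degrees.\<close>

definition ext :: "'a \<Rightarrow> 'a \<Rightarrow> bool" where
  "ext l n \<longleftrightarrow> l \<in> mor G \<and> (\<exists>b\<in>mor G. src G l = rng G b \<and> cmp G l b = n)"

lemma ext_cmp [simp]: "l \<in> mor G \<Longrightarrow> b \<in> mor G \<Longrightarrow> src G l = rng G b \<Longrightarrow> ext l (cmp G l b)"
  by (auto simp: ext_def)

lemma ext_mor: "ext l n \<Longrightarrow> l \<in> mor G \<and> n \<in> mor G"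
  by (auto simp: ext_def)

lemma ext_deg_le: "ext l n \<Longrightarrow> deg G l \<le> deg G n"
  by (auto simp: ext_def)

lemma ext_trans:
  assumes "ext a b" "ext b c" shows "ext a c"
proof -
  obtain u w where "u \<in> mor G" "src G a = rng G u" "cmp G a u = b"
    "w \<in> mor G" "src G b = rng G w" "cmp G b w = c" "a \<in> mor G"
    using assms by (auto simp: ext_def)
  then have "cmp G u w \<in> mor G \<and> src G a = rng G (cmp G u w) \<and> cmp G a (cmp G u w) = c"
    using cmp_assoc[of a u w] src_cmp[of a u] by auto
  then show ?thesis using \<open>a \<in> mor G\<close> by (auto simp: ext_def)
qed

lemma ext_unique:
  assumes "ext a n" "ext a' n" "deg G a = deg G a'" shows "a = a'"
proof -
  obtain b b' where "a \<in> mor G" "b \<in> mor G" "src G a = rng G b" "cmp G a b = n"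
    "a' \<in> mor G" "b' \<in> mor G" "src G a' = rng G b'" "cmp G a' b' = n"
    using assms by (auto simp: ext_def)
  then show ?thesis using cmp_cancel(1)[of a b a' b'] assms(3) by auto
qed

lemma ext_exists:
  assumes "n \<in> mor G" "m \<le> deg G n" shows "\<exists>a. ext a n \<and> deg G a = m"
  using factorisation[OF assms(1), of m "deg G n - m"] multidegree_diff_add[OF assms(2)]
  by (auto simp: ext_def)

text \<open>The longer prefix is cut at the degree of the shorter; the piece obtained is again a
  prefix of \<open>n\<close> and hence equals \<open>a\<close>.\<close>

lemma ext_chain:
  assumes "ext a n" "ext b n" "deg G a \<le> deg G b" shows "ext a b"
proof -
  obtain c where "ext c b" "deg G c = deg G a" using ext_exists[of b "deg G a"] assms ext_mor by auto
  then show ?thesis using ext_unique[of c n a] ext_trans[of c b n] assms by auto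
qed

lemma
  assumes "x \<in> inf_paths k G" "p \<in> Nk k" "q \<in> Nk k" "p \<le> q"
  shows path_mor [simp]: "x (p, q) \<in> mor G" and path_deg [simp]: "deg G (x (p, q)) = q - p"
    and path_rng: "rng G (x (p, q)) = x (p, p)" and path_src: "src G (x (p, q)) = x (q, q)"
  using assms by (auto simp: inf_paths_def)

lemma path_cmp:
  assumes "x \<in> inf_paths k G" "p \<in> Nk k" "q \<in> Nk k" "r \<in> Nk k" "p \<le> q" "q \<le> r"
  shows "cmp G (x (p, q)) (x (q, r)) = x (p, r)"
proof -
  have "\<forall>p\<in>Nk k. \<forall>q\<in>Nk k. \<forall>r\<in>Nk k. p \<le> q \<longrightarrow> q \<le> r \<longrightarrow> cmp G (x (p, q)) (x (q, r)) = x (p, r)"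
    using assms(1) unfolding inf_paths_def mem_Collect_eq by (elim conjE)
  then show ?thesis using assms(2-) by simp
qed

lemma path_undefined:
  assumes "x \<in> inf_paths k G" "\<not> (p \<in> Nk k \<and> q \<in> Nk k \<and> p \<le> q)"
  shows "x (p, q) = undefined"
proof -
  have "\<forall>p q. \<not> (p \<in> Nk k \<and> q \<in> Nk k \<and> p \<le> q) \<longrightarrow> x (p, q) = undefined"
    using assms(1) unfolding inf_paths_def mem_Collect_eq by (elim conjE)
  then show ?thesis using assms(2) by simp
qed

lemma path_ext:
  assumes "x \<in> inf_paths k G" "p \<in> Nk k" "q \<in> Nk k" "p \<le> q"
  shows "ext (x (0, p)) (x (0, q))"
  using assms path_cmp[of x 0 p q] path_src[of x 0 p] path_rng[of x p q]
  unfolding ext_def by (auto intro!: bexI[of _ "x (p, q)"])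

text \<open>Cancelling \<open>x (0, p)\<close> from \<open>x (0, q)\<close> leaves
  \<open>x (p, q)\<close>; outside the domain both paths are \<open>undefined\<close>.\<close>

lemma path_eqI:
  assumes x: "x \<in> inf_paths k G" and y: "y \<in> inf_paths k G"
    and eq: "\<And>n. n \<in> Nk k \<Longrightarrow> x (0, n) = y (0, n)"
  shows "x = y"
proof (rule ext, clarify)
  fix p q :: "nat \<Rightarrow> nat"
  show "x (p, q) = y (p, q)"
  proof (cases "p \<in> Nk k \<and> q \<in> Nk k \<and> p \<le> q")
    case True
    then show ?thesis
      using cmp_cancel(2)[of "x (0, p)" "x (p, q)" "y (0, p)" "y (p, q)"] x y eq[of p] eq[of q]
        path_cmp[of x 0 p q] path_cmp[of y 0 p q] path_src[of x 0 p] path_src[of y 0 p]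
        path_rng[of x p q] path_rng[of y p q] by simp
  next
    case False
    then show ?thesis using path_undefined[OF x False] path_undefined[OF y False] by simp
  qed
qed

text \<open>A coherent choice of initial segments is enough data for an infinite path: the segment
  from \<open>p\<close> to \<open>q\<close> is the complement of \<open>e p\<close> in
  \<open>e q\<close>, and functoriality follows from uniqueness of complements.\<close>

lemma path_construct:
  assumes e: "\<And>n. n \<in> Nk k \<Longrightarrow> e n \<in> mor G" "\<And>n. n \<in> Nk k \<Longrightarrow> deg G (e n) = n"
    and chain: "\<And>m n. m \<in> Nk k \<Longrightarrow> n \<in> Nk k \<Longrightarrow> m \<le> n \<Longrightarrow> ext (e m) (e n)"
  shows "\<exists>x\<in>inf_paths k G. \<forall>n\<in>Nk k. x (0, n) = e n"
proof -
  have "\<exists>b. b \<in> mor G \<and> src G (e p) = rng G b \<and> cmp G (e p) b = e q"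
    if "p \<in> Nk k" "q \<in> Nk k" "p \<le> q" for p q using chain[OF that] by (auto simp: ext_def)
  then obtain b where b: "\<And>p q. p \<in> Nk k \<Longrightarrow> q \<in> Nk k \<Longrightarrow> p \<le> q \<Longrightarrow>
      b p q \<in> mor G \<and> src G (e p) = rng G (b p q) \<and> cmp G (e p) (b p q) = e q"
    by metis
  define x where "x = (\<lambda>(p, q). if p \<in> Nk k \<and> q \<in> Nk k \<and> p \<le> q then b p q else undefined)"
  \<comment> \<open>Every later identity about segments is proved by checking that the candidate
    solves the equation defining \<open>b p q\<close>.\<close>
  have bu: "b p q = c" if "p \<in> Nk k" "q \<in> Nk k" "p \<le> q" "c \<in> mor G" "src G (e p) = rng G c" "cmp G (e p) c = e q" for p q c
    using cmp_cancel(2)[of "e p" "b p q" "e p" c] b[of p q] that e by simp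
  have bpp: "b p p = src G (e p)" if "p \<in> Nk k" for p
    using that e by (intro bu) auto
  have "x \<in> inf_paths k G"
    unfolding inf_paths_def
  proof (intro CollectI conjI ballI impI allI)
    fix p q :: "nat \<Rightarrow> nat" assume pq: "p \<in> Nk k" "q \<in> Nk k" "p \<le> q"
    note bpq = b[OF pq]
    show "x (p, q) \<in> mor G" using pq bpq by (simp add: x_def)
    have "p + deg G (b p q) = q" using bpq deg_cmp[of "e p" "b p q"] e pq by simp
    from arg_cong[OF this, of "\<lambda>z. z - p"] show "deg G (x (p, q)) = q - p"
      using pq by (simp add: x_def)
    show "rng G (x (p, q)) = x (p, p)" using pq bpq by (simp add: x_def bpp)
    have "src G (b p q) = src G (e q)" using bpq src_cmp[of "e p" "b p q"] e pq by simp
    then show "src G (x (p, q)) = x (q, q)" using pq by (simp add: x_def bpp)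
    fix r :: "nat \<Rightarrow> nat" assume r: "r \<in> Nk k" "q \<le> r"
    note bqr = b[OF pq(2) r]
    have sb: "src G (b p q) = rng G (b q r)" using bqr \<open>src G (b p q) = src G (e q)\<close> by simp
    have "b p r = cmp G (b p q) (b q r)"
      using pq r bpq bqr sb e cmp_assoc[of "e p" "b p q" "b q r"] by (intro bu) auto
    then show "cmp G (x (p, q)) (x (q, r)) = x (p, r)" using pq r by (auto simp: x_def)
  next
    fix p q :: "nat \<Rightarrow> nat" assume "\<not> (p \<in> Nk k \<and> q \<in> Nk k \<and> p \<le> q)"
    then show "x (p, q) = undefined" by (auto simp: x_def)
  qed
  moreover have "x (0, n) = e n" if n: "n \<in> Nk k" for n
  proof -
    \<comment> \<open>By construction \<open>x (0, n)\<close> is \<open>b 0 n\<close>, the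
      complement of \<open>e 0\<close>; since \<open>e 0\<close> is a vertex, that complement is
      \<open>e n\<close> itself.\<close>
    have "src G (e 0) = e 0" using e by (intro vertex_src) auto
    then have "e n = cmp G (e 0) (b 0 n)" "e 0 = rng G (b 0 n)" "b 0 n \<in> mor G" using b[of 0 n] n by auto
    then show ?thesis using n by (simp add: x_def)
  qed
  ultimately show ?thesis by blast
qed

section \<open>Cylinders, shifts and prefixing\<close>

abbreviation "Z \<equiv> cyl k G"
abbreviation "\<Omega> \<equiv> inf_paths k G"

lemma cylD: "x \<in> Z l \<Longrightarrow> x \<in> \<Omega> \<and> x (0, deg G l) = l"
  by (simp add: cyl_def)

lemma shift_apply: "p \<in> Nk k \<Longrightarrow> q \<in> Nk k \<Longrightarrow> p \<le> q \<Longrightarrow> shift k m x (p, q) = x (p + m, q + m)"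
  by (simp add: shift_def)

lemma shift_path:
  assumes x: "x \<in> \<Omega>" and m: "m \<in> Nk k" shows "shift k m x \<in> \<Omega>"
  unfolding inf_paths_def
proof (intro CollectI conjI ballI impI allI)
  fix p q :: "nat \<Rightarrow> nat" assume pq: "p \<in> Nk k" "q \<in> Nk k" "p \<le> q"
  have le: "p + m \<le> q + m" using pq by (simp add: le_fun_def)
  have eq: "q + m - (p + m) = q - p" by (auto simp: fun_eq_iff)
  show "shift k m x (p, q) \<in> mor G" "deg G (shift k m x (p, q)) = q - p"
    "rng G (shift k m x (p, q)) = shift k m x (p, p)" "src G (shift k m x (p, q)) = shift k m x (q, q)"
    using pq m x le eq path_rng[of x "p + m" "q + m"] path_src[of x "p + m" "q + m"]
    by (simp_all add: shift_apply)
  fix r :: "nat \<Rightarrow> nat" assume r: "r \<in> Nk k" "q \<le> r"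
  have "q + m \<le> r + m" "p \<le> r" using pq r by (auto simp: le_fun_def intro: order_trans)
  then show "cmp G (shift k m x (p, q)) (shift k m x (q, r)) = shift k m x (p, r)"
    using pq r m x le by (simp add: shift_apply path_cmp)
qed (auto simp: shift_def)

lemma shift_zero: "x \<in> \<Omega> \<Longrightarrow> shift k 0 x = x"
  using path_undefined by (intro path_eqI shift_path) (auto simp: shift_apply)

lemma cyl_src_iff: "l \<in> mor G \<Longrightarrow> x \<in> Z (src G l) \<longleftrightarrow> x \<in> \<Omega> \<and> x (0, 0) = src G l"
  by (simp add: cyl_def)

lemma path_via_shift:
  assumes x: "x \<in> \<Omega>" and l: "l \<in> mor G" "x (0, deg G l) = l" and n: "n \<in> Nk k"
  shows "x (0, n + deg G l) = cmp G l (shift k (deg G l) x (0, n))"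
    and "src G l = rng G (shift k (deg G l) x (0, n))"
  using path_cmp[of x 0 "deg G l" "n + deg G l"] path_src[of x 0 "deg G l"]
    path_rng[of x "deg G l" "n + deg G l"] assms by (simp_all add: shift_apply)

lemma shift_cyl:
  assumes "l \<in> mor G" "x \<in> Z l" shows "shift k (deg G l) x \<in> Z (src G l)"
  unfolding cyl_src_iff[OF assms(1)]
  using assms path_via_shift(2)[of x l 0] shift_path[of x "deg G l"] path_rng[of "shift k (deg G l) x" 0 0]
  by (auto dest: cylD)

text \<open>The products \<open>w n\<close> of \<open>l\<close> with the initial segments of
  \<open>x\<close> form a coherent chain, but \<open>w n\<close> has degree
  \<open>deg G l + n\<close>. The new path takes as its segment of degree \<open>n\<close> the
  prefix \<open>e n\<close> of \<open>w n\<close>.\<close>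

lemma prefix_exists:
  assumes l: "l \<in> mor G" and x: "x \<in> Z (src G l)"
  shows "\<exists>y\<in>Z l. shift k (deg G l) y = x"
proof -
  let ?d = "deg G l"
  have xp: "x \<in> \<Omega>" and x0: "x (0, 0) = src G l" using assms by (auto simp: cyl_src_iff)
  have c: "src G l = rng G (x (0, n))" if "n \<in> Nk k" for n
    using path_rng[OF xp _ that, of 0] x0 by simp
  define w where "w n = cmp G l (x (0, n))" for n
  have w: "w n \<in> mor G" "deg G (w n) = ?d + n" if "n \<in> Nk k" for n
    using that xp l c[OF that] by (auto simp: w_def)
  have wext: "ext (w m) (w n)" if "m \<in> Nk k" "n \<in> Nk k" "m \<le> n" for m n
  proof -
    have sr: "src G (x (0, m)) = rng G (x (m, n))"
      using path_src[of x 0 m] path_rng[of x m n] xp that by simp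
    have "w n = cmp G (w m) (x (m, n))"
      using cmp_assoc[of l "x (0, m)" "x (m, n)"] path_cmp[of x 0 m n] xp l that c[of m] sr
      by (simp add: w_def)
    moreover have "src G (w m) = rng G (x (m, n))" using that l xp c[of m] sr by (simp add: w_def)
    ultimately show ?thesis using w that xp by simp
  qed
  have "\<exists>a. ext a (w n) \<and> deg G a = n" if "n \<in> Nk k" for n
    using w[OF that] by (intro ext_exists) auto
  then obtain e where e: "\<And>n. n \<in> Nk k \<Longrightarrow> ext (e n) (w n) \<and> deg G (e n) = n" by metis
  have "\<exists>y\<in>\<Omega>. \<forall>n\<in>Nk k. y (0, n) = e n"
  proof (rule path_construct)
    fix m n assume mn: "m \<in> Nk k" "n \<in> Nk k" "m \<le> n"
    have "ext (e m) (w n)" using e[OF mn(1)] wext[OF mn] ext_trans by blast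
    then show "ext (e m) (e n)" using e[OF mn(1)] e[OF mn(2)] mn ext_chain[of "e m" "w n" "e n"] by auto
  qed (use e ext_mor in auto)
  then obtain y where y: "y \<in> \<Omega>" "\<And>n. n \<in> Nk k \<Longrightarrow> y (0, n) = e n" by blast
  have "ext l (w ?d)" using l c xp by (simp add: w_def)
  then have ed: "e ?d = l" using e[of ?d] l by (intro ext_unique[of _ "w ?d"]) auto
  then have yl: "y (0, ?d) = l" using y l by simp
  have "shift k ?d y = x"
  proof (rule path_eqI)
    fix n assume n: "n \<in> Nk k"
    have "ext (w n) (w (n + ?d))" using n l by (intro wext) auto
    then have "e (n + ?d) = w n" using e[of "n + ?d"] w[OF n] n l
      by (intro ext_unique[of _ "w (n + ?d)"]) (auto simp: add.commute)
    then have "cmp G l (shift k ?d y (0, n)) = cmp G l (x (0, n))"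
      using path_via_shift(1)[of y l n] y yl l n by (simp add: w_def)
    then show "shift k ?d y (0, n) = x (0, n)"
      using path_via_shift(2)[of y l n] y yl l n c[OF n] xp shift_path[of y ?d]
        cmp_cancel(2)[of l "shift k ?d y (0, n)" l "x (0, n)"] by simp
  qed (use y l xp shift_path in auto)
  then show ?thesis using y yl by (auto simp: cyl_def)
qed

text \<open>At degree \<open>n + deg G l\<close> both paths are \<open>l\<close> followed by a
  segment of the common shift; cutting back to degree \<open>n\<close> gives equality.\<close>

lemma prefix_unique:
  assumes l: "l \<in> mor G" and y: "y \<in> Z l" and y': "y' \<in> Z l"
    and eq: "shift k (deg G l) y = shift k (deg G l) y'"
  shows "y = y'"
proof (rule path_eqI)
  fix n assume n: "n \<in> Nk k"
  have "y (0, n + deg G l) = y' (0, n + deg G l)"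
    using path_via_shift(1)[of y l n] path_via_shift(1)[of y' l n] cylD[OF y] cylD[OF y'] l n eq by simp
  then show "y (0, n) = y' (0, n)"
    using path_ext[of y n "n + deg G l"] path_ext[of y' n "n + deg G l"] cylD[OF y] cylD[OF y'] l n
    by (intro ext_unique[of _ "y (0, n + deg G l)"]) auto
qed (use y y' in \<open>auto simp: cyl_def\<close>)

lemma prefix_eq:
  assumes "l \<in> mor G" "y \<in> Z l" "shift k (deg G l) y = x"
  shows "prefix k G l x = y"
  unfolding prefix_def
  by (rule the_equality) (use assms prefix_unique[OF assms(1)] in \<open>auto simp: cyl_def\<close>)

lemma prefix_shift: "l \<in> mor G \<Longrightarrow> y \<in> Z l \<Longrightarrow> prefix k G l (shift k (deg G l) y) = y"
  by (simp add: prefix_eq)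

lemma
  assumes "l \<in> mor G" "x \<in> Z (src G l)"
  shows prefix_cyl: "prefix k G l x \<in> Z l" and shift_prefix: "shift k (deg G l) (prefix k G l x) = x"
  using prefix_exists[OF assms] prefix_eq[OF assms(1)] by auto

text \<open>Writing a forward image as a preimage under the shift is what makes images under the
  prefixing map measurable.\<close>

lemma prefix_image:
  assumes "l \<in> mor G" "A \<subseteq> Z (src G l)"
  shows "prefix k G l ` A = Z l \<inter> shift k (deg G l) -` A"
proof -
  have "y \<in> prefix k G l ` A" if "y \<in> Z l" "shift k (deg G l) y \<in> A" for y
    using prefix_shift[OF assms(1) that(1)] that(2) by (intro image_eqI[where x = "shift k (deg G l) y"]) auto
  then show ?thesis using assms prefix_cyl shift_prefix by auto
qed

lemma cyl_ext_subset:
  assumes "ext l n" shows "Z n \<subseteq> Z l"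
proof
  fix x assume x: "x \<in> Z n"
  have "ext (x (0, deg G l)) (x (0, deg G n))"
    using cylD[OF x] ext_mor[OF assms] ext_deg_le[OF assms] by (intro path_ext) auto
  then have "x (0, deg G l) = l"
    using assms cylD[OF x] ext_mor[OF assms] by (intro ext_unique[of _ n]) auto
  then show "x \<in> Z l" using cylD[OF x] by (auto simp: cyl_def)
qed

lemma cyl_path: "x \<in> \<Omega> \<Longrightarrow> N \<in> Nk k \<Longrightarrow> x \<in> Z (x (0, N))"
  by (simp add: cyl_def)

section \<open>Splitting cylinders to a common degree\<close>

definition level :: "(nat \<Rightarrow> nat) \<Rightarrow> 'a set" where
  "level N = {n\<in>mor G. deg G n = N}"

lemma finite_level [simp]: "finite (level N)"
  using fin by (simp add: level_def finite_kgraph_def)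

lemma level_iff: "n \<in> level N \<longleftrightarrow> n \<in> mor G \<and> deg G n = N"
  by (simp add: level_def)

lemma countable_mor: "countable (mor G)"
proof -
  have "mor G = (\<Union>N\<in>Nk k. level N)" by (auto simp: level_def)
  then show ?thesis using countable_Nk by (metis countable_UN countable_finite finite_level)
qed

lemma cyl_disjoint: "n \<in> level N \<Longrightarrow> n' \<in> level N \<Longrightarrow> x \<in> Z n \<Longrightarrow> x \<in> Z n' \<Longrightarrow> n = n'"
  by (auto simp: level_def cyl_def)

lemma disjoint_cyl: "M \<subseteq> level N \<Longrightarrow> disjoint_family_on Z M"
  unfolding disjoint_family_on_def using cyl_disjoint by blast

lemma UN_level: "N \<in> Nk k \<Longrightarrow> (\<Union>n\<in>level N. Z n) = \<Omega>"
  by (auto simp: level_def cyl_def)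

definition exts :: "'a \<Rightarrow> (nat \<Rightarrow> nat) \<Rightarrow> 'a set" where
  "exts l N = {n\<in>level N. ext l n}"

lemma finite_exts [simp]: "finite (exts l N)"
  by (simp add: exts_def)

lemma cyl_mem_exts:
  assumes "x \<in> Z l" "l \<in> mor G" "N \<in> Nk k" "deg G l \<le> N"
  shows "x (0, N) \<in> exts l N"
  using assms path_ext[of x "deg G l" N] cylD[OF assms(1)] by (auto simp: exts_def level_def)

lemma cyl_exts:
  assumes "l \<in> mor G" "N \<in> Nk k" "deg G l \<le> N"
  shows "Z l = (\<Union>n\<in>exts l N. Z n)"
proof (intro equalityI subsetI)
  fix x assume x: "x \<in> Z l"
  show "x \<in> (\<Union>n\<in>exts l N. Z n)"
    using cyl_mem_exts[OF x assms] cyl_path[of x N] cylD[OF x] assms by blast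
next
  fix x assume "x \<in> (\<Union>n\<in>exts l N. Z n)"
  then show "x \<in> Z l" using cyl_ext_subset by (auto simp: exts_def)
qed

text \<open>Reindexes the Cuntz-Krieger sum at the vertex \<open>src G l\<close> as a sum over the
  extensions of \<open>l\<close>; injectivity is left cancellation.\<close>

lemma exts_bij:
  assumes l: "l \<in> mor G" and n: "n \<in> Nk k"
  shows "bij_betw (cmp G l) {m\<in>mor G. rng G m = src G l \<and> deg G m = n} (exts l (deg G l + n))"
proof (rule bij_betwI')
  fix m m' assume "m \<in> {m\<in>mor G. rng G m = src G l \<and> deg G m = n}" "m' \<in> {m\<in>mor G. rng G m = src G l \<and> deg G m = n}"
  then have "m \<in> mor G" "src G l = rng G m" "m' \<in> mor G" "src G l = rng G m'" by auto
  then show "(cmp G l m = cmp G l m') = (m = m')" using cmp_cancel(2)[of l m l m'] l by metis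
next
  fix m assume "m \<in> {m\<in>mor G. rng G m = src G l \<and> deg G m = n}"
  then have "m \<in> mor G" "src G l = rng G m" "deg G m = n" by auto
  then show "cmp G l m \<in> exts l (deg G l + n)"
    using l cmp_mor[of l m] deg_cmp[of l m] ext_cmp[of l m] by (simp add: exts_def level_def)
next
  fix p assume "p \<in> exts l (deg G l + n)"
  then obtain b where "b \<in> mor G" "src G l = rng G b" "cmp G l b = p" "deg G p = deg G l + n"
    by (auto simp: exts_def level_def ext_def)
  moreover from this have "deg G b = n" using deg_cmp[of l b] l by (metis multidegree_add_diff(1))
  ultimately show "\<exists>m\<in>{m\<in>mor G. rng G m = src G l \<and> deg G m = n}. p = cmp G l m"
    by (intro bexI[of _ b]) simp_all
qed

text \<open>Cancelling \<open>l\<close> from the initial segment of degree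
  \<open>deg G l + deg G m\<close> decides membership. This is how composition of morphisms enters
  pointwise formulas with the shift.\<close>

lemma cyl_cmp_iff:
  assumes "l \<in> mor G" "m \<in> mor G" "src G l = rng G m" "y \<in> Z l"
  shows "y \<in> Z (cmp G l m) \<longleftrightarrow> shift k (deg G l) y \<in> Z m"
proof -
  have y: "y \<in> \<Omega>" "y (0, deg G l) = l" using assms cylD by auto
  have eq: "y (0, deg G l + deg G m) = cmp G l (shift k (deg G l) y (0, deg G m))"
    "src G l = rng G (shift k (deg G l) y (0, deg G m))"
    using path_via_shift[of y l "deg G m"] y assms by (auto simp: add.commute)
  have sy: "shift k (deg G l) y \<in> \<Omega>" using shift_path y assms by simp
  have "cmp G l (shift k (deg G l) y (0, deg G m)) = cmp G l m \<longleftrightarrow> shift k (deg G l) y (0, deg G m) = m"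
    using cmp_cancel(2)[of l "shift k (deg G l) y (0, deg G m)" l m] eq(2) assms sy by auto
  then show ?thesis using y sy assms eq(1) by (simp add: cyl_def)
qed

text \<open>Cylinders are not closed under intersection; finite unions of cylinders of equal degree are,
because every cylinder splits into cylinders of any larger degree.\<close>

definition clop :: "'a ipath set set" where
  "clop = {\<Union>n\<in>M. Z n | M N. N \<in> Nk k \<and> M \<subseteq> level N}"

lemma clop_refine:
  assumes "N \<in> Nk k" "M \<subseteq> level N" "N' \<in> Nk k" "N \<le> N'"
  shows "\<exists>M'\<subseteq>level N'. (\<Union>n\<in>M. Z n) = (\<Union>n\<in>M'. Z n)"
proof (intro exI conjI)
  show "(\<Union>n\<in>M. exts n N') \<subseteq> level N'" by (auto simp: exts_def)
  have "Z n = (\<Union>p\<in>exts n N'. Z p)" if "n \<in> M" for n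
    using that assms by (intro cyl_exts) (auto simp: level_def)
  then show "(\<Union>n\<in>M. Z n) = (\<Union>n\<in>(\<Union>n\<in>M. exts n N'). Z n)" by (simp add: UN_UN_flatten)
qed

lemma Int_stable_clop: "Int_stable clop"
proof (rule Int_stableI)
  fix A B assume "A \<in> clop" "B \<in> clop"
  then obtain M N M' N' where A: "N \<in> Nk k" "M \<subseteq> level N" "A = (\<Union>n\<in>M. Z n)"
    and B: "N' \<in> Nk k" "M' \<subseteq> level N'" "B = (\<Union>n\<in>M'. Z n)" by (auto simp: clop_def)
  obtain P where P: "P \<subseteq> level (sup N N')" "A = (\<Union>n\<in>P. Z n)"
    using clop_refine[OF A(1,2), of "sup N N'"] A B by auto
  obtain Q where Q: "Q \<subseteq> level (sup N N')" "B = (\<Union>n\<in>Q. Z n)"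
    using clop_refine[OF B(1,2), of "sup N N'"] A B by auto
  have "A \<inter> B = (\<Union>n\<in>P \<inter> Q. Z n)"
  proof (intro equalityI subsetI)
    fix x assume "x \<in> A \<inter> B"
    then obtain p q where pq: "p \<in> P" "x \<in> Z p" "q \<in> Q" "x \<in> Z q" using P Q by auto
    then have "p = q" using cyl_disjoint[of p "sup N N'" q x] P Q by auto
    then show "x \<in> (\<Union>n\<in>P \<inter> Q. Z n)" using pq by auto
  qed (use P Q in auto)
  moreover have "sup N N' \<in> Nk k" "P \<inter> Q \<subseteq> level (sup N N')" using A B P by auto
  ultimately show "A \<inter> B \<in> clop" unfolding clop_def by blast
qed

lemma cyl_clop: "l \<in> mor G \<Longrightarrow> Z l \<in> clop"
  unfolding clop_def by (intro CollectI exI[of _ "{l}"] exI[of _ "deg G l"]) (auto simp: level_def)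

lemma space_clop: "\<Omega> \<in> clop"
  unfolding clop_def using UN_level[of 0] by (intro CollectI exI[of _ "level 0"] exI[of _ 0]) auto

lemma clop_Pow: "clop \<subseteq> Pow \<Omega>"
  by (auto simp: clop_def cyl_def)

section \<open>The Borel sets of the path space\<close>

text \<open>The topology is given by cylinders as a subbasis; they are in fact a basis, since a
  point \<open>x\<close> of two cylinders also lies in the cylinder of its own initial segment of a
  common larger degree.\<close>

lemma openin_cyl_neighbourhood:
  assumes "openin (topology_generated_by (Z ` mor G)) U" "x \<in> U"
  shows "\<exists>l\<in>mor G. x \<in> Z l \<and> Z l \<subseteq> U"
  using assms unfolding openin_topology_generated_by_iff
proof (induction arbitrary: x rule: generate_topology_on.induct)
  case (Int a b)
  then obtain l m where lm: "l \<in> mor G" "x \<in> Z l" "Z l \<subseteq> a" "m \<in> mor G" "x \<in> Z m" "Z m \<subseteq> b"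
    by (metis IntD1 IntD2)
  define N where "N = sup (deg G l) (deg G m)"
  have N: "N \<in> Nk k" "deg G l \<le> N" "deg G m \<le> N" using lm unfolding N_def by (auto intro: Nk_sup)
  have x: "x \<in> \<Omega>" using lm cylD by auto
  have "x (0, N) \<in> exts l N" "x (0, N) \<in> exts m N" using lm N by (auto intro!: cyl_mem_exts)
  then have "Z (x (0, N)) \<subseteq> Z l" "Z (x (0, N)) \<subseteq> Z m" by (auto simp: exts_def dest: cyl_ext_subset)
  then show ?case using lm x N cyl_path[of x N] by (intro bexI[of _ "x (0, N)"]) auto
next
  case (UN K)
  from UN.prems obtain a where a: "a \<in> K" "x \<in> a" by blast
  with UN.IH[OF a] show ?case by blast
qed auto

text \<open>Every open set is the union of the cylinders it contains, and there are only countably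
  many morphisms.\<close>

lemma path_borel_cyl: "path_borel k G = sigma_sets \<Omega> (Z ` mor G)"
proof -
  have "U \<in> sigma_sets \<Omega> (Z ` mor G)"
    if U: "openin (topology_generated_by (Z ` mor G)) U" for U
  proof -
    have "U = (\<Union>l\<in>{l\<in>mor G. Z l \<subseteq> U}. Z l)" using openin_cyl_neighbourhood[OF U] by blast
    moreover have "(\<Union>l\<in>{l\<in>mor G. Z l \<subseteq> U}. Z l) \<in> sigma_sets \<Omega> (Z ` mor G)"
      by (intro sigma_sets_UNION countable_image countable_subset[OF _ countable_mor]) auto
    ultimately show ?thesis by simp
  qed
  moreover have "Z l \<in> {U. U \<subseteq> \<Omega> \<and> openin (topology_generated_by (Z ` mor G)) U}" if "l \<in> mor G" for l
    using that by (auto simp: cyl_def intro!: topology_generated_by_Basis)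
  ultimately show ?thesis unfolding path_borel_def
    by (intro equalityI sigma_sets_mono) (auto intro: sigma_sets.Basic)
qed

lemma path_borel_clop: "path_borel k G = sigma_sets \<Omega> clop"
proof -
  have "A \<in> sigma_sets \<Omega> (Z ` mor G)" if A: "A \<in> clop" for A
  proof -
    obtain M where M: "M \<subseteq> mor G" "A = (\<Union>n\<in>M. Z n)" using A by (auto simp: clop_def level_def)
    show ?thesis unfolding M(2)
      by (intro sigma_sets_UNION countable_image countable_subset[OF M(1) countable_mor])
        (use M in \<open>auto intro: sigma_sets.Basic\<close>)
  qed
  then show ?thesis unfolding path_borel_cyl using cyl_clop
    by (intro equalityI sigma_sets_mono) (auto intro: sigma_sets.Basic)
qed

end

section \<open>Measures on the path space\<close>

locale path_measure = kgr k G for k and G :: "'a kgraph" +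
  fixes \<mu> :: "'a ipath measure"
  assumes borel: "borel_on_paths k G \<mu>"
begin

lemma space_mu [simp]: "space \<mu> = \<Omega>"
  using borel by (simp add: borel_on_paths_def)

lemma sets_mu: "sets \<mu> = sigma_sets \<Omega> (Z ` mor G)" "sets \<mu> = sigma_sets \<Omega> clop"
  using borel path_borel_cyl path_borel_clop by (auto simp: borel_on_paths_def)

lemma cyl_sets [simp, measurable]: "l \<in> mor G \<Longrightarrow> Z l \<in> sets \<mu>"
  by (simp add: sets_mu(1) sigma_sets.Basic)

lemma cyl_sub: "Z l \<subseteq> \<Omega>"
  by (auto simp: cyl_def)

lemma measurable_pathI:
  assumes "\<And>x. x \<in> space M \<Longrightarrow> f x \<in> \<Omega>" "\<And>m. m \<in> mor G \<Longrightarrow> f -` Z m \<inter> space M \<in> sets M"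
  shows "f \<in> measurable M \<mu>"
  by (rule measurable_sigma_sets[OF sets_mu(1)]) (use assms cyl_sub in auto)

text \<open>The preimage of \<open>Z m\<close> is the union of the cylinders of
  \<open>cmp G l m\<close> over all \<open>l\<close> of degree \<open>n\<close> ending at the range
  of \<open>m\<close>, and there are finitely many such \<open>l\<close>.\<close>

lemma shift_measurable [measurable]:
  assumes n: "n \<in> Nk k" shows "shift k n \<in> measurable \<mu> \<mu>"
proof (rule measurable_pathI)
  fix m assume m: "m \<in> mor G"
  have "shift k n -` Z m \<inter> space \<mu> = (\<Union>l\<in>{l\<in>level n. src G l = rng G m}. Z (cmp G l m))"
  proof (intro equalityI subsetI)
    fix x assume "x \<in> shift k n -` Z m \<inter> space \<mu>"
    then have x: "x \<in> \<Omega>" "shift k n x \<in> Z m" by auto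
    define l where "l = x (0, n)"
    have l: "l \<in> mor G" "deg G l = n" "x \<in> Z l" using x n cyl_path[of x n] by (auto simp: l_def)
    have "src G l = rng G (shift k n x (0, deg G m))"
      using path_via_shift(2)[of x l "deg G m"] l x m by (simp add: l_def)
    then have s: "src G l = rng G m" using cylD[OF x(2)] by simp
    then have "x \<in> Z (cmp G l m)" using cyl_cmp_iff[of l m x] l x m by simp
    then show "x \<in> (\<Union>l\<in>{l\<in>level n. src G l = rng G m}. Z (cmp G l m))" using l s by (auto simp: level_def)
  next
    fix x assume "x \<in> (\<Union>l\<in>{l\<in>level n. src G l = rng G m}. Z (cmp G l m))"
    then obtain l where l: "l \<in> mor G" "deg G l = n" "src G l = rng G m" "x \<in> Z (cmp G l m)"
      by (auto simp: level_def)
    then have "x \<in> Z l" using cyl_ext_subset[of l "cmp G l m"] m by auto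
    then show "x \<in> shift k n -` Z m \<inter> space \<mu>" using cyl_cmp_iff[of l m x] l m cylD by auto
  qed
  also have "\<dots> \<in> sets \<mu>" using m by (intro sets.finite_UN) (auto simp: level_def intro: finite_subset[OF _ finite_level[of n]])
  finally show "shift k n -` Z m \<inter> space \<mu> \<in> sets \<mu>" .
qed (use shift_path n in auto)

lemma prefix_measurable:
  assumes l: "l \<in> mor G"
  shows "prefix k G l \<in> measurable (restrict_space \<mu> (Z (src G l))) \<mu>"
proof (rule measurable_pathI)
  have sp: "space (restrict_space \<mu> (Z (src G l))) = Z (src G l)"
    using cyl_sub[of "src G l"] by (auto simp: space_restrict_space)
  show "prefix k G l x \<in> \<Omega>" if "x \<in> space (restrict_space \<mu> (Z (src G l)))" for x
    using that l prefix_cyl[of l x] cylD by (auto simp: sp)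
  fix m assume m: "m \<in> mor G"
  define N where "N = sup (deg G l) (deg G m)"
  have N: "N \<in> Nk k" "deg G l \<le> N" "deg G m \<le> N" using l m unfolding N_def by (auto intro: Nk_sup)
  \<comment> \<open>Whether the prefixed path lies in \<open>Z m\<close> depends only on its segment
    of degree \<open>N\<close>, which is \<open>cmp G l p\<close> for the initial segment
    \<open>p\<close> of \<open>x\<close> of degree \<open>N - deg G l\<close>.\<close>
  define P where "P = {p\<in>level (N - deg G l). src G l = rng G p \<and> ext m (cmp G l p)}"
  have dP: "deg G (cmp G l p) = N" if "p \<in> P" for p
    using that l multidegree_diff_add[OF N(2)] by (auto simp: P_def level_def)
  have "prefix k G l -` Z m \<inter> Z (src G l) = (\<Union>p\<in>P. Z p)"
  proof (intro equalityI subsetI)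
    fix x assume x: "x \<in> prefix k G l -` Z m \<inter> Z (src G l)"
    let ?y = "prefix k G l x"
    have y: "?y \<in> Z l" "?y \<in> Z m" "shift k (deg G l) ?y = x" "?y \<in> \<Omega>"
      using x prefix_cyl[of l x] shift_prefix[of l x] l cylD by auto
    have "?y (0, N) \<in> exts l N" "?y (0, N) \<in> exts m N" using y l m N by (auto intro!: cyl_mem_exts)
    then obtain p where p: "p \<in> mor G" "src G l = rng G p" "cmp G l p = ?y (0, N)"
      and e: "ext m (?y (0, N))" by (auto simp: exts_def ext_def)
    have "deg G l + deg G p = N" using deg_cmp[OF l p(1,2)] p(3) y N by simp
    then have "deg G p = N - deg G l" by auto
    then have "p \<in> P" using p e by (auto simp: P_def level_def)
    moreover have "?y \<in> Z (cmp G l p)" using p(3) cyl_path[of ?y N] y N by simp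
    then have "x \<in> Z p" using cyl_cmp_iff[of l p ?y] y p l by simp
    ultimately show "x \<in> (\<Union>p\<in>P. Z p)" by auto
  next
    fix x assume "x \<in> (\<Union>p\<in>P. Z p)"
    then obtain p where p: "p \<in> P" "x \<in> Z p" by auto
    then have pm: "p \<in> mor G" "src G l = rng G p" "ext m (cmp G l p)" by (auto simp: P_def level_def)
    have xs: "x \<in> Z (src G l)"
      using p(2) cyl_ext_subset[of "src G l" p] pm l ext_cmp[of "rng G p" p] by auto
    then have "prefix k G l x \<in> Z (cmp G l p)"
      using cyl_cmp_iff[of l p "prefix k G l x"] prefix_cyl[OF l xs] shift_prefix[OF l xs] p pm l by simp
    then show "x \<in> prefix k G l -` Z m \<inter> Z (src G l)" using xs cyl_ext_subset[OF pm(3)] by auto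
  qed
  moreover have "(\<Union>p\<in>P. Z p) \<in> sets \<mu>"
    by (intro sets.finite_UN) (auto simp: P_def level_def intro: finite_subset[OF _ finite_level[of "N - deg G l"]])
  ultimately show "prefix k G l -` Z m \<inter> space (restrict_space \<mu> (Z (src G l))) \<in> sets (restrict_space \<mu> (Z (src G l)))"
    using l cyl_sub[of "src G l"] by (subst sets_restrict_space_iff) (auto simp: sp Int_absorb2)
qed

lemma prefix_image_sets:
  assumes "l \<in> mor G" "A \<in> sets \<mu>" "A \<subseteq> Z (src G l)"
  shows "prefix k G l ` A \<in> sets \<mu>"
proof -
  have "shift k (deg G l) -` A \<inter> space \<mu> \<in> sets \<mu>"
    using assms by (intro measurable_sets[OF shift_measurable]) auto
  then have "Z l \<inter> (shift k (deg G l) -` A \<inter> space \<mu>) \<in> sets \<mu>" using assms by auto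
  moreover have "prefix k G l ` A = Z l \<inter> (shift k (deg G l) -` A \<inter> space \<mu>)"
    using prefix_image[OF assms(1,3)] cyl_sub[of l] by auto
  ultimately show ?thesis by simp
qed

lemma emeasure_UN_cyl:
  assumes "sets \<nu> = sets \<mu>" "M \<subseteq> level N"
  shows "emeasure \<nu> (\<Union>n\<in>M. Z n) = (\<Sum>n\<in>M. emeasure \<nu> (Z n))"
proof -
  have "finite M" using finite_subset[OF assms(2)] by simp
  then show ?thesis using assms disjoint_cyl[OF assms(2)]
    by (intro sum_emeasure[symmetric]) (auto simp: level_def)
qed

text \<open>Additivity carries agreement from cylinders to \<open>clop\<close>, which is stable
  under intersection. The whole space is a member of finite measure, being a finite union of vertex
  cylinders, so one set exhausts it.\<close>

lemma measure_eqI_cyl: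
  assumes s: "sets \<nu> = sets \<mu>" "sets \<nu>' = sets \<mu>"
    and eq: "\<And>l. l \<in> mor G \<Longrightarrow> emeasure \<nu> (Z l) = emeasure \<nu>' (Z l)"
    and fin: "\<And>l. l \<in> mor G \<Longrightarrow> emeasure \<nu> (Z l) \<noteq> \<infinity>"
  shows "\<nu> = \<nu>'"
proof (rule measure_eqI_generator_eq[OF Int_stable_clop clop_Pow, where A = "\<lambda>_. \<Omega>"])
  fix X assume "X \<in> clop"
  then obtain M N where M: "M \<subseteq> level N" "X = (\<Union>n\<in>M. Z n)" by (auto simp: clop_def)
  show "emeasure \<nu> X = emeasure \<nu>' X"
    unfolding M(2) emeasure_UN_cyl[OF s(1) M(1)] emeasure_UN_cyl[OF s(2) M(1)]
    using M eq by (intro sum.cong) (auto simp: level_def)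
next
  have "emeasure \<nu> \<Omega> = (\<Sum>n\<in>level 0. emeasure \<nu> (Z n))"
    using emeasure_UN_cyl[OF s(1), of "level 0" 0] UN_level[of 0] by simp
  moreover have "(\<Sum>n\<in>level 0. emeasure \<nu> (Z n)) < \<infinity>"
    using fin by (simp add: level_iff less_top)
  ultimately show "emeasure \<nu> \<Omega> \<noteq> \<infinity>" by (simp add: less_top)
qed (use s sets_mu space_clop in auto)

lemma finite_measureI_cyl:
  assumes "\<And>v. v \<in> vertices G \<Longrightarrow> emeasure \<mu> (Z v) \<noteq> \<infinity>"
  shows "finite_measure \<mu>"
proof
  have "emeasure \<mu> \<Omega> = (\<Sum>n\<in>level 0. emeasure \<mu> (Z n))"
    using emeasure_UN_cyl[of \<mu> "level 0" 0] UN_level[of 0] by simp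
  moreover have "(\<Sum>n\<in>level 0. emeasure \<mu> (Z n)) < \<infinity>"
    using assms by (simp add: level_iff vertices_def less_top)
  ultimately show "emeasure \<mu> (space \<mu>) \<noteq> \<infinity>" by (simp add: less_top)
qed

lemma indicator_UN_cyl:
  assumes "M \<subseteq> level N"
  shows "(indicator (\<Union>n\<in>M. Z n) :: _ \<Rightarrow> complex) = (\<Sum>n\<in>M. indicator (Z n))"
proof
  fix x
  have "(indicator (\<Union>n\<in>M. Z n) x :: complex) = (\<Sum>n\<in>M. indicator (Z n) x)"
    using finite_subset[OF assms] disjoint_cyl[OF assms] by (intro indicator_UN_disjoint) auto
  then show "(indicator (\<Union>n\<in>M. Z n) x :: complex) = (\<Sum>n\<in>M. indicator (Z n)) x"
    by (simp add: sum_fun_apply)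
qed

lemma L2_dense_cyl:
  assumes "finite_measure \<mu>" "S \<subseteq> hcar (L2 \<mu>)"
    and "\<And>l. l \<in> mor G \<Longrightarrow> indicator (Z l) \<in> hilb.hclos (L2 \<mu>) S"
  shows "dense_span (L2 \<mu>) S"
proof -
  interpret finite_measure \<mu> by fact
  interpret L: hilb "L2 \<mu>" by (rule hilb_L2)
  have "hcar (L2 \<mu>) \<subseteq> L.hclos S"
  proof (rule L2_dense_indicators[OF Int_stable_clop])
    fix A assume "A \<in> clop"
    then obtain M N where M: "M \<subseteq> level N" "A = (\<Union>n\<in>M. Z n)" by (auto simp: clop_def)
    show "indicator A \<in> L.hclos S"
      unfolding M(2) indicator_UN_cyl[OF M(1)]
      using M(1) by (intro L.hclos_sum assms) (auto simp: level_def)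
  qed (use clop_Pow sets_mu space_clop assms in auto)
  then show ?thesis using L.dense_span_iff_hclos[OF assms(2)] by simp
qed

end

section \<open>Representations of projective systems are monic\<close>

lemma proj_rep_monic:
  assumes "kgr k G" and borel: "borel_on_paths k G \<mu>" and ps: "proj_system k G \<mu> f"
    and CK: "CK_rep k G (L2 \<mu>) (proj_rep k G f) Ss"
  shows "monic_with G (L2 \<mu>) (proj_rep k G f) Ss (\<lambda>_. 1)"
proof -
  interpret kgr k G by fact
  interpret path_measure k G \<mu> by unfold_locales fact
  have sb: "std_sbfs k G \<mu>" using ps by (simp add: proj_system_def)
  have fm [measurable]: "f l \<in> borel_measurable \<mu>"
    and fint: "integrable \<mu> (\<lambda>x. (cmod (f l x))\<^sup>2)"
    and fpush: "\<And>A. A \<in> sets \<mu> \<Longrightarrow> emeasure \<mu> {x\<in>Z (src G l). prefix k G l x \<in> A}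
                        = (\<integral>\<^sup>+x\<in>A. ennreal ((cmod (f l x))\<^sup>2) \<partial>\<mu>)"
    and fne: "AE x in \<mu>. x \<in> Z l \<longrightarrow> f l x \<noteq> 0" if "l \<in> mor G" for l
    using ps that by (auto simp: proj_system_def)
  \<comment> \<open>The push-forward condition at the whole space gives each
    \<open>Z (src G l)\<close> the finite mass of the squared modulus of \<open>f l\<close>. Taking
    vertices for \<open>l\<close> makes \<open>\<mu>\<close> finite, so constants lie in
    \<open>L2 \<mu>\<close>.\<close>
  have total: "emeasure \<mu> (Z (src G l)) = ennreal (\<integral>x. (cmod (f l x))\<^sup>2 \<partial>\<mu>)" if l: "l \<in> mor G" for l
  proof -
    have "{x\<in>Z (src G l). prefix k G l x \<in> \<Omega>} = Z (src G l)"
      using prefix_cyl[OF l] cylD by auto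
    then have "emeasure \<mu> (Z (src G l)) = (\<integral>\<^sup>+x\<in>\<Omega>. ennreal ((cmod (f l x))\<^sup>2) \<partial>\<mu>)"
      using fpush[OF l, of \<Omega>] sets.top[of \<mu>] by simp
    also have "\<dots> = (\<integral>\<^sup>+x. ennreal ((cmod (f l x))\<^sup>2) \<partial>\<mu>)"
      by (intro nn_integral_cong) simp
    finally show ?thesis using fint[OF l] by (simp add: nn_integral_eq_integral)
  qed
  have "finite_measure \<mu>"
    using total vertexD by (intro finite_measureI_cyl) (metis ennreal_neq_top infinity_ennreal_def)
  then interpret finite_measure \<mu> .
  have one: "(\<lambda>_. 1) \<in> hcar (L2 \<mu>)" by (simp add: L2_car)
  \<comment> \<open>Prefixing by \<open>l\<close> never leaves \<open>Z l\<close>, so the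
    push-forward has no mass outside it.\<close>
  have supp: "AE x in \<mu>. x \<notin> Z l \<longrightarrow> f l x = 0" if l: "l \<in> mor G" for l
  proof -
    have A: "\<Omega> - Z l \<in> sets \<mu>" using l sets.compl_sets[of "Z l" \<mu>] by simp
    have "{x\<in>Z (src G l). prefix k G l x \<in> \<Omega> - Z l} = {}" using prefix_cyl[OF l] by auto
    then have "(\<integral>\<^sup>+x. ennreal ((cmod (f l x))\<^sup>2) * indicator (\<Omega> - Z l) x \<partial>\<mu>) = 0"
      using fpush[OF l A] by (simp only: emeasure_empty)
    then have "AE x in \<mu>. ennreal ((cmod (f l x))\<^sup>2) * indicator (\<Omega> - Z l) x = 0"
      using A fm[OF l] by (subst (asm) nn_integral_0_iff_AE) auto
    then show ?thesis
      by (rule AE_mp) (auto intro!: AE_I2 simp: indicator_def split: if_splits)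
  qed
  \<comment> \<open>Multiplicativity for \<open>cmp G v v = v\<close>, with the shift by 0 being the
    identity, makes \<open>f v\<close> idempotent pointwise; being nonzero on \<open>Z v\<close>, it
    is 1 there.\<close>
  have fv: "AE x in \<mu>. f v x = indicator (Z v) x" if v: "v \<in> vertices G" for v
  proof -
    note vD = vertexD[OF v]
    have "\<forall>l\<in>mor G. \<forall>m\<in>mor G. src G l = rng G m \<longrightarrow>
        (AE x in \<mu>. f l x * f m (shift k (deg G l) x) = f (cmp G l m) x)"
      using ps unfolding proj_system_def by (elim conjE)
    moreover have "src G v = rng G v" using vD by simp
    ultimately have "AE x in \<mu>. f v x * f v (shift k (deg G v) x) = f (cmp G v v) x"
      using vD(1) by blast
    moreover have "cmp G v v = v" using cmp_rng[OF vD(1)] vD by simp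
    ultimately have "AE x in \<mu>. f v x * f v (shift k 0 x) = f v x" using vD by simp
    then show ?thesis using fne[OF vD(1)] supp[OF vD(1)] AE_space[of \<mu>]
    proof eventually_elim
      case (elim x)
      then have "f v x * f v x = f v x" by (simp add: shift_zero)
      then show ?case using elim by (cases "x \<in> Z v") auto
    qed
  qed
  let ?t = "proj_rep k G f"
  have adj: "is_adjoint (L2 \<mu>) (?t l) (Ss l)" if "l \<in> mor G" for l
    using CK that by (simp add: CK_rep_def)
  have tc: "?t l g \<in> hcar (L2 \<mu>)" and Sc: "Ss l g \<in> hcar (L2 \<mu>)"
    if "l \<in> mor G" "g \<in> hcar (L2 \<mu>)" for l g
    using adj[OF that(1)] that(2) by (auto simp: is_adjoint_def is_op_def)
  interpret L: hilb "L2 \<mu>" by (rule hilb_L2)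
  have main: "AE x in \<mu>. ?t l (Ss l (\<lambda>_. 1)) x = indicator (Z l) x" if l: "l \<in> mor G" for l
  proof -
    define D where "D = {l'\<in>mor G. rng G l' = rng G l \<and> deg G l' = deg G l}"
    have D: "finite D" "l \<in> D" "D \<subseteq> mor G" "D \<subseteq> level (deg G l)"
      using l finite_level[of "deg G l"] by (auto simp: D_def level_def intro: rev_finite_subset)
    let ?s = "\<Sum>l'\<in>D. ?t l' (Ss l' (\<lambda>_. 1))"
    have "op_eq (L2 \<mu>) (?t (rng G l)) (\<lambda>x. \<Sum>l'\<in>D. ?t l' (Ss l' x))"
      using CK l by (simp add: CK_rep_def D_def)
    then have "hnull (L2 \<mu>) (?t (rng G l) (\<lambda>_. 1) - ?s)" using one by (simp add: op_eq_def)
    moreover have "?t (rng G l) (\<lambda>_. 1) - ?s \<in> hcar (L2 \<mu>)"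
      using D one l tc Sc by (intro L.diff_closed L.sum_closed) auto
    ultimately have eq: "AE x in \<mu>. (?t (rng G l) (\<lambda>_. 1) - ?s) x = 0" by (simp only: L2_hnull_iff)
    have "AE x in \<mu>. \<forall>l'\<in>D. x \<notin> Z l' \<longrightarrow> f l' x = 0"
      using D supp by (intro AE_finite_allI) auto
    with eq fv[OF rng_vertex[OF l]] show ?thesis
    proof eventually_elim
      case (elim x)
      have "?s x = (\<Sum>l'\<in>D. ?t l' (Ss l' (\<lambda>_. 1)) x)" by (simp add: sum_fun_apply)
      then have sum: "indicator (Z (rng G l)) x = (\<Sum>l'\<in>D. ?t l' (Ss l' (\<lambda>_. 1)) x)"
        using elim by (simp add: proj_rep_def)
      show ?case
      proof (cases "x \<in> Z l")
        case True
        have "x \<notin> Z l'" if "l' \<in> D" "l' \<noteq> l" for l'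
          using cyl_disjoint[of l' "deg G l" l x] D that True by auto
        then have "(\<Sum>l'\<in>D. ?t l' (Ss l' (\<lambda>_. 1)) x) = (\<Sum>l'\<in>{l}. ?t l' (Ss l' (\<lambda>_. 1)) x)"
          using D elim by (intro sum.mono_neutral_right) (auto simp: proj_rep_def)
        moreover have "x \<in> Z (rng G l)"
          using cyl_ext_subset[of "rng G l" l] ext_cmp[of "rng G l" l] l True by auto
        ultimately show ?thesis using sum True by simp
      next
        case False
        then show ?thesis using elim D by (simp add: proj_rep_def)
      qed
    qed
  qed
  let ?S = "{?t l (Ss l (\<lambda>_. 1)) | l. l \<in> mor G}"
  have S: "?S \<subseteq> hcar (L2 \<mu>)" using tc Sc one by auto
  have "dense_span (L2 \<mu>) ?S"
  proof (rule L2_dense_cyl[OF \<open>finite_measure \<mu>\<close> S])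
    fix l assume l: "l \<in> mor G"
    show "indicator (Z l) \<in> L.hclos ?S"
    proof (rule L.hclos_null[OF S])
      show "indicator (Z l) \<in> hcar (L2 \<mu>)" using l by (simp add: L2_indicator)
      show "?t l (Ss l (\<lambda>_. 1)) \<in> L.hclos ?S" using l by (intro L.hclos_superset[OF S]) auto
      show "hnull (L2 \<mu>) (indicator (Z l) - ?t l (Ss l (\<lambda>_. 1)))"
        by (rule L2_hnullI, use main[OF l] in eventually_elim) simp
    qed
  qed
  \<comment> \<open>The squared norm of \<open>?t l\<close> applied to 1 is the mass of
    \<open>Z (src G l)\<close>, positive by the semibranching conditions.\<close>
  moreover have "\<not> hnull (L2 \<mu>) (?t l (\<lambda>_. 1))" if l: "l \<in> mor G" for l
  proof
    assume "hnull (L2 \<mu>) (?t l (\<lambda>_. 1))"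
    then have "(\<integral>x. (cmod (f l x))\<^sup>2 \<partial>\<mu>) = 0" by (simp add: hnull_def L2_hip_self proj_rep_def)
    moreover have "emeasure \<mu> (Z (src G l)) > 0" using sb l by (simp add: std_sbfs_def)
    ultimately show False using total[OF l] by simp
  qed
  ultimately show ?thesis using one by (auto simp: monic_with_def)
qed

section \<open>Monic representations\<close>

lemma L2_hnull_diff_iff:
  assumes "g \<in> hcar (L2 M)" "h \<in> hcar (L2 M)"
  shows "hnull (L2 M) (g - h) \<longleftrightarrow> (AE x in M. g x = h x)"
proof -
  interpret hilb "L2 M" by (rule hilb_L2)
  show ?thesis using assms by (simp add: L2_hnull_iff)
qed

lemma L2_blin_mult_indicator:
  assumes A: "A \<in> sets M"
  shows "blin (L2 M) (L2 M) (\<lambda>g x. indicator A x * g x)"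
proof -
  have le: "(cmod (indicator A x * z))\<^sup>2 \<le> (cmod z)\<^sup>2" for x and z :: complex by (simp add: indicator_def)
  have c: "(\<lambda>x. indicator A x * g x) \<in> hcar (L2 M)" if g: "g \<in> hcar (L2 M)" for g
    unfolding L2_car
  proof
    note [measurable] = A L2_measurable[OF g]
    show m: "(\<lambda>x. indicator A x * g x) \<in> borel_measurable M" by measurable
    show "integrable M (\<lambda>x. (cmod (indicator A x * g x))\<^sup>2)"
    proof (rule Bochner_Integration.integrable_bound)
      show "integrable M (\<lambda>x. (cmod (g x))\<^sup>2)" using g by (simp add: L2_car)
      show "AE x in M. norm ((cmod (indicator A x * g x))\<^sup>2) \<le> norm ((cmod (g x))\<^sup>2)"
        by (intro AE_I2) (simp only: real_norm_def abs_power2 le)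
    qed measurable
  qed
  have "hnorm (L2 M) (\<lambda>x. indicator A x * g x) \<le> 1 * hnorm (L2 M) g" if g: "g \<in> hcar (L2 M)" for g
  proof -
    have "(\<integral>x. (cmod (indicator A x * g x))\<^sup>2 \<partial>M) \<le> (\<integral>x. (cmod (g x))\<^sup>2 \<partial>M)"
      by (rule integral_mono) (use g c[OF g] in \<open>simp_all only: L2_car le\<close>)
    then show ?thesis by (simp add: L2_hnorm)
  qed
  then show ?thesis
    unfolding blin_def using c
    by (auto intro!: L2_hnullI exI[of _ 1] simp: L2_hsc algebra_simps)
qed

locale monic_rep = path_measure k G \<mu> + H: hilb H
  for k and G :: "'a kgraph" and \<mu> and H :: "('h::ab_group_add) hspace" +
  fixes t ts \<xi>
  assumes definite: "hdefinite H" and CK: "CK_rep k G H t ts" and monic: "monic_with G H t ts \<xi>"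
    and mu: "\<And>l. l \<in> mor G \<Longrightarrow> emeasure \<mu> (Z l) = ennreal (Re (hip H \<xi> (t l (ts l \<xi>))))"
begin

lemma null_eq: "x \<in> hcar H \<Longrightarrow> y \<in> hcar H \<Longrightarrow> hnull H (x - y) \<Longrightarrow> x = y"
  using definite H.diff_closed[of x y] unfolding hdefinite_def hnull_def by auto

lemma hip_ext:
  assumes "u \<in> hcar H" "w \<in> hcar H" "\<And>z. z \<in> hcar H \<Longrightarrow> hip H z u = hip H z w"
  shows "u = w"
  using assms by (intro null_eq) (auto simp: hnull_def H.hip_linear)

lemma adjoint: "l \<in> mor G \<Longrightarrow> is_adjoint H (t l) (ts l)"
  using CK unfolding CK_rep_def by (elim conjE) blast

lemma t_blin: "l \<in> mor G \<Longrightarrow> blin H H (t l)" and ts_blin: "l \<in> mor G \<Longrightarrow> blin H H (ts l)"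
  using adjoint unfolding is_adjoint_def is_op_iff_blin by blast+

lemma t_closed [simp]: "l \<in> mor G \<Longrightarrow> x \<in> hcar H \<Longrightarrow> t l x \<in> hcar H"
  and ts_closed [simp]: "l \<in> mor G \<Longrightarrow> x \<in> hcar H \<Longrightarrow> ts l x \<in> hcar H"
  using blin_closed t_blin ts_blin by blast+

lemma t_add: "l \<in> mor G \<Longrightarrow> x \<in> hcar H \<Longrightarrow> y \<in> hcar H \<Longrightarrow> t l (x + y) = t l x + t l y"
  by (intro null_eq blin_add[OF t_blin]) auto

lemma ts_add: "l \<in> mor G \<Longrightarrow> x \<in> hcar H \<Longrightarrow> y \<in> hcar H \<Longrightarrow> ts l (x + y) = ts l x + ts l y"
  by (intro null_eq blin_add[OF ts_blin]) auto

lemma t_zero [simp]: "l \<in> mor G \<Longrightarrow> t l 0 = 0"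
  using t_add[of l 0 0] by simp

lemma ts_zero [simp]: "l \<in> mor G \<Longrightarrow> ts l 0 = 0"
  using ts_add[of l 0 0] by simp

lemma t_sum: "l \<in> mor G \<Longrightarrow> (\<And>i. i \<in> F \<Longrightarrow> g i \<in> hcar H) \<Longrightarrow> t l (sum g F) = (\<Sum>i\<in>F. t l (g i))"
  by (induction F rule: infinite_finite_induct) (auto simp: t_add)

lemma ts_sum: "l \<in> mor G \<Longrightarrow> (\<And>i. i \<in> F \<Longrightarrow> g i \<in> hcar H) \<Longrightarrow> ts l (sum g F) = (\<Sum>i\<in>F. ts l (g i))"
  by (induction F rule: infinite_finite_induct) (auto simp: ts_add)

lemma hip_t_left: "l \<in> mor G \<Longrightarrow> x \<in> hcar H \<Longrightarrow> y \<in> hcar H \<Longrightarrow> hip H (t l x) y = hip H x (ts l y)"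
  using adjoint unfolding is_adjoint_def by blast

lemma hip_t_right: "l \<in> mor G \<Longrightarrow> x \<in> hcar H \<Longrightarrow> y \<in> hcar H \<Longrightarrow> hip H x (t l y) = hip H (ts l x) y"
  using H.hip_cnj[of "t l y" x] H.hip_cnj[of y "ts l x"] hip_t_left[of l y x] by simp

lemma op_eqD: "op_eq H A B \<Longrightarrow> x \<in> hcar H \<Longrightarrow> A x \<in> hcar H \<Longrightarrow> B x \<in> hcar H \<Longrightarrow> A x = B x"
  by (auto simp: op_eq_def intro: null_eq)

lemma t_t:
  assumes "l \<in> mor G" "m \<in> mor G" "src G l = rng G m" "x \<in> hcar H"
  shows "t l (t m x) = t (cmp G l m) x"
proof -
  have "op_eq H (t l \<circ> t m) (t (cmp G l m))"
    using CK assms unfolding CK_rep_def by (elim conjE) blast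
  from op_eqD[OF this assms(4)] show ?thesis using assms by simp
qed

lemma ts_ts:
  assumes "l \<in> mor G" "m \<in> mor G" "src G l = rng G m" "x \<in> hcar H"
  shows "ts m (ts l x) = ts (cmp G l m) x"
proof (rule hip_ext)
  fix z assume z: "z \<in> hcar H"
  have "hip H z (ts m (ts l x)) = hip H (t l (t m z)) x" using assms z by (simp add: hip_t_left)
  also have "\<dots> = hip H z (ts (cmp G l m) x)"
    using assms z t_t[of l m z] cmp_mor[of l m] by (simp add: hip_t_left)
  finally show "hip H z (ts m (ts l x)) = hip H z (ts (cmp G l m) x)" .
qed (use assms in auto)

lemma ts_t:
  assumes "l \<in> mor G" "x \<in> hcar H"
  shows "ts l (t l x) = t (src G l) x"
proof -
  have "op_eq H (ts l \<circ> t l) (t (src G l))"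
    using CK assms unfolding CK_rep_def by (elim conjE) blast
  from op_eqD[OF this assms(2)] show ?thesis using assms by simp
qed

lemma ts_vertex:
  assumes "v \<in> vertices G" "x \<in> hcar H"
  shows "ts v x = t v x"
proof -
  have "op_eq H (ts v) (t v)"
    using CK assms unfolding CK_rep_def by (elim conjE) blast
  from op_eqD[OF this assms(2)] show ?thesis using assms vertexD by simp
qed

lemma t_vertices:
  assumes "v \<in> vertices G" "w \<in> vertices G" "x \<in> hcar H"
  shows "t v (t w x) = (if v = w then t v x else 0)"
proof -
  have "op_eq H (t v \<circ> t w) (if v = w then t v else (\<lambda>_. 0))"
    using CK assms unfolding CK_rep_def by (elim conjE) blast
  from op_eqD[OF this assms(3)] show ?thesis using assms vertexD by (simp split: if_splits)
qed

section \<open>Range projections\<close>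

definition P where "P l x = t l (ts l x)"

lemma P_closed [simp]: "l \<in> mor G \<Longrightarrow> x \<in> hcar H \<Longrightarrow> P l x \<in> hcar H"
  by (simp add: P_def)

lemma P_sum: "l \<in> mor G \<Longrightarrow> (\<And>i. i \<in> F \<Longrightarrow> g i \<in> hcar H) \<Longrightarrow> P l (sum g F) = (\<Sum>i\<in>F. P l (g i))"
  by (simp add: P_def t_sum ts_sum)

lemma P_blin: "l \<in> mor G \<Longrightarrow> blin H H (P l)"
  unfolding P_def[abs_def]
  by (rule blin_comp[OF H.hilb_axioms H.hilb_axioms H.hilb_axioms ts_blin t_blin])

lemma t_decompose:
  assumes "v \<in> vertices G" "n \<in> Nk k" "x \<in> hcar H"
  shows "t v x = (\<Sum>l\<in>{l\<in>mor G. rng G l = v \<and> deg G l = n}. P l x)"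
proof -
  have "op_eq H (t v) (\<lambda>x. \<Sum>l\<in>{l\<in>mor G. rng G l = v \<and> deg G l = n}. t l (ts l x))"
    using CK assms unfolding CK_rep_def by (elim conjE) blast
  moreover have "(\<Sum>l\<in>{l\<in>mor G. rng G l = v \<and> deg G l = n}. t l (ts l x)) \<in> hcar H"
    using assms by (intro H.sum_closed) auto
  moreover have "t v x \<in> hcar H" using assms vertexD by simp
  ultimately show ?thesis
    unfolding P_def using op_eqD[of "t v" "\<lambda>x. \<Sum>l\<in>{l\<in>mor G. rng G l = v \<and> deg G l = n}. t l (ts l x)" x] assms
    by blast
qed

lemma t_rng [simp]: "l \<in> mor G \<Longrightarrow> x \<in> hcar H \<Longrightarrow> t (rng G l) (t l x) = t l x"
  using t_t[of "rng G l" l x] by simp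

lemma t_src [simp]: "l \<in> mor G \<Longrightarrow> x \<in> hcar H \<Longrightarrow> t l (t (src G l) x) = t l x"
  using t_t[of l "src G l" x] by simp

lemma ts_rng [simp]: "l \<in> mor G \<Longrightarrow> x \<in> hcar H \<Longrightarrow> ts l (t (rng G l) x) = ts l x"
  using ts_ts[of "rng G l" l x] ts_vertex[of "rng G l" x] by simp

lemma P_t: "l \<in> mor G \<Longrightarrow> x \<in> hcar H \<Longrightarrow> P l (t l x) = t l x"
  by (simp add: P_def ts_t)

lemma P_idem [simp]: "l \<in> mor G \<Longrightarrow> x \<in> hcar H \<Longrightarrow> P l (P l x) = P l x"
  using P_t[of l "ts l x"] by (simp add: P_def)

lemma P_vertex: "v \<in> vertices G \<Longrightarrow> x \<in> hcar H \<Longrightarrow> P v x = t v x"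
  using vertexD[of v] by (simp add: P_def ts_vertex t_vertices)

lemma P_hip: "l \<in> mor G \<Longrightarrow> x \<in> hcar H \<Longrightarrow> y \<in> hcar H \<Longrightarrow> hip H (P l x) y = hip H x (P l y)"
  by (simp add: P_def hip_t_left hip_t_right)

lemma P_hip_self: "l \<in> mor G \<Longrightarrow> x \<in> hcar H \<Longrightarrow> hip H x (P l x) = of_real ((hnorm H (P l x))\<^sup>2)"
  using P_hip[of l x "P l x"] H.hip_self[of "P l x"] by simp

lemma P_cmp:
  assumes "l \<in> mor G" "m \<in> mor G" "src G l = rng G m" "x \<in> hcar H"
  shows "P (cmp G l m) x = t l (P m (ts l x))"
  using assms t_t[of l m "ts m (ts l x)"] ts_ts[of l m x] by (simp add: P_def)

text \<open>The vertex projection at \<open>src G l\<close> can be inserted between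
  \<open>t l\<close> and \<open>ts l\<close>; its Cuntz-Krieger decomposition then splits
  \<open>P l\<close>, in parallel with \<open>cyl_exts\<close>.\<close>

lemma P_exts:
  assumes l: "l \<in> mor G" and N: "N \<in> Nk k" "deg G l \<le> N" and x: "x \<in> hcar H"
  shows "P l x = (\<Sum>n\<in>exts l N. P n x)"
proof -
  let ?D = "{m\<in>mor G. rng G m = src G l \<and> deg G m = N - deg G l}"
  have "P l x = t l (t (src G l) (ts l x))" using l x by (simp add: P_def)
  also have "t (src G l) (ts l x) = (\<Sum>m\<in>?D. P m (ts l x))"
    using l N x by (intro t_decompose) auto
  also have "t l \<dots> = (\<Sum>m\<in>?D. t l (P m (ts l x)))" using l x by (intro t_sum) auto
  also have "\<dots> = (\<Sum>m\<in>?D. P (cmp G l m) x)" using l x by (intro sum.cong) (auto simp: P_cmp)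
  also have "\<dots> = (\<Sum>n\<in>exts l (deg G l + (N - deg G l)). P n x)"
    using l N by (intro sum.reindex_bij_betw exts_bij) auto
  finally show ?thesis using multidegree_diff_add[OF N(2)] by simp
qed

text \<open>For different ranges the vertex projections are orthogonal. For equal ranges, a vector
  \<open>y\<close> fixed by \<open>P m\<close> has squared norm equal to the sum of the squared
  norms of all \<open>P l' y\<close>; the term \<open>l' = m\<close> exhausts it, so the others
  vanish.\<close>

lemma P_orthogonal:
  assumes l: "l \<in> level N" and m: "m \<in> level N" and ne: "l \<noteq> m" and x: "x \<in> hcar H"
  shows "P l (P m x) = 0"
proof -
  have lm: "l \<in> mor G" "m \<in> mor G" "deg G l = deg G m" using l m by (auto simp: level_iff)
  define y where "y = P m x"
  have y: "y \<in> hcar H" "t (rng G m) y = y" "P m y = y" using lm x by (auto simp: y_def) (simp add: P_def)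
  show ?thesis
  proof (cases "rng G l = rng G m")
    case False
    have "ts l y = ts l (t (rng G l) (t (rng G m) y))" using lm y by simp
    also have "\<dots> = 0" using lm y False t_vertices[of "rng G l" "rng G m" y] by simp
    finally show ?thesis using lm by (simp add: y_def[symmetric] P_def[of l])
  next
    case True
    let ?D = "{l'\<in>mor G. rng G l' = rng G m \<and> deg G l' = deg G m}"
    have fin: "finite ?D" by (rule finite_subset[OF _ finite_level[of "deg G m"]]) (auto simp: level_iff)
    have "hip H y y = hip H y (\<Sum>l'\<in>?D. P l' y)"
      using t_decompose[of "rng G m" "deg G m" y] lm y by simp
    also have "\<dots> = (\<Sum>l'\<in>?D. hip H y (P l' y))" using y by (intro H.hip_sum_right) auto
    also have "\<dots> = (\<Sum>l'\<in>?D. of_real ((hnorm H (P l' y))\<^sup>2))"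
      using y by (intro sum.cong) (auto simp: P_hip_self)
    finally have "hip H y y = of_real (\<Sum>l'\<in>?D. (hnorm H (P l' y))\<^sup>2)" by simp
    then have "(hnorm H y)\<^sup>2 = (\<Sum>l'\<in>?D. (hnorm H (P l' y))\<^sup>2)"
      using H.hnorm_sq[of y] y by (simp only: Re_complex_of_real)
    also have "\<dots> = (hnorm H (P m y))\<^sup>2 + (\<Sum>l'\<in>?D - {m}. (hnorm H (P l' y))\<^sup>2)"
      using fin lm by (intro sum.remove) auto
    finally have "(\<Sum>l'\<in>?D - {m}. (hnorm H (P l' y))\<^sup>2) = 0" using y by simp
    then have "(hnorm H (P l y))\<^sup>2 = 0"
      using fin lm ne True by (subst (asm) sum_nonneg_eq_0_iff) auto
    then show ?thesis using null_eq[of "P l y" 0] lm y by (simp add: H.hnull_iff y_def)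
  qed
qed

lemma P_P_level:
  assumes l: "l \<in> mor G" and N: "N \<in> Nk k" "deg G l \<le> N" and n: "n \<in> level N" and x: "x \<in> hcar H"
  shows "P l (P n x) = (if n \<in> exts l N then P n x else 0)"
proof -
  have nm: "n \<in> mor G" using n by (simp add: level_iff)
  have "P l (P n x) = (\<Sum>n'\<in>exts l N. P n' (P n x))" using l N nm x by (intro P_exts) auto
  also have "\<dots> = (\<Sum>n'\<in>exts l N. if n' = n then P n x else 0)"
    using n x nm P_orthogonal[of _ N n x] by (intro sum.cong) (auto simp: exts_def)
  finally show ?thesis by (simp add: sum.delta)
qed

text \<open>The index set is the one in \<open>cyl_Int\<close>: products of projections and
  intersections of cylinders split identically.\<close>

lemma P_P:
  assumes l: "l \<in> mor G" and m: "m \<in> mor G" and N: "N \<in> Nk k" "deg G l \<le> N" "deg G m \<le> N" and x: "x \<in> hcar H"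
  shows "P l (P m x) = (\<Sum>n\<in>exts l N \<inter> exts m N. P n x)"
proof -
  have ex: "n \<in> mor G" "n \<in> level N" if "n \<in> exts m N" for n using that by (auto simp: exts_def level_iff)
  have "P l (P m x) = P l (\<Sum>n\<in>exts m N. P n x)" using P_exts[OF m N(1,3) x] by simp
  also have "\<dots> = (\<Sum>n\<in>exts m N. P l (P n x))" using l x ex by (intro P_sum) auto
  also have "\<dots> = (\<Sum>n\<in>exts m N. if n \<in> exts l N then P n x else 0)"
    using P_P_level[OF l N(1,2) _ x] ex by (intro sum.cong) auto
  also have "\<dots> = (\<Sum>n\<in>exts m N \<inter> exts l N. P n x)" by (simp add: sum.inter_restrict)
  finally show ?thesis by (simp add: Int_commute)
qed

lemma cyl_Int:
  assumes "l \<in> mor G" "m \<in> mor G" "N \<in> Nk k" "deg G l \<le> N" "deg G m \<le> N"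
  shows "Z l \<inter> Z m = (\<Union>n\<in>exts l N \<inter> exts m N. Z n)"
proof (intro equalityI subsetI)
  fix x assume "x \<in> Z l \<inter> Z m"
  then show "x \<in> (\<Union>n\<in>exts l N \<inter> exts m N. Z n)"
    using cyl_mem_exts[of x l N] cyl_mem_exts[of x m N] cyl_path[of x N] cylD[of x l] assms by blast
next
  fix x assume "x \<in> (\<Union>n\<in>exts l N \<inter> exts m N. Z n)"
  then show "x \<in> Z l \<inter> Z m" using cyl_ext_subset by (auto simp: exts_def)
qed

lemma common_level:
  assumes "l \<in> mor G" "m \<in> mor G"
  obtains N where "N \<in> Nk k" "deg G l \<le> N" "deg G m \<le> N"
proof -
  have "sup (deg G l) (deg G m) \<in> Nk k" using assms by (intro Nk_sup) auto
  then show ?thesis using that by (meson sup_ge1 sup_ge2)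
qed

lemma xi [simp]: "\<xi> \<in> hcar H"
  using monic by (simp add: monic_with_def)

lemma dense_P: "dense_span H ((\<lambda>l. P l \<xi>) ` mor G)"
proof -
  have "{t l (ts l \<xi>) | l. l \<in> mor G} = (\<lambda>l. P l \<xi>) ` mor G" by (auto simp: P_def)
  then show ?thesis using monic by (simp add: monic_with_def)
qed

lemma emeasure_cyl: "l \<in> mor G \<Longrightarrow> emeasure \<mu> (Z l) = ennreal ((hnorm H (P l \<xi>))\<^sup>2)"
  using mu[of l] P_hip_self[of l \<xi>] by (simp add: P_def)

lemma finite_mu: "finite_measure \<mu>"
  using vertexD by (intro finite_measureI_cyl) (simp add: emeasure_cyl)

sublocale finite_measure \<mu> by (rule finite_mu)

lemma hip_xi_P: "l \<in> mor G \<Longrightarrow> hip H \<xi> (P l \<xi>) = of_real (measure \<mu> (Z l))"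
  using emeasure_cyl[of l] P_hip_self[of l \<xi>] by (simp add: measure_def)

text \<open>Self-adjointness moves both projections to one side, where \<open>P_P\<close> splits the
  product into projections whose cylinders partition \<open>Z l \<inter> Z m\<close>; additivity of
  the measure does the rest.\<close>

lemma gram_P:
  assumes "l \<in> mor G" "m \<in> mor G"
  shows "hip H (P l \<xi>) (P m \<xi>) = hip (L2 \<mu>) (indicator (Z l)) (indicator (Z m))"
proof -
  obtain N where N: "N \<in> Nk k" "deg G l \<le> N" "deg G m \<le> N" using common_level[OF assms] .
  let ?E = "exts l N \<inter> exts m N"
  have E: "?E \<subseteq> level N" "\<And>n. n \<in> ?E \<Longrightarrow> n \<in> mor G" by (auto simp: exts_def level_iff)
  have "hip H (P l \<xi>) (P m \<xi>) = hip H \<xi> (\<Sum>n\<in>?E. P n \<xi>)"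
    using assms P_hip[of l \<xi> "P m \<xi>"] P_P[OF assms N xi] by simp
  also have "\<dots> = (\<Sum>n\<in>?E. of_real (measure \<mu> (Z n)))"
    using E(2) by (subst H.hip_sum_right) (auto intro!: sum.cong hip_xi_P)
  also have "\<dots> = of_real (measure \<mu> (\<Union>n\<in>?E. Z n))"
    using E disjoint_cyl[OF E(1)] by (subst finite_measure_finite_Union) auto
  also have "\<dots> = of_real (measure \<mu> (Z l \<inter> Z m))" using cyl_Int[OF assms N] by simp
  finally show ?thesis using assms by (simp add: L2_hip_indicator)
qed

lemma unitary_exists:
  obtains U where "\<And>x. x \<in> hcar H \<Longrightarrow> U x \<in> hcar (L2 \<mu>)"
    "\<And>x y. x \<in> hcar H \<Longrightarrow> y \<in> hcar H \<Longrightarrow> hip (L2 \<mu>) (U x) (U y) = hip H x y"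
    "\<And>y. y \<in> hcar (L2 \<mu>) \<Longrightarrow> \<exists>x\<in>hcar H. hnull (L2 \<mu>) (y - U x)"
    "\<And>l. l \<in> mor G \<Longrightarrow> hnull (L2 \<mu>) (U (P l \<xi>) - indicator (Z l))"
proof -
  interpret L: hilb "L2 \<mu>" by (rule hilb_L2)
  have gp: "gram_pair H (L2 \<mu>) (\<lambda>l. P l \<xi>) (\<lambda>l. indicator (Z l)) (mor G)"
    by unfold_locales (auto simp: L2_indicator gram_P dense_P)
  have S: "(\<lambda>l. indicator (Z l)) ` mor G \<subseteq> hcar (L2 \<mu>)" by (auto simp: L2_indicator)
  have "dense_span (L2 \<mu>) ((\<lambda>l. indicator (Z l)) ` mor G)"
    by (intro L2_dense_cyl[OF finite_mu S] L.hclos_superset[OF S]) auto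
  from gram_unitary[OF gp this] that show ?thesis by metis
qed

text \<open>A null vertex cylinder means that \<open>t v\<close> kills \<open>\<xi>\<close>. It then
  kills every \<open>P m \<xi>\<close>: for \<open>m\<close> with range \<open>v\<close> because
  \<open>ts m\<close> factors through \<open>t v\<close>, otherwise by orthogonality of vertices.
  Density gives \<open>t v = 0\<close>, against monicity.\<close>

lemma vertex_positive:
  assumes v: "v \<in> vertices G" shows "emeasure \<mu> (Z v) > 0"
proof (rule ccontr)
  note vD = vertexD[OF v]
  assume "\<not> emeasure \<mu> (Z v) > 0"
  then have "(hnorm H (P v \<xi>))\<^sup>2 = 0" using emeasure_cyl[OF vD(1)] by (simp add: ennreal_eq_0_iff)
  then have "P v \<xi> = 0" using null_eq[of "P v \<xi>" 0] vD by (simp add: H.hnull_iff)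
  then have tv: "t v \<xi> = 0" using P_vertex[OF v] by simp
  have "hnull H (t v x)" if x: "x \<in> hcar H" for x
  proof (rule blin_null_on_dense[OF H.hilb_axioms H.hilb_axioms t_blin[OF vD(1)] _ dense_P _ x])
    fix y assume "y \<in> (\<lambda>l. P l \<xi>) ` mor G"
    then obtain m where m: "m \<in> mor G" "y = P m \<xi>" by auto
    have eq: "P m \<xi> = t (rng G m) (t m (ts m (t (rng G m) \<xi>)))" using m by (simp add: P_def)
    have "t v y = 0"
    proof (cases "v = rng G m")
      case True
      then have "ts m \<xi> = 0" using ts_rng[OF m(1) xi] tv m(1) by (simp del: ts_rng)
      then show ?thesis using m True by (simp add: P_def)
    next
      case False
      then show ?thesis
        using m v unfolding m(2) eq by (subst t_vertices) auto
    qed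
    then show "hnull H (t v y)" by simp
  qed auto
  then show False using monic vD(1) by (auto simp: monic_with_def)
qed

end

section \<open>The model on the path space\<close>

locale monic_model = monic_rep +
  fixes U
  assumes U_closed [simp]: "\<And>x. x \<in> hcar H \<Longrightarrow> U x \<in> hcar (L2 \<mu>)"
    and U_hip: "\<And>x y. x \<in> hcar H \<Longrightarrow> y \<in> hcar H \<Longrightarrow> hip (L2 \<mu>) (U x) (U y) = hip H x y"
    and U_surj: "\<And>y. y \<in> hcar (L2 \<mu>) \<Longrightarrow> \<exists>x\<in>hcar H. hnull (L2 \<mu>) (y - U x)"
    and U_P_null: "\<And>l. l \<in> mor G \<Longrightarrow> hnull (L2 \<mu>) (U (P l \<xi>) - indicator (Z l))"
begin

sublocale L: hilb "L2 \<mu>" by (rule hilb_L2)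

lemma U_blin: "blin H (L2 \<mu>) U"
  by (rule isometry_blin[OF H.hilb_axioms L.hilb_axioms]) (auto simp: U_hip)

lemma U_measurable [measurable]: "x \<in> hcar H \<Longrightarrow> U x \<in> borel_measurable \<mu>"
  by (rule L2_measurable) simp

lemma U_P_xi: "l \<in> mor G \<Longrightarrow> AE y in \<mu>. U (P l \<xi>) y = indicator (Z l) y"
  using U_P_null[of l] L2_hnull_diff_iff[of "U (P l \<xi>)" \<mu> "indicator (Z l)"] by (simp add: L2_indicator)

lemma U_add: "x \<in> hcar H \<Longrightarrow> x' \<in> hcar H \<Longrightarrow> AE y in \<mu>. U (x + x') y = U x y + U x' y"
  using blin_add[OF U_blin, of x x'] L2_hnull_diff_iff[of "U (x + x')" \<mu> "U x + U x'"]
    L.add_closed[of "U x" "U x'"] by simp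

lemma U_zero: "AE y in \<mu>. U 0 y = 0"
  using U_add[of 0 0] by simp

lemma U_sum:
  assumes "finite F" "\<And>i. i \<in> F \<Longrightarrow> g i \<in> hcar H"
  shows "AE y in \<mu>. U (\<Sum>i\<in>F. g i) y = (\<Sum>i\<in>F. U (g i) y)"
  using assms
proof (induction F rule: finite_induct)
  case empty
  then show ?case using U_zero by simp
next
  case (insert i F)
  have "AE y in \<mu>. U (g i + (\<Sum>i\<in>F. g i)) y = U (g i) y + U (\<Sum>i\<in>F. g i) y"
    using insert by (intro U_add) auto
  moreover have "AE y in \<mu>. U (\<Sum>i\<in>F. g i) y = (\<Sum>i\<in>F. U (g i) y)" using insert by auto
  ultimately show ?case by eventually_elim (simp add: insert(1,2))
qed

text \<open>Identities between bounded maps may thus be tested on the vectors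
  \<open>P m \<xi>\<close>, whose images are explicit indicators.\<close>

lemma AE_eq_on_dense:
  assumes A: "blin H (L2 \<mu>) A" and B: "blin H (L2 \<mu>) B"
    and eq: "\<And>m. m \<in> mor G \<Longrightarrow> AE y in \<mu>. A (P m \<xi>) y = B (P m \<xi>) y" and x: "x \<in> hcar H"
  shows "AE y in \<mu>. A x y = B x y"
proof -
  have "hnull (L2 \<mu>) (A x - B x)"
  proof (rule blin_null_on_dense[OF H.hilb_axioms L.hilb_axioms blin_diff[OF L.hilb_axioms A B H.hilb_axioms] _ dense_P _ x])
    fix y assume "y \<in> (\<lambda>l. P l \<xi>) ` mor G"
    then obtain m where m: "m \<in> mor G" "y = P m \<xi>" by auto
    show "hnull (L2 \<mu>) (A y - B y)"
      unfolding m(2) using eq[OF m(1)] blin_closed[OF A] blin_closed[OF B] m(1)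
      by (subst L2_hnull_diff_iff) auto
  qed auto
  then show ?thesis
    using blin_closed[OF A] blin_closed[OF B] x by (subst (asm) L2_hnull_diff_iff) auto
qed

text \<open>On a generator \<open>P m \<xi>\<close> the left side becomes a sum of indicators by
  \<open>P_P\<close>, and the right side is the indicator of \<open>Z l \<inter> Z m\<close>;
  \<open>cyl_Int\<close> matches them.\<close>

lemma U_P:
  assumes l: "l \<in> mor G" and x: "x \<in> hcar H"
  shows "AE y in \<mu>. U (P l x) y = indicator (Z l) y * U x y"
proof (rule AE_eq_on_dense[OF _ _ _ x])
  show "blin H (L2 \<mu>) (\<lambda>x. U (P l x))"
    by (rule blin_comp[OF H.hilb_axioms H.hilb_axioms L.hilb_axioms P_blin[OF l] U_blin])
  show "blin H (L2 \<mu>) (\<lambda>x y. indicator (Z l) y * U x y)"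
    by (rule blin_comp[OF H.hilb_axioms L.hilb_axioms L.hilb_axioms U_blin L2_blin_mult_indicator]) (simp add: l)
  fix m assume m: "m \<in> mor G"
  obtain N where N: "N \<in> Nk k" "deg G l \<le> N" "deg G m \<le> N" using common_level[OF l m] .
  let ?E = "exts l N \<inter> exts m N"
  have E: "?E \<subseteq> level N" "\<And>n. n \<in> ?E \<Longrightarrow> n \<in> mor G" by (auto simp: exts_def level_iff)
  have "AE y in \<mu>. U (\<Sum>n\<in>?E. P n \<xi>) y = (\<Sum>n\<in>?E. U (P n \<xi>) y)"
    using E by (intro U_sum) auto
  moreover have "AE y in \<mu>. \<forall>n\<in>?E. U (P n \<xi>) y = indicator (Z n) y"
    using E U_P_xi by (intro AE_finite_allI) auto
  ultimately show "AE y in \<mu>. U (P l (P m \<xi>)) y = indicator (Z l) y * U (P m \<xi>) y"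
    using U_P_xi[OF m]
  proof eventually_elim
    case (elim y)
    have "U (P l (P m \<xi>)) y = (\<Sum>n\<in>?E. indicator (Z n) y)"
      using elim by (simp add: P_P[OF l m N xi])
    also have "\<dots> = indicator (\<Union>n\<in>?E. Z n) y"
      using indicator_UN_cyl[OF E(1)] by (simp add: sum_fun_apply)
    also have "\<dots> = indicator (Z l) y * indicator (Z m) y"
      using cyl_Int[OF l m N] by (simp add: indicator_inter_arith[symmetric])
    finally show ?case using elim by simp
  qed
qed

definition f where "f l = U (t l \<xi>)"

lemma f_closed [simp]: "l \<in> mor G \<Longrightarrow> f l \<in> hcar (L2 \<mu>)"
  by (simp add: f_def)

lemma f_measurable [measurable]: "l \<in> mor G \<Longrightarrow> f l \<in> borel_measurable \<mu>"
  by (simp add: f_def)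

text \<open>The vector \<open>t l \<xi>\<close> is fixed by \<open>P l\<close>, which
  \<open>U\<close> turns into multiplication by the indicator of \<open>Z l\<close>.\<close>

lemma f_support:
  assumes l: "l \<in> mor G" shows "AE y in \<mu>. y \<notin> Z l \<longrightarrow> f l y = 0"
  using U_P[OF l, of "t l \<xi>"] l unfolding f_def by (simp add: P_t) (auto elim: AE_mp)

lemma cyl_rng: "m \<in> mor G \<Longrightarrow> x \<in> Z m \<Longrightarrow> x \<in> Z (rng G m)"
  using cyl_ext_subset[of "rng G m" m] ext_cmp[of "rng G m" m] by auto

lemma cyl_vertex_rng: "v \<in> vertices G \<Longrightarrow> m \<in> mor G \<Longrightarrow> x \<in> Z m \<Longrightarrow> x \<in> Z v \<Longrightarrow> rng G m = v"
  using cyl_rng[of m x] vertexD[of v] by (intro cyl_disjoint[of _ 0 _ x]) (auto simp: level_iff)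

text \<open>For composable \<open>l\<close> and \<open>m\<close>, \<open>t l (P m \<xi>)\<close> is
  the projection of the composite applied to \<open>t l \<xi>\<close>, and within \<open>Z l\<close>
  the cylinder of the composite is the shift preimage of \<open>Z m\<close>. Otherwise both sides
  vanish: the vertex projections are orthogonal, and shifting \<open>Z l\<close> lands in a
  different vertex cylinder.\<close>

lemma U_t_P:
  assumes l: "l \<in> mor G" and m: "m \<in> mor G"
  shows "AE y in \<mu>. U (t l (P m \<xi>)) y = f l y * indicator (Z m) (shift k (deg G l) y)"
proof (cases "src G l = rng G m")
  case True
  have "P m (t (src G l) \<xi>) = P m \<xi>" using True m by (simp add: P_def)
  then have "P (cmp G l m) (t l \<xi>) = t l (P m \<xi>)" using l m True by (simp add: P_cmp ts_t)
  moreover have "AE y in \<mu>. U (P (cmp G l m) (t l \<xi>)) y = indicator (Z (cmp G l m)) y * f l y"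
    unfolding f_def using l m True by (intro U_P) auto
  ultimately have "AE y in \<mu>. U (t l (P m \<xi>)) y = indicator (Z (cmp G l m)) y * f l y" by simp
  with f_support[OF l] show ?thesis
  proof eventually_elim
    case (elim y)
    then show ?case
      using cyl_cmp_iff[OF l m True, of y] by (cases "y \<in> Z l") (auto simp: indicator_def)
  qed
next
  case False
  have "P m \<xi> = t (rng G m) (P m \<xi>)" using m by (simp add: P_def)
  then have "t (src G l) (P m \<xi>) = t (src G l) (t (rng G m) (P m \<xi>))" by (rule arg_cong)
  also have "\<dots> = 0" using l m False by (subst t_vertices) auto
  finally have "t l (t (src G l) (P m \<xi>)) = 0" using l by simp
  then have z: "t l (P m \<xi>) = 0" using l m by simp
  from U_zero f_support[OF l] show ?thesis unfolding z
  proof eventually_elim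
    case (elim y)
    have "shift k (deg G l) y \<notin> Z m" if "y \<in> Z l"
      using cyl_vertex_rng[of "src G l" m "shift k (deg G l) y"] shift_cyl[OF l that] l m False by auto
    then show ?case using elim by (cases "y \<in> Z l") auto
  qed
qed

text \<open>Since \<open>ts l\<close> after \<open>t l\<close> is the projection at
  \<open>src G l\<close>, the norm is that of \<open>P (src G l) (P m \<xi>)\<close>, whose image is
  the indicator of the intersection.\<close>

lemma hnorm_t_P:
  assumes l: "l \<in> mor G" and m: "m \<in> mor G"
  shows "ennreal ((hnorm (L2 \<mu>) (U (t l (P m \<xi>))))\<^sup>2) = emeasure \<mu> (Z (src G l) \<inter> Z m)"
proof -
  have "(hnorm (L2 \<mu>) (U (t l (P m \<xi>))))\<^sup>2 = Re (hip H (t l (P m \<xi>)) (t l (P m \<xi>)))"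
    using l m by (simp add: L.hnorm_sq U_hip)
  also have "hip H (t l (P m \<xi>)) (t l (P m \<xi>)) = hip H (P m \<xi>) (P (src G l) (P m \<xi>))"
    using l m by (simp add: hip_t_left ts_t P_vertex)
  also have "\<dots> = hip H (P (src G l) (P m \<xi>)) (P (src G l) (P m \<xi>))"
    using l m P_hip[of "src G l" "P m \<xi>" "P (src G l) (P m \<xi>)"] by simp
  also have "\<dots> = hip (L2 \<mu>) (U (P (src G l) (P m \<xi>))) (U (P (src G l) (P m \<xi>)))"
    using l m by (simp add: U_hip)
  also have "Re \<dots> = (hnorm (L2 \<mu>) (U (P (src G l) (P m \<xi>))))\<^sup>2"
    using l m by (simp add: L.hnorm_sq)
  also have "hnorm (L2 \<mu>) (U (P (src G l) (P m \<xi>))) = hnorm (L2 \<mu>) (indicator (Z (src G l) \<inter> Z m))"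
  proof (rule L.hnorm_cong)
    have "AE y in \<mu>. U (P (src G l) (P m \<xi>)) y = indicator (Z (src G l) \<inter> Z m) y"
      using U_P[of "src G l" "P m \<xi>"] U_P_xi[OF m] l m
      by (auto simp: indicator_inter_arith elim: AE_mp)
    then show "hnull (L2 \<mu>) (U (P (src G l) (P m \<xi>)) - indicator (Z (src G l) \<inter> Z m))"
      using l m by (subst L2_hnull_diff_iff) (auto simp: L2_indicator)
  qed (use l m in \<open>auto simp: L2_indicator\<close>)
  finally show ?thesis using l m by (simp add: L2_hnorm_indicator emeasure_eq_measure)
qed

lemma distr_shift:
  assumes l: "l \<in> mor G"
  shows "distr (density \<mu> (\<lambda>y. ennreal ((cmod (f l y))\<^sup>2))) \<mu> (shift k (deg G l)) = density \<mu> (indicator (Z (src G l)))"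
proof (rule measure_eqI_cyl)
  note [measurable] = f_measurable[OF l] shift_measurable[OF deg_Nk[OF l]]
  fix m assume m: "m \<in> mor G"
  let ?A = "shift k (deg G l) -` Z m \<inter> space \<mu>"
  have A: "?A \<in> sets \<mu>" using m by measurable
  have "emeasure (distr (density \<mu> (\<lambda>y. ennreal ((cmod (f l y))\<^sup>2))) \<mu> (shift k (deg G l))) (Z m)
      = emeasure (density \<mu> (\<lambda>y. ennreal ((cmod (f l y))\<^sup>2))) ?A"
    using m by (subst emeasure_distr) auto
  also have "\<dots> = (\<integral>\<^sup>+y. ennreal ((cmod (f l y))\<^sup>2) * indicator ?A y \<partial>\<mu>)"
    using A by (subst emeasure_density) auto
  also have "\<dots> = (\<integral>\<^sup>+y. ennreal ((cmod (U (t l (P m \<xi>)) y))\<^sup>2) \<partial>\<mu>)"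
  proof (rule nn_integral_cong_AE, use U_t_P[OF l m] AE_space[of \<mu>] in eventually_elim)
    case (elim y)
    then show ?case by (simp add: indicator_def)
  qed
  also have "\<dots> = emeasure \<mu> (Z (src G l) \<inter> Z m)"
    using l m by (simp add: L2_hnorm_nn hnorm_t_P)
  finally have eq: "emeasure (distr (density \<mu> (\<lambda>y. ennreal ((cmod (f l y))\<^sup>2))) \<mu> (shift k (deg G l))) (Z m)
      = emeasure \<mu> (Z (src G l) \<inter> Z m)" .
  have "emeasure (density \<mu> (indicator (Z (src G l)))) (Z m) = (\<integral>\<^sup>+y. indicator (Z (src G l) \<inter> Z m) y \<partial>\<mu>)"
    unfolding indicator_inter_arith using l m by (subst emeasure_density) auto
  also have "\<dots> = emeasure \<mu> (Z (src G l) \<inter> Z m)" using l m by (intro nn_integral_indicator) auto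
  finally show "emeasure (distr (density \<mu> (\<lambda>y. ennreal ((cmod (f l y))\<^sup>2))) \<mu> (shift k (deg G l))) (Z m)
      = emeasure (density \<mu> (indicator (Z (src G l)))) (Z m)" using eq by simp
  show "emeasure (distr (density \<mu> (\<lambda>y. ennreal ((cmod (f l y))\<^sup>2))) \<mu> (shift k (deg G l))) (Z m) \<noteq> \<infinity>"
    unfolding eq by simp
qed auto

text \<open>Change of variables for \<open>distr_shift\<close>. Allowing any extended nonnegative
  measurable \<open>g\<close>, it serves indicators, squared moduli and densities alike.\<close>

lemma nn_integral_shift:
  assumes l: "l \<in> mor G" and g [measurable]: "g \<in> borel_measurable \<mu>"
  shows "(\<integral>\<^sup>+y. ennreal ((cmod (f l y))\<^sup>2) * g (shift k (deg G l) y) \<partial>\<mu>) = (\<integral>\<^sup>+y. indicator (Z (src G l)) y * g y \<partial>\<mu>)"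
proof -
  note [measurable] = f_measurable[OF l] shift_measurable[OF deg_Nk[OF l]]
  have [measurable]: "Z (src G l) \<in> sets \<mu>" using l by simp
  have "(\<integral>\<^sup>+y. indicator (Z (src G l)) y * g y \<partial>\<mu>) = (\<integral>\<^sup>+y. g y \<partial>density \<mu> (indicator (Z (src G l))))"
    by (subst nn_integral_density) auto
  also have "\<dots> = (\<integral>\<^sup>+y. g (shift k (deg G l) y) \<partial>density \<mu> (\<lambda>y. ennreal ((cmod (f l y))\<^sup>2)))"
    unfolding distr_shift[OF l, symmetric] by (subst nn_integral_distr) auto
  also have "\<dots> = (\<integral>\<^sup>+y. ennreal ((cmod (f l y))\<^sup>2) * g (shift k (deg G l) y) \<partial>\<mu>)"
    by (subst nn_integral_density) auto
  finally show ?thesis by simp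
qed

section \<open>The weighted shift as a bounded operator\<close>

text \<open>Stated for all measurable \<open>g\<close>, with integrals that may be infinite, so that
  it yields membership in \<open>L2\<close>, the contraction bound and compatibility with null
  sets.\<close>

lemma proj_rep_nn:
  assumes l: "l \<in> mor G" and g: "g \<in> borel_measurable \<mu>"
  shows "(\<integral>\<^sup>+y. ennreal ((cmod (proj_rep k G f l g y))\<^sup>2) \<partial>\<mu>) \<le> (\<integral>\<^sup>+y. ennreal ((cmod (g y))\<^sup>2) \<partial>\<mu>)"
proof -
  note [measurable] = g
  have "(\<integral>\<^sup>+y. ennreal ((cmod (proj_rep k G f l g y))\<^sup>2) \<partial>\<mu>)
      = (\<integral>\<^sup>+y. ennreal ((cmod (f l y))\<^sup>2) * (\<lambda>y. ennreal ((cmod (g y))\<^sup>2)) (shift k (deg G l) y) \<partial>\<mu>)"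
    by (simp add: proj_rep_def norm_mult power_mult_distrib ennreal_mult')
  also have "\<dots> = (\<integral>\<^sup>+y. indicator (Z (src G l)) y * ennreal ((cmod (g y))\<^sup>2) \<partial>\<mu>)"
    by (rule nn_integral_shift[OF l]) measurable
  also have "\<dots> \<le> (\<integral>\<^sup>+y. ennreal ((cmod (g y))\<^sup>2) \<partial>\<mu>)"
    by (intro nn_integral_mono) (auto simp: indicator_def)
  finally show ?thesis .
qed

lemma proj_rep_closed:
  assumes l: "l \<in> mor G" and g: "g \<in> hcar (L2 \<mu>)"
  shows "proj_rep k G f l g \<in> hcar (L2 \<mu>)"
proof (rule L2_carI)
  note [measurable] = f_measurable[OF l] shift_measurable[OF deg_Nk[OF l]] L2_measurable[OF g]
  show "proj_rep k G f l g \<in> borel_measurable \<mu>" unfolding proj_rep_def by measurable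
  have "(\<integral>\<^sup>+y. ennreal ((cmod (g y))\<^sup>2) \<partial>\<mu>) < \<infinity>" using L2_hnorm_nn[OF g] by simp
  with proj_rep_nn[OF l L2_measurable[OF g]]
  show "(\<integral>\<^sup>+y. ennreal ((cmod (proj_rep k G f l g y))\<^sup>2) \<partial>\<mu>) < \<infinity>" by (rule order.strict_trans1)
qed

lemma proj_rep_blin:
  assumes l: "l \<in> mor G"
  shows "blin (L2 \<mu>) (L2 \<mu>) (proj_rep k G f l)"
  unfolding blin_def
proof (intro conjI ballI allI)
  have "hnorm (L2 \<mu>) (proj_rep k G f l g) \<le> 1 * hnorm (L2 \<mu>) g" if g: "g \<in> hcar (L2 \<mu>)" for g
  proof -
    have "ennreal ((hnorm (L2 \<mu>) (proj_rep k G f l g))\<^sup>2) \<le> ennreal ((hnorm (L2 \<mu>) g)\<^sup>2)"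
      using proj_rep_nn[OF l L2_measurable[OF g]] L2_hnorm_nn[OF g] L2_hnorm_nn[OF proj_rep_closed[OF l g]] by simp
    then have "(hnorm (L2 \<mu>) (proj_rep k G f l g))\<^sup>2 \<le> (hnorm (L2 \<mu>) g)\<^sup>2" by simp
    from power2_le_imp_le[OF this] g show ?thesis by simp
  qed
  then show "\<exists>C. \<forall>x\<in>hcar (L2 \<mu>). hnorm (L2 \<mu>) (proj_rep k G f l x) \<le> C * hnorm (L2 \<mu>) x" by blast
qed (use proj_rep_closed[OF l] in \<open>auto intro!: L2_hnullI AE_I2 simp: proj_rep_def L2_hsc algebra_simps\<close>)

text \<open>The shift is not known to pull null sets back to null sets. The bound applied to
  \<open>g - g'\<close> shows that \<open>f l\<close> vanishes almost everywhere on the part where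
  the shifted functions differ.\<close>

lemma proj_rep_cong:
  assumes l: "l \<in> mor G" and g: "g \<in> borel_measurable \<mu>" "g' \<in> borel_measurable \<mu>"
    and eq: "AE y in \<mu>. g y = g' y"
  shows "AE y in \<mu>. proj_rep k G f l g y = proj_rep k G f l g' y"
proof -
  note [measurable] = g f_measurable[OF l] shift_measurable[OF deg_Nk[OF l]]
  have "(\<integral>\<^sup>+y. ennreal ((cmod (g y - g' y))\<^sup>2) \<partial>\<mu>) = 0"
    using eq by (subst nn_integral_0_iff_AE) auto
  then have "(\<integral>\<^sup>+y. ennreal ((cmod (proj_rep k G f l (\<lambda>y. g y - g' y) y))\<^sup>2) \<partial>\<mu>) = 0"
    using proj_rep_nn[OF l, of "\<lambda>y. g y - g' y"] by simp
  then have "AE y in \<mu>. proj_rep k G f l (\<lambda>y. g y - g' y) y = 0"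
    by (subst (asm) nn_integral_0_iff_AE) (auto simp: proj_rep_def)
  then show ?thesis by (rule AE_mp) (auto intro!: AE_I2 simp: proj_rep_def algebra_simps)
qed

lemma U_intertwines:
  assumes l: "l \<in> mor G" and x: "x \<in> hcar H"
  shows "AE y in \<mu>. U (t l x) y = proj_rep k G f l (U x) y"
proof (rule AE_eq_on_dense[OF _ _ _ x])
  show "blin H (L2 \<mu>) (\<lambda>x. U (t l x))"
    by (rule blin_comp[OF H.hilb_axioms H.hilb_axioms L.hilb_axioms t_blin[OF l] U_blin])
  show "blin H (L2 \<mu>) (\<lambda>x. proj_rep k G f l (U x))"
    by (rule blin_comp[OF H.hilb_axioms L.hilb_axioms L.hilb_axioms U_blin proj_rep_blin[OF l]])
  fix m assume m: "m \<in> mor G"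
  have "AE y in \<mu>. proj_rep k G f l (U (P m \<xi>)) y = proj_rep k G f l (indicator (Z m)) y"
    using m by (intro proj_rep_cong[OF l] U_P_xi) auto
  with U_t_P[OF l m] show "AE y in \<mu>. U (t l (P m \<xi>)) y = proj_rep k G f l (U (P m \<xi>)) y"
    by eventually_elim (auto simp: proj_rep_def)
qed

text \<open>Transports the identity of \<open>P l \<xi>\<close> with \<open>t l (ts l \<xi>)\<close>: it makes \<open>f l\<close> nonvanishing on the
cylinder and exhibits the density of the prefixing map without Radon-Nikodym.\<close>

lemma indicator_factor:
  assumes l: "l \<in> mor G"
  shows "AE y in \<mu>. indicator (Z l) y = f l y * U (ts l \<xi>) (shift k (deg G l) y)"
  using U_intertwines[OF l, of "ts l \<xi>"] U_P_xi[OF l] l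
  by (simp add: P_def proj_rep_def) (auto elim: AE_mp)

lemma f_nonzero: "l \<in> mor G \<Longrightarrow> AE y in \<mu>. y \<in> Z l \<longrightarrow> f l y \<noteq> 0"
  using indicator_factor[of l] by (rule AE_mp) (auto intro!: AE_I2)

lemma f_pushforward:
  assumes l: "l \<in> mor G" and A: "A \<in> sets \<mu>"
  shows "emeasure \<mu> {x\<in>Z (src G l). prefix k G l x \<in> A} = (\<integral>\<^sup>+x\<in>A. ennreal ((cmod (f l x))\<^sup>2) \<partial>\<mu>)"
proof -
  let ?B = "{x\<in>Z (src G l). prefix k G l x \<in> A}"
  have sp: "space (restrict_space \<mu> (Z (src G l))) = Z (src G l)"
    using cyl_sub[of "src G l"] by (auto simp: space_restrict_space)
  have "prefix k G l -` A \<inter> Z (src G l) \<in> sets (restrict_space \<mu> (Z (src G l)))"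
    using measurable_sets[OF prefix_measurable[OF l] A] by (simp add: sp)
  then have "prefix k G l -` A \<inter> Z (src G l) \<in> sets \<mu>"
    using l cyl_sub[of "src G l"] by (subst (asm) sets_restrict_space_iff) (auto simp: Int_absorb2)
  moreover have "?B = prefix k G l -` A \<inter> Z (src G l)" by auto
  ultimately have B [measurable]: "?B \<in> sets \<mu>" by simp
  have "(\<integral>\<^sup>+x\<in>A. ennreal ((cmod (f l x))\<^sup>2) \<partial>\<mu>)
      = (\<integral>\<^sup>+y. ennreal ((cmod (f l y))\<^sup>2) * indicator ?B (shift k (deg G l) y) \<partial>\<mu>)"
  proof (rule nn_integral_cong_AE, use f_support[OF l] in eventually_elim)
    \<comment> \<open>On \<open>Z l\<close>, prefixing undoes the shift, so \<open>y\<close> lies in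
      \<open>A\<close> exactly when its shift lies in \<open>?B\<close>; off \<open>Z l\<close> the
      weight is zero.\<close>
    case (elim y)
    then show ?case
      using prefix_shift[OF l, of y] shift_cyl[OF l, of y] by (cases "y \<in> Z l") (auto simp: indicator_def)
  qed
  also have "\<dots> = (\<integral>\<^sup>+y. indicator (Z (src G l)) y * indicator ?B y \<partial>\<mu>)"
    by (rule nn_integral_shift[OF l]) measurable
  also have "\<dots> = (\<integral>\<^sup>+y. indicator ?B y \<partial>\<mu>)"
    by (intro nn_integral_cong) (auto simp: indicator_def)
  also have "\<dots> = emeasure \<mu> ?B" by (rule nn_integral_indicator[OF B])
  finally show ?thesis by simp
qed

lemma prefix_derivative:
  assumes l: "l \<in> mor G"
  defines "\<Phi> \<equiv> \<lambda>y. ennreal ((cmod (U (ts l \<xi>) y))\<^sup>2)"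
  shows "\<Phi> \<in> borel_measurable \<mu>" and "AE x in \<mu>. x \<in> Z (src G l) \<longrightarrow> \<Phi> x > 0"
    and "\<And>A. A \<in> sets \<mu> \<Longrightarrow> A \<subseteq> Z (src G l) \<Longrightarrow> emeasure \<mu> (prefix k G l ` A) = (\<integral>\<^sup>+x\<in>A. \<Phi> x \<partial>\<mu>)"
proof -
  have [measurable]: "U (ts l \<xi>) \<in> borel_measurable \<mu>" using l by simp
  have Zs [measurable]: "Z (src G l) \<in> sets \<mu>" using l by simp
  show \<Phi>m [measurable]: "\<Phi> \<in> borel_measurable \<mu>" unfolding \<Phi>_def by measurable
  let ?A = "{x\<in>space \<mu>. x \<in> Z (src G l) \<and> \<Phi> x = 0}"
  have A [measurable]: "?A \<in> sets \<mu>" by measurable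
  \<comment> \<open>The zero set of the density is moved to \<open>Z l\<close> by the change of
    variables. There \<open>indicator_factor\<close> makes a product containing the shifted density
    equal to 1, so the density cannot be zero and the integrand vanishes.\<close>
  have "emeasure \<mu> ?A = (\<integral>\<^sup>+y. indicator (Z (src G l)) y * indicator ?A y \<partial>\<mu>)"
    by (subst nn_integral_indicator[OF A, symmetric]) (auto intro!: nn_integral_cong simp: indicator_def)
  also have "\<dots> = (\<integral>\<^sup>+y. ennreal ((cmod (f l y))\<^sup>2) * indicator ?A (shift k (deg G l) y) \<partial>\<mu>)"
    by (rule nn_integral_shift[OF l, symmetric]) measurable
  also have "\<dots> = (\<integral>\<^sup>+y. 0 \<partial>\<mu>)"
  proof (rule nn_integral_cong_AE, use f_support[OF l] indicator_factor[OF l] in eventually_elim)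
    case (elim y)
    then show ?case by (cases "y \<in> Z l") (auto simp: indicator_def \<Phi>_def)
  qed
  finally have "?A \<in> null_sets \<mu>" using A by (simp add: null_sets_def)
  then show "AE x in \<mu>. x \<in> Z (src G l) \<longrightarrow> \<Phi> x > 0"
    using cyl_sub[of "src G l"] by (intro AE_I'[of ?A]) (auto simp: not_gr_zero)
  fix B assume B [measurable]: "B \<in> sets \<mu>" and sub: "B \<subseteq> Z (src G l)"
  have "(\<integral>\<^sup>+x\<in>B. \<Phi> x \<partial>\<mu>) = (\<integral>\<^sup>+y. indicator (Z (src G l)) y * (\<Phi> y * indicator B y) \<partial>\<mu>)"
    using sub by (intro nn_integral_cong) (auto simp: indicator_def)
  also have "\<dots> = (\<integral>\<^sup>+y. ennreal ((cmod (f l y))\<^sup>2) * (\<Phi> (shift k (deg G l) y) * indicator B (shift k (deg G l) y)) \<partial>\<mu>)"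
    by (rule nn_integral_shift[OF l, symmetric]) measurable
  also have "\<dots> = (\<integral>\<^sup>+y. indicator (prefix k G l ` B) y \<partial>\<mu>)"
  proof (rule nn_integral_cong_AE, use f_support[OF l] indicator_factor[OF l] in eventually_elim)
    case (elim y)
    \<comment> \<open>On \<open>Z l\<close> the density after the shift is the reciprocal of the
      squared modulus of \<open>f l\<close>, so the product is an indicator.\<close>
    have "ennreal ((cmod (f l y))\<^sup>2) * \<Phi> (shift k (deg G l) y)
        = ennreal ((cmod (f l y * U (ts l \<xi>) (shift k (deg G l) y)))\<^sup>2)"
      by (simp add: \<Phi>_def ennreal_mult' norm_mult power_mult_distrib)
    also have "\<dots> = indicator (Z l) y"
      unfolding elim(2)[symmetric] by (simp add: indicator_def)
    finally show ?case
      unfolding prefix_image[OF l sub] mult.assoc[symmetric] by (simp add: indicator_def)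
  qed
  also have "\<dots> = emeasure \<mu> (prefix k G l ` B)"
    by (rule nn_integral_indicator[OF prefix_image_sets[OF l B sub]])
  finally show "emeasure \<mu> (prefix k G l ` B) = (\<integral>\<^sup>+x\<in>B. \<Phi> x \<partial>\<mu>)" by simp
qed

lemma std_sbfs_mu: "std_sbfs k G \<mu>"
  unfolding std_sbfs_def
proof (intro conjI ballI)
  fix n assume n: "n \<in> Nk k"
  show "(\<Union>l\<in>{l\<in>mor G. deg G l = n}. Z l) = \<Omega>" using UN_level[OF n] by (simp add: level_def)
  show "disjoint_family_on Z {l\<in>mor G. deg G l = n}" using disjoint_cyl[of "level n" n] by (simp add: level_def)
  show "shift k n \<in> measurable \<mu> \<mu>" using n by (rule shift_measurable)
next
  fix l assume l: "l \<in> mor G"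
  show "prefix k G l \<in> measurable (restrict_space \<mu> (Z (src G l))) \<mu>" using l by (rule prefix_measurable)
  show "A \<subseteq> Z (src G l) \<longrightarrow> prefix k G l ` A \<in> sets \<mu>" if "A \<in> sets \<mu>" for A
    using prefix_image_sets[OF l that] by blast
  show "\<exists>\<Phi>\<in>borel_measurable \<mu>. (AE x in \<mu>. x \<in> Z (src G l) \<longrightarrow> \<Phi> x > 0) \<and>
      (\<forall>A\<in>sets \<mu>. A \<subseteq> Z (src G l) \<longrightarrow> emeasure \<mu> (prefix k G l ` A) = (\<integral>\<^sup>+x\<in>A. \<Phi> x \<partial>\<mu>))"
    using prefix_derivative[OF l] by (intro bexI[of _ "\<lambda>y. ennreal ((cmod (U (ts l \<xi>) y))\<^sup>2)"]) auto
qed (use vertex_positive in auto)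

lemma proj_system_f: "proj_system k G \<mu> f"
  unfolding proj_system_def
proof (intro conjI ballI impI)
  fix l m assume l: "l \<in> mor G" and m: "m \<in> mor G" and lm: "src G l = rng G m"
  \<comment> \<open>Multiplicativity of \<open>f\<close> is the intertwining relation at the vector
    \<open>t m \<xi>\<close>.\<close>
  have "AE y in \<mu>. U (t l (t m \<xi>)) y = proj_rep k G f l (U (t m \<xi>)) y"
    using l m by (intro U_intertwines) auto
  then show "AE x in \<mu>. f l x * f m (shift k (deg G l) x) = f (cmp G l m) x"
    using t_t[OF l m lm xi] by (simp add: f_def proj_rep_def eq_commute)
next
  fix l A assume l: "l \<in> mor G" and A: "A \<in> sets \<mu>"
  show "emeasure \<mu> {x\<in>Z (src G l). prefix k G l x \<in> A} = (\<integral>\<^sup>+x\<in>A. ennreal ((cmod (f l x))\<^sup>2) \<partial>\<mu>)"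
    using l A by (rule f_pushforward)
next
  fix l assume l: "l \<in> mor G"
  show "integrable \<mu> (\<lambda>x. (cmod (f l x))\<^sup>2)" using f_closed[OF l] by (simp add: L2_car)
  show "AE x in \<mu>. x \<in> Z l \<longrightarrow> f l x \<noteq> 0" using l by (rule f_nonzero)
qed (use std_sbfs_mu in auto)

lemma unit_equiv_f: "unit_equiv G H t (L2 \<mu>) (proj_rep k G f)"
  unfolding unit_equiv_def
proof (intro exI[of _ U] conjI ballI allI)
  fix l x assume l: "l \<in> mor G" and x: "x \<in> hcar H"
  show "hnull (L2 \<mu>) (U (t l x) - proj_rep k G f l (U x))"
    using U_intertwines[OF l x] l x proj_rep_closed[OF l, of "U x"] by (subst L2_hnull_diff_iff) auto
qed (use U_hip U_surj blin_add[OF U_blin] blin_sc[OF U_blin] in auto)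

end

lemma monic_rep_unit_equiv:
  assumes "monic_rep k G \<mu> H t ts \<xi>"
  shows "\<exists>f. proj_system k G \<mu> f \<and> unit_equiv G H t (L2 \<mu>) (proj_rep k G f)"
proof -
  interpret monic_rep k G \<mu> H t ts \<xi> by fact
  obtain U where "\<And>x. x \<in> hcar H \<Longrightarrow> U x \<in> hcar (L2 \<mu>)"
    "\<And>x y. x \<in> hcar H \<Longrightarrow> y \<in> hcar H \<Longrightarrow> hip (L2 \<mu>) (U x) (U y) = hip H x y"
    "\<And>y. y \<in> hcar (L2 \<mu>) \<Longrightarrow> \<exists>x\<in>hcar H. hnull (L2 \<mu>) (y - U x)"
    "\<And>l. l \<in> mor G \<Longrightarrow> hnull (L2 \<mu>) (U (P l \<xi>) - indicator (Z l))"
    using unitary_exists by metis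
  then interpret monic_model k G \<mu> H t ts \<xi> U by unfold_locales
  show ?thesis using proj_system_f unit_equiv_f by blast
qed

theorem mainTheorem12:
  fixes k :: nat and G :: "'a kgraph"
  assumes kpos: "0 < k"
    and kg: "is_kgraph k G" and fin: "finite_kgraph G" and nosrc: "no_sources k G"
  shows
    "(\<forall>(H :: ('h::ab_group_add) hspace) t ts \<xi> (\<mu> :: 'a ipath measure).
        is_hilbert_sp H \<and> hdefinite H \<and> CK_rep k G H t ts \<and> monic_with G H t ts \<xi> \<and>
        borel_on_paths k G \<mu> \<and>
        (\<forall>l\<in>mor G. emeasure \<mu> (cyl k G l) = ennreal (Re (hip H \<xi> (t l (ts l \<xi>)))))
      \<longrightarrow> (\<exists>f. proj_system k G \<mu> f \<and> unit_equiv G H t (L2 \<mu>) (proj_rep k G f)))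
     \<and>
     (\<forall>(\<mu> :: 'a ipath measure) f Ss.
        borel_on_paths k G \<mu> \<and> proj_system k G \<mu> f \<and> CK_rep k G (L2 \<mu>) (proj_rep k G f) Ss
      \<longrightarrow> (\<exists>\<xi>. monic_with G (L2 \<mu>) (proj_rep k G f) Ss \<xi>))"
proof (intro conjI allI impI; elim conjE)
  fix H :: "'h hspace" and t ts \<xi> and \<mu> :: "'a ipath measure"
  assume "is_hilbert_sp H" "hdefinite H" "CK_rep k G H t ts" "monic_with G H t ts \<xi>"
    "borel_on_paths k G \<mu>"
    "\<forall>l\<in>mor G. emeasure \<mu> (cyl k G l) = ennreal (Re (hip H \<xi> (t l (ts l \<xi>))))"
  then have "monic_rep k G \<mu> H t ts \<xi>"
    by unfold_locales (use kg fin in auto)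
  then show "\<exists>f. proj_system k G \<mu> f \<and> unit_equiv G H t (L2 \<mu>) (proj_rep k G f)"
    by (rule monic_rep_unit_equiv)
next
  fix \<mu> :: "'a ipath measure" and f Ss
  assume "borel_on_paths k G \<mu>" "proj_system k G \<mu> f" "CK_rep k G (L2 \<mu>) (proj_rep k G f) Ss"
  moreover have "kgr k G" using kg fin by unfold_locales
  ultimately show "\<exists>\<xi>. monic_with G (L2 \<mu>) (proj_rep k G f) Ss \<xi>"
    using proj_rep_monic by blast
qed

end
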